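(* Let $\Omega$ be a domain in $\mathbb{C}^2$ (coordinates $(w,z)$) with smooth boundary. Fix a boundary point $p \in \partial\Omega$ and an integer $r>0$. Assume that the outward unit normal vector of $\partial\Omega$ at $p$ is $(1,0)$. Then there are a neighborhood $U$ of $p$ and a continuous map $\Psi : (\partial\Omega\cap U)\times\mathbb{C}^2 \to \mathbb{C}^2$ which satisfies, for each $q\in\partial\Omega\cap U$, the following properties: (1) The map $\Psi_q := \Psi(q,\cdot)$ is the composition of a translation, a dilation and a triangular map. (2) $\Psi_q(q) = (0,0)$. (3) Locally at $(0,0)$, the domain $\Psi_q(\Omega\cap U)$ is represented by $$\left\{(w,z) \;\middle|\; \mathrm{Re}\,w + P(z,\bar z) + R(z,\bar z) + \mathrm{Im}\left(\frac{w}{c}\right) Q\left(\mathrm{Im}\left(\frac{w}{c}\right), z,\bar z\right) < 0\right\},$$ where (all depending on $q$) $P$ is a real-valued polynomial of degree at most $r$ with no harmonic terms, $c=c(q)$ is a constant satisfying $\mathrm{Re}\,c\neq 0$ and $\lim_{q\to p}c(q)=1$, and $R$ and $Q$ are real-valued smooth functions with $\nu(R(z,\bar z))>r$ and $\nu\left(Q\left(\mathrm{Im}\left(\frac{w}{c}\right),z,\bar z\right)\right)\ge 1$. Moreover, if the point $q\in\partial\Omega\cap U$ is pseudoconvex of finite type $2k$ and $r=2k$, then $P$ is a homogeneous polynomial of degree $2k$.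
   Context: $\nu(f)$ denotes the order of vanishing of $f$ at the origin. A dilation is a map $(w,z)\mapsto(\lambda w,\mu z)$ with nonzero complex constants $\lambda,\mu$; a triangular map is a map $(w,z)\mapsto(w+h(z),z)$ with $h$ a holomorphic polynomial. A polynomial $P(z,\bar z)$ has no harmonic terms if it contains no pure monomials $z^m$ or $\bar z^m$, $m\ge0$. Finite type is in the sense of D'Angelo: for a local defining function $\rho$ of $\Omega$ at $q\in\partial\Omega$, the type is $\Delta(q):=\sup_h\frac{\nu(\rho\circ h)}{\nu(h-q)}$, the supremum over all nontrivial (nonconstant) analytic discs $h$ in $\mathbb{C}^2$ with $h(0)=q$; $q$ is of finite type $2k$ if $\Delta(q)=2k$. *)

theory Defs
  imports "HOL-Complex_Analysis.Complex_Analysis" "HOL-Computational_Algebra.Polynomial"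
begin

type_synonym complex2 = "complex \<times> complex"

section \<open>Smoothness and order of vanishing\<close>

primrec iter_deriv :: "'a list \<Rightarrow> ('a::real_normed_vector \<Rightarrow> 'b::real_normed_vector) \<Rightarrow> 'a \<Rightarrow> 'b" where
  "iter_deriv [] f = f"
| "iter_deriv (v # vs) f = iter_deriv vs (\<lambda>x. frechet_derivative f (at x) v)"

text \<open>
  On an open subset of a finite-dimensional space this is the class of infinitely often
  (real) differentiable maps; it is only used for open \<open>S\<close>. A smooth function
  \<open>R(z, cnj z)\<close> of a complex variable is a map on \<open>complex\<close> that is smooth in this real sense.
\<close>
definition smooth_on :: "'a::real_normed_vector set \<Rightarrow> ('a \<Rightarrow> 'b::real_normed_vector) \<Rightarrow> bool" where
  "smooth_on S f \<longleftrightarrow> (\<forall>vs. \<forall>x\<in>S. iter_deriv vs f differentiable (at x))"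

text \<open>
  The least order of a derivative, equivalently of a nonzero term of the Taylor series, that does
  not vanish at the origin; \<open>\<infinity>\<close> if there is none. Meant for maps smooth near the origin.
\<close>
definition vanishing_order :: "('a::real_normed_vector \<Rightarrow> 'b::real_normed_vector) \<Rightarrow> enat" where
  "vanishing_order f = (INF vs\<in>{vs. iter_deriv vs f 0 \<noteq> 0}. enat (length vs))"

section \<open>Domains with smooth boundary\<close>

definition local_defining_function ::
    "complex2 set \<Rightarrow> complex2 \<Rightarrow> complex2 set \<Rightarrow> (complex2 \<Rightarrow> real) \<Rightarrow> bool" where
  "local_defining_function \<Omega> q V \<rho> \<longleftrightarrow>
     open V \<and> q \<in> V \<and> smooth_on V \<rho> \<and>
     (\<forall>x\<in>V. (x \<in> \<Omega> \<longleftrightarrow> \<rho> x < 0) \<and> (x \<in> frontier \<Omega> \<longleftrightarrow> \<rho> x = 0)) \<and>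
     (\<forall>x\<in>V \<inter> frontier \<Omega>. frechet_derivative \<rho> (at x) \<noteq> (\<lambda>_. 0))"

definition smooth_boundary :: "complex2 set \<Rightarrow> bool" where
  "smooth_boundary \<Omega> \<longleftrightarrow> (\<forall>q\<in>frontier \<Omega>. \<exists>V \<rho>. local_defining_function \<Omega> q V \<rho>)"

text \<open>The normalised gradient of a defining function; it does not depend on the function.\<close>
definition outward_unit_normal :: "complex2 set \<Rightarrow> complex2 \<Rightarrow> complex2 \<Rightarrow> bool" where
  "outward_unit_normal \<Omega> p n \<longleftrightarrow>
     (\<exists>V \<rho> g. local_defining_function \<Omega> p V \<rho> \<and> (GDERIV \<rho> p :> g) \<and> n = sgn g)"

section \<open>Pseudoconvexity\<close>

text \<open>
  For \<open>e = (1,0)\<close> and \<open>e = (0,1)\<close> these are the Wirtinger derivatives with respect to the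
  coordinates \<open>w\<close> and \<open>z\<close>, and to their conjugates.
\<close>
definition wirtinger :: "complex2 \<Rightarrow> (complex2 \<Rightarrow> complex) \<Rightarrow> complex2 \<Rightarrow> complex" where
  "wirtinger e f x =
     (frechet_derivative f (at x) e
      - \<i> * frechet_derivative f (at x) (\<i> * fst e, \<i> * snd e)) / 2"

definition wirtinger_bar :: "complex2 \<Rightarrow> (complex2 \<Rightarrow> complex) \<Rightarrow> complex2 \<Rightarrow> complex" where
  "wirtinger_bar e f x =
     (frechet_derivative f (at x) e
      + \<i> * frechet_derivative f (at x) (\<i> * fst e, \<i> * snd e)) / 2"

definition complex_tangent :: "(complex2 \<Rightarrow> real) \<Rightarrow> complex2 \<Rightarrow> complex2 \<Rightarrow> bool" where
  "complex_tangent \<rho> x \<xi> \<longleftrightarrow>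
     wirtinger (1, 0) (\<lambda>y. of_real (\<rho> y)) x * fst \<xi>
     + wirtinger (0, 1) (\<lambda>y. of_real (\<rho> y)) x * snd \<xi> = 0"

text \<open>The form is Hermitian, so taking the real part loses nothing.\<close>
definition levi_form :: "(complex2 \<Rightarrow> real) \<Rightarrow> complex2 \<Rightarrow> complex2 \<Rightarrow> real" where
  "levi_form \<rho> x \<xi> =
     (let L = (\<lambda>e e'. wirtinger e (wirtinger_bar e' (\<lambda>y. of_real (\<rho> y))) x);
          e1 = (1, 0); e2 = (0, 1); a = fst \<xi>; b = snd \<xi>
      in Re (L e1 e1 * a * cnj a + L e1 e2 * a * cnj b
             + L e2 e1 * b * cnj a + L e2 e2 * b * cnj b))"

text \<open>
  The boundary is Levi pseudoconvex at all its points near \<open>q\<close>, not merely at \<open>q\<close> itself.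
\<close>
definition pseudoconvex_point :: "complex2 set \<Rightarrow> complex2 \<Rightarrow> bool" where
  "pseudoconvex_point \<Omega> q \<longleftrightarrow>
     (\<exists>V \<rho>. local_defining_function \<Omega> q V \<rho> \<and>
        (\<forall>x\<in>V \<inter> frontier \<Omega>. \<forall>\<xi>. complex_tangent \<rho> x \<xi> \<longrightarrow> levi_form \<rho> x \<xi> \<ge> 0))"

section \<open>Finite type in the sense of D'Angelo\<close>

definition analytic_disc :: "(complex \<Rightarrow> complex2) \<Rightarrow> complex2 \<Rightarrow> bool" where
  "analytic_disc h q \<longleftrightarrow>
     (\<lambda>\<zeta>. fst (h \<zeta>)) holomorphic_on ball 0 1 \<and> (\<lambda>\<zeta>. snd (h \<zeta>)) holomorphic_on ball 0 1 \<and>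
     h 0 = q \<and> \<not> h constant_on ball 0 1"

definition dangelo_type :: "(complex2 \<Rightarrow> real) \<Rightarrow> complex2 \<Rightarrow> ereal" where
  "dangelo_type \<rho> q =
     (SUP h\<in>{h. analytic_disc h q}.
        ereal_of_enat (vanishing_order (\<rho> \<circ> h)) / ereal_of_enat (vanishing_order (\<lambda>\<zeta>. h \<zeta> - q)))"

text \<open>The type does not depend on the choice of the local defining function.\<close>
definition of_finite_type :: "complex2 set \<Rightarrow> complex2 \<Rightarrow> nat \<Rightarrow> bool" where
  "of_finite_type \<Omega> q m \<longleftrightarrow>
     (\<exists>V \<rho>. local_defining_function \<Omega> q V \<rho> \<and> dangelo_type \<rho> q = ereal (real m))"

section \<open>Coordinate changes\<close>

definition translation_map :: "complex2 \<Rightarrow> complex2 \<Rightarrow> complex2" where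
  "translation_map a x = x + a"

definition dilation_map :: "complex \<Rightarrow> complex \<Rightarrow> complex2 \<Rightarrow> complex2" where
  "dilation_map l m = (\<lambda>(w, z). (l * w, m * z))"

definition triangular_map :: "complex poly \<Rightarrow> complex2 \<Rightarrow> complex2" where
  "triangular_map h = (\<lambda>(w, z). (w + poly h z, z))"

text \<open>
  The order of composition is immaterial: moving a translation or a dilation past a triangular
  map yields maps of the same kinds.
\<close>
definition translation_dilation_triangular :: "(complex2 \<Rightarrow> complex2) \<Rightarrow> bool" where
  "translation_dilation_triangular F \<longleftrightarrow>
     (\<exists>a l m h. l \<noteq> 0 \<and> m \<noteq> 0 \<and> F = triangular_map h \<circ> dilation_map l m \<circ> translation_map a)"

section \<open>Polynomials in a complex variable and its conjugate\<close>

text \<open>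
  A polynomial \<open>P(z, cnj z)\<close> is a polynomial in \<open>cnj z\<close> over the polynomials in \<open>z\<close>; the coefficient of
  \<open>z^i (cnj z)^j\<close> is \<open>coeff (coeff P j) i\<close>.
\<close>
definition zzbar_eval :: "complex poly poly \<Rightarrow> complex \<Rightarrow> complex" where
  "zzbar_eval P z = poly (poly P [:cnj z:]) z"

definition zzbar_real_valued :: "complex poly poly \<Rightarrow> bool" where
  "zzbar_real_valued P \<longleftrightarrow> (\<forall>z. zzbar_eval P z \<in> \<real>)"

definition zzbar_degree_le :: "nat \<Rightarrow> complex poly poly \<Rightarrow> bool" where
  "zzbar_degree_le r P \<longleftrightarrow> (\<forall>i j. coeff (coeff P j) i \<noteq> 0 \<longrightarrow> i + j \<le> r)"

definition no_harmonic_terms :: "complex poly poly \<Rightarrow> bool" where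
  "no_harmonic_terms P \<longleftrightarrow> (\<forall>m. coeff (coeff P 0) m = 0 \<and> coeff (coeff P m) 0 = 0)"

text \<open>The zero polynomial is not regarded as homogeneous of degree \<open>d\<close>.\<close>
definition zzbar_homogeneous :: "nat \<Rightarrow> complex poly poly \<Rightarrow> bool" where
  "zzbar_homogeneous d P \<longleftrightarrow> P \<noteq> 0 \<and> (\<forall>i j. coeff (coeff P j) i \<noteq> 0 \<longrightarrow> i + j = d)"

end

theory Submission
  imports Defs
begin

text \<open>
  Since the normal at \<open>p\<close> is \<open>(1, 0)\<close>, the boundary near \<open>p\<close> is a graph \<open>Re w = \<phi> (Im w, z)\<close> with \<open>\<phi>\<close> smooth
  (\<open>smooth_boundary_graph\<close>). Let \<open>q = (q\<^sub>1, q\<^sub>2)\<close> be a boundary point and \<open>y = (Im q\<^sub>1, q\<^sub>2)\<close>. For a polynomial \<open>h\<close>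
  with \<open>h 0 = 0\<close> the coordinates \<open>w - q\<^sub>1 + h (z - q\<^sub>2)\<close> and \<open>z - q\<^sub>2\<close> turn \<open>\<phi>\<close> into
  \<open>\<phi>~ (t, z) = \<phi> (Im q\<^sub>1 + t - Im (h z), q\<^sub>2 + z) - \<phi> y + Re (h z)\<close>. Write
  \<open>\<phi>~ (t, z) = \<phi>~ (0, z) + a t + t N (t, z)\<close> with \<open>a = \<partial>\<phi>/\<partial>t\<close> at \<open>y\<close> and \<open>N\<close> smooth, \<open>N (0, 0) = 0\<close>
  (\<open>hadamard_quotient\<close>). As \<open>Re w - a Im w = Re (c w)\<close> for \<open>c = 1 + \<i> a\<close>, the dilation of \<open>w\<close> by \<open>c\<close> gives the domain
  the form \<open>Re w - \<phi>~ (0, z) - Im (w / c) N (Im (w / c), z) < 0\<close>. That the shear precedes the dilation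
  makes the last term a function of \<open>Im (w / c)\<close> and \<open>z\<close> alone; the price is that \<open>h\<close> enters
  \<open>\<phi>~ (0, z)\<close> nonlinearly.

  It remains to choose \<open>h\<close> such that the Taylor polynomial of degree \<open>r\<close> of \<open>\<phi>~ (0, \<cdot>)\<close> has no harmonic terms.
  Adding \<open>\<beta> z\<^sup>n\<close> to \<open>h\<close> changes \<open>\<phi>~ (0, z)\<close> by \<open>Re (c \<beta> z\<^sup>n)\<close> up to terms of higher order
  (\<open>sheared_add_monomial\<close>), and \<open>c \<noteq> 0\<close>; so the coefficients of \<open>h\<close> are determined one after the other
  (\<open>exists_shear\<close>). They come out as smooth functions of \<open>y\<close>, whence the continuity of \<open>\<Psi>\<close>.

  For the finite type, let \<open>m \<le> r\<close> be the degree of the lowest homogeneous part of \<open>\<phi>~ (0, \<cdot>)\<close>. The disc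
  \<open>w = 0\<close> in the new coordinates shows that the type is at least \<open>m\<close>. On an arbitrary disc \<open>(W, Z)\<close> the lowest
  order part of \<open>\<phi>~ (0, Z)\<close> contains no harmonic terms and hence cannot be cancelled by the harmonic
  function \<open>Re (c W)\<close>, which shows that the type is at most \<open>m\<close> (\<open>disc_order_bound\<close>). So if the type is \<open>r\<close>,
  then \<open>P\<close> consists of its part of degree \<open>r\<close> only, and this part is not zero: if all parts of degree at most
  \<open>r\<close> vanished, then the disc \<open>w = 0\<close> would show that the type exceeds \<open>r\<close>.

  The orders of vanishing are defined by iterated derivatives; for smooth maps they are the growth rates
  at the origin (\<open>enat_le_vanishing_order_iff_vanishes_to_order\<close>). Therefore any defining function
  may be replaced by \<open>Re w - \<phi> (Im w, z)\<close>, to which it is comparable (\<open>defining_function_comparable\<close>).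
\<close>


section \<open>Calculus of smooth maps\<close>

text \<open>Smoothness is closed under taking directional derivatives, so its closure properties are
  obtained by deriving once and appealing to the property for fewer derivatives. The order of
  differentiability is made explicit below to turn this into an induction.\<close>

definition dir_deriv :: "'a::real_normed_vector \<Rightarrow> ('a \<Rightarrow> 'b::real_normed_vector) \<Rightarrow> 'a \<Rightarrow> 'b" where
  "dir_deriv v f = (\<lambda>x. frechet_derivative f (at x) v)"

lemma iter_deriv_Cons: "iter_deriv (v # vs) f = iter_deriv vs (dir_deriv v f)"
  by (simp add: dir_deriv_def)

lemma dir_deriv_eq: "(f has_derivative D) (at x) \<Longrightarrow> dir_deriv v f x = D v"
  using frechet_derivative_at dir_deriv_def by metis

lemma has_derivative_dir_deriv:
  "f differentiable (at x) \<Longrightarrow> (f has_derivative (\<lambda>v. dir_deriv v f x)) (at x)"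
  unfolding dir_deriv_def by (simp add: frechet_derivative_works[symmetric])

lemma has_derivative_cong_open:
  assumes "open S" "x \<in> S" "\<And>y. y \<in> S \<Longrightarrow> f y = g y"
  shows "(f has_derivative D) (at x) \<longleftrightarrow> (g has_derivative D) (at x)"
  using assms has_derivative_transform_within_open[of f D x UNIV S g]
    has_derivative_transform_within_open[of g D x UNIV S f] by auto

lemma differentiable_cong_open:
  assumes "open S" "x \<in> S" "\<And>y. y \<in> S \<Longrightarrow> f y = g y"
  shows "f differentiable (at x) \<longleftrightarrow> g differentiable (at x)"
  unfolding differentiable_def by (simp add: has_derivative_cong_open[of S x f g, OF assms])

lemma dir_deriv_cong_open:
  assumes "open S" "x \<in> S" "\<And>y. y \<in> S \<Longrightarrow> f y = g y"
  shows "dir_deriv v f x = dir_deriv v g x"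
  unfolding dir_deriv_def frechet_derivative_def
  by (simp add: has_derivative_cong_open[of S x f g, OF assms])

lemma iter_deriv_cong_open:
  assumes "open S" "x \<in> S" "\<And>y. y \<in> S \<Longrightarrow> f y = g y"
  shows "iter_deriv vs f x = iter_deriv vs g x"
  using assms(3)
proof (induction vs arbitrary: f g)
  case Nil
  then show ?case using assms(2) by simp
next
  case (Cons v vs)
  have "\<And>y. y \<in> S \<Longrightarrow> dir_deriv v f y = dir_deriv v g y"
    using dir_deriv_cong_open[OF assms(1)] Cons.prems by blast
  then show ?case
    unfolding iter_deriv_Cons by (rule Cons.IH)
qed

lemma onorm_scaleR_left_le: "norm v \<le> M \<Longrightarrow> onorm (\<lambda>r::real. r *\<^sub>R v) \<le> M"
  by (rule onorm_le) (simp add: mult.commute[of M] mult_left_mono)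

definition Ck_on :: "nat \<Rightarrow> 'a::real_normed_vector set \<Rightarrow> ('a \<Rightarrow> 'b::real_normed_vector) \<Rightarrow> bool" where
  "Ck_on n S f \<longleftrightarrow> (\<forall>vs. length vs \<le> n \<longrightarrow> (\<forall>x\<in>S. iter_deriv vs f differentiable (at x)))"

lemma smooth_on_iff_Ck: "smooth_on S f \<longleftrightarrow> (\<forall>n. Ck_on n S f)"
  unfolding smooth_on_def Ck_on_def by blast

lemma Ck_on_0: "Ck_on 0 S f \<longleftrightarrow> (\<forall>x\<in>S. f differentiable (at x))"
  unfolding Ck_on_def by simp

lemma Ck_on_Suc:
  "Ck_on (Suc n) S f \<longleftrightarrow> (\<forall>x\<in>S. f differentiable (at x)) \<and> (\<forall>v. Ck_on n S (dir_deriv v f))"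
  (is "?L = ?R")
proof
  assume L: ?L
  have "Ck_on n S (dir_deriv v f)" for v
    unfolding Ck_on_def
  proof (intro allI impI ballI)
    fix vs :: "'a list" and x assume "length vs \<le> n" "x \<in> S"
    then have "iter_deriv (v # vs) f differentiable (at x)"
      using L unfolding Ck_on_def by (auto simp del: iter_deriv.simps)
    then show "iter_deriv vs (dir_deriv v f) differentiable (at x)"
      by (simp only: iter_deriv_Cons)
  qed
  moreover have "f differentiable (at x)" if "x \<in> S" for x
    using L that unfolding Ck_on_def by (metis iter_deriv.simps(1) le0 list.size(3))
  ultimately show ?R by blast
next
  assume R: ?R
  show ?L unfolding Ck_on_def
  proof (intro allI impI ballI)
    fix vs :: "'a list" and x assume "length vs \<le> Suc n" "x \<in> S"
    then show "iter_deriv vs f differentiable (at x)"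
      using R by (cases vs) (auto simp: iter_deriv_Cons Ck_on_def simp del: iter_deriv.simps(2))
  qed
qed

lemma Ck_on_mono: "Ck_on n S f \<Longrightarrow> m \<le> n \<Longrightarrow> Ck_on m S f"
  unfolding Ck_on_def by auto

lemma Ck_on_differentiable: "Ck_on n S f \<Longrightarrow> x \<in> S \<Longrightarrow> f differentiable (at x)"
  by (metis Ck_on_0 Ck_on_mono le0)

lemma Ck_on_cong:
  assumes "open S" "\<And>y. y \<in> S \<Longrightarrow> f y = g y"
  shows "Ck_on n S f \<longleftrightarrow> Ck_on n S g"
proof -
  have "iter_deriv vs f differentiable (at x) \<longleftrightarrow> iter_deriv vs g differentiable (at x)"
    if "x \<in> S" for vs x
    by (rule differentiable_cong_open[OF assms(1) that]) (rule iter_deriv_cong_open[OF assms(1) _ assms(2)])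
  then show ?thesis unfolding Ck_on_def by blast
qed

text \<open>The form in which the induction step is used: any formula for the derivative on \<open>S\<close> will do,
  although off \<open>S\<close> it may differ from \<open>dir_deriv\<close>.\<close>

lemma Ck_on_SucI:
  assumes "open S" and D: "\<And>x. x \<in> S \<Longrightarrow> (f has_derivative f' x) (at x)"
    and C: "\<And>v. Ck_on n S (\<lambda>x. f' x v)"
  shows "Ck_on (Suc n) S f"
  unfolding Ck_on_Suc
proof (intro conjI ballI allI)
  fix v
  show "Ck_on n S (dir_deriv v f)"
    by (subst Ck_on_cong[OF assms(1) dir_deriv_eq[OF D]]) (assumption, rule C)
next
  fix x assume "x \<in> S"
  then show "f differentiable (at x)"
    unfolding differentiable_def using D by blast
qed

lemma Ck_on_0I:
  "(\<And>x. x \<in> S \<Longrightarrow> (f has_derivative f' x) (at x)) \<Longrightarrow> Ck_on 0 S f"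
  unfolding Ck_on_0 differentiable_def by blast

lemma Ck_on_has_derivative:
  "Ck_on n S f \<Longrightarrow> x \<in> S \<Longrightarrow> (f has_derivative (\<lambda>v. dir_deriv v f x)) (at x)"
  by (rule has_derivative_dir_deriv) (rule Ck_on_differentiable)

lemma Ck_on_Suc_dir_deriv: "Ck_on (Suc n) S f \<Longrightarrow> Ck_on n S (dir_deriv v f)"
  by (simp add: Ck_on_Suc)

lemma Ck_on_SucD: "Ck_on (Suc n) S f \<Longrightarrow> Ck_on n S f"
  by (erule Ck_on_mono) simp

lemma Ck_on_const: "Ck_on n S (\<lambda>x. c)"
proof (induction n arbitrary: c)
  case 0
  then show ?case by (simp add: Ck_on_0)
next
  case (Suc n)
  have "dir_deriv v (\<lambda>x::'a. c) = (\<lambda>x. 0)" for v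
    by (rule ext) (rule dir_deriv_eq, rule has_derivative_const)
  then show ?case by (auto simp: Ck_on_Suc intro: Suc.IH)
qed

lemma Ck_on_add:
  assumes "open S"
  shows "Ck_on n S f \<Longrightarrow> Ck_on n S g \<Longrightarrow> Ck_on n S (\<lambda>x. f x + g x)"
proof (induction n arbitrary: f g)
  case 0
  then show ?case by (simp add: Ck_on_0)
next
  case (Suc n)
  show ?case
    by (rule Ck_on_SucI[OF assms has_derivative_add])
      (assumption | rule Suc.prems Ck_on_has_derivative Suc.IH Ck_on_Suc_dir_deriv)+
qed

lemma Ck_on_sum:
  assumes "open S" "finite I" "\<And>i. i \<in> I \<Longrightarrow> Ck_on n S (f i)"
  shows "Ck_on n S (\<lambda>x. \<Sum>i\<in>I. f i x)"
  using assms(2,3)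
  by (induction I rule: finite_induct) (auto intro!: Ck_on_const Ck_on_add[OF assms(1)])

lemma Ck_on_bounded_linear:
  assumes "open S" "bounded_linear L"
  shows "Ck_on n S f \<Longrightarrow> Ck_on n S (\<lambda>x. L (f x))"
proof (induction n arbitrary: f)
  case 0
  then show ?case
    by (rule Ck_on_0I[OF bounded_linear.has_derivative[OF assms(2) Ck_on_has_derivative]])
next
  case (Suc n)
  show ?case
    by (rule Ck_on_SucI[OF assms(1) bounded_linear.has_derivative[OF assms(2)]])
      (assumption | rule Suc.prems Ck_on_has_derivative Suc.IH Ck_on_Suc_dir_deriv)+
qed

lemma Ck_on_ident: "Ck_on n S (\<lambda>x. x)"
proof (cases n)
  case (Suc m)
  have "dir_deriv v (\<lambda>x::'a. x) = (\<lambda>x. v)" for v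
    by (rule ext) (rule dir_deriv_eq, rule has_derivative_ident)
  then show ?thesis unfolding Suc Ck_on_Suc by (simp add: Ck_on_const)
qed (simp add: Ck_on_0)

lemma Ck_on_bilinear:
  assumes "open S" "bounded_bilinear B"
  shows "Ck_on n S f \<Longrightarrow> Ck_on n S g \<Longrightarrow> Ck_on n S (\<lambda>x. B (f x) (g x))"
proof (induction n arbitrary: f g)
  case 0
  show ?case
    by (rule Ck_on_0I[OF bounded_bilinear.FDERIV[OF assms(2)]])
      (assumption | rule 0 Ck_on_has_derivative)+
next
  case (Suc n)
  show ?case
    by (rule Ck_on_SucI[OF assms(1) bounded_bilinear.FDERIV[OF assms(2)]])
      (assumption | rule Suc.prems Ck_on_has_derivative Ck_on_add[OF assms(1)] Suc.IH
        Ck_on_Suc_dir_deriv Ck_on_SucD)+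
qed

lemma dir_deriv_expand:
  fixes g :: "'b::euclidean_space \<Rightarrow> 'c::real_normed_vector"
  assumes "g differentiable (at x)"
  shows "dir_deriv v g x = (\<Sum>b\<in>Basis. (v \<bullet> b) *\<^sub>R dir_deriv b g x)"
proof -
  note L = has_derivative_linear[OF has_derivative_dir_deriv[OF assms]]
  have "dir_deriv v g x = dir_deriv (\<Sum>b\<in>Basis. (v \<bullet> b) *\<^sub>R b) g x"
    by (simp add: euclidean_representation)
  also have "\<dots> = (\<Sum>b\<in>Basis. (v \<bullet> b) *\<^sub>R dir_deriv b g x)"
    by (simp only: linear_sum[OF L] linear_scale[OF L])
  finally show ?thesis .
qed

text \<open>By the chain rule a derivative of a composition is bilinear in a derivative of the inner
  map and the compositions of the partial derivatives of the outer map with the inner one.\<close>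

lemma Ck_on_compose:
  fixes f :: "'a::real_normed_vector \<Rightarrow> 'b::euclidean_space" and g :: "'b \<Rightarrow> 'c::real_normed_vector"
  assumes "open S" "f ` S \<subseteq> T"
  shows "Ck_on n S f \<Longrightarrow> Ck_on n T g \<Longrightarrow> Ck_on n S (\<lambda>x. g (f x))"
proof (induction n arbitrary: g)
  case 0
  then show ?case unfolding Ck_on_0
    using assms(2) differentiable_compose[of g f] by (simp add: image_subset_iff)
next
  case (Suc n)
  note D = Ck_on_has_derivative[OF Suc.prems(1)] Ck_on_has_derivative[OF Suc.prems(2)]
  have g: "g differentiable (at (f x))" if "x \<in> S" for x
    using Ck_on_differentiable[OF Suc.prems(2)] assms(2) that by blast
  have "((\<lambda>x. g (f x)) has_derivative
      (\<lambda>v. \<Sum>b\<in>Basis. (dir_deriv v f x \<bullet> b) *\<^sub>R dir_deriv b g (f x))) (at x)" if "x \<in> S" for x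
    unfolding dir_deriv_expand[OF g[OF that], symmetric]
    by (rule has_derivative_compose[OF D(1)[OF that] has_derivative_dir_deriv[OF g[OF that]]])
  moreover have "Ck_on n S (\<lambda>x. \<Sum>b\<in>Basis. (dir_deriv v f x \<bullet> b) *\<^sub>R dir_deriv b g (f x))" for v
    by (intro Ck_on_sum[OF assms(1)] Ck_on_bilinear[OF assms(1) bounded_bilinear_scaleR]
        Suc.IH Ck_on_SucD[OF Suc.prems(1)] Ck_on_bilinear[OF assms(1) bounded_bilinear_inner]
        Ck_on_const Ck_on_Suc_dir_deriv Suc.prems finite_Basis)
  ultimately show ?case by (rule Ck_on_SucI[OF assms(1)])
qed

lemma Ck_on_inverse:
  fixes f :: "'a::real_normed_vector \<Rightarrow> 'b::real_normed_field"
  assumes "open S" "\<And>x. x \<in> S \<Longrightarrow> f x \<noteq> 0"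
  shows "Ck_on n S f \<Longrightarrow> Ck_on n S (\<lambda>x. inverse (f x))"
proof (induction n)
  case 0
  show ?case
    by (rule Ck_on_0I[OF Deriv.has_derivative_inverse[OF assms(2) Ck_on_has_derivative[OF 0]]])
next
  case (Suc n)
  note i = Suc.IH[OF Ck_on_SucD[OF Suc.prems]]
  show ?case
    by (rule Ck_on_SucI[OF assms(1)
          Deriv.has_derivative_inverse[OF assms(2) Ck_on_has_derivative[OF Suc.prems]]])
      (auto intro!: i Ck_on_bounded_linear[OF assms(1) bounded_linear_minus[OF bounded_linear_ident]]
        Ck_on_bilinear[OF assms(1) bounded_bilinear_mult] Ck_on_Suc_dir_deriv[OF Suc.prems])
qed

lemma smooth_on_differentiable: "smooth_on S f \<Longrightarrow> x \<in> S \<Longrightarrow> f differentiable (at x)"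
  unfolding smooth_on_iff_Ck using Ck_on_differentiable by blast

lemma smooth_on_has_derivative:
  "smooth_on S f \<Longrightarrow> x \<in> S \<Longrightarrow> (f has_derivative (\<lambda>v. dir_deriv v f x)) (at x)"
  using smooth_on_differentiable has_derivative_dir_deriv by blast

lemma smooth_on_dir_deriv: "smooth_on S f \<Longrightarrow> smooth_on S (dir_deriv v f)"
  unfolding smooth_on_iff_Ck using Ck_on_Suc by blast

lemma smooth_on_subset: "smooth_on S f \<Longrightarrow> T \<subseteq> S \<Longrightarrow> smooth_on T f"
  unfolding smooth_on_def by blast

lemma smooth_on_continuous_on: "smooth_on S f \<Longrightarrow> continuous_on S f"
  by (meson continuous_at_imp_continuous_on differentiable_imp_continuous_within smooth_on_differentiable)

named_theorems smooth_intros

lemma smooth_on_const [smooth_intros]: "smooth_on S (\<lambda>x. c)"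
  unfolding smooth_on_iff_Ck using Ck_on_const by blast

lemma smooth_on_ident [smooth_intros]: "smooth_on S (\<lambda>x. x)"
  unfolding smooth_on_iff_Ck using Ck_on_ident by blast

lemma smooth_on_add [smooth_intros]:
  "smooth_on S f \<Longrightarrow> smooth_on S g \<Longrightarrow> open S \<Longrightarrow> smooth_on S (\<lambda>x. f x + g x)"
  unfolding smooth_on_iff_Ck using Ck_on_add by blast

lemma smooth_on_sum [smooth_intros]:
  "(\<And>i. i \<in> I \<Longrightarrow> smooth_on S (f i)) \<Longrightarrow> finite I \<Longrightarrow> open S \<Longrightarrow> smooth_on S (\<lambda>x. \<Sum>i\<in>I. f i x)"
  unfolding smooth_on_iff_Ck using Ck_on_sum[of S I _ f] by blast

lemma smooth_on_bounded_linear: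
  "bounded_linear L \<Longrightarrow> smooth_on S f \<Longrightarrow> open S \<Longrightarrow> smooth_on S (\<lambda>x. L (f x))"
  unfolding smooth_on_iff_Ck using Ck_on_bounded_linear by blast

lemmas smooth_on_Re [smooth_intros] = smooth_on_bounded_linear[OF bounded_linear_Re]
lemmas smooth_on_Im [smooth_intros] = smooth_on_bounded_linear[OF bounded_linear_Im]
lemmas smooth_on_cnj [smooth_intros] = smooth_on_bounded_linear[OF bounded_linear_cnj]
lemmas smooth_on_of_real [smooth_intros] = smooth_on_bounded_linear[OF bounded_linear_of_real]
lemmas smooth_on_fst [smooth_intros] = smooth_on_bounded_linear[OF bounded_linear_fst]
lemmas smooth_on_snd [smooth_intros] = smooth_on_bounded_linear[OF bounded_linear_snd]
lemmas smooth_on_minus [smooth_intros] =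
  smooth_on_bounded_linear[OF bounded_linear_minus[OF bounded_linear_ident]]

lemma smooth_on_diff [smooth_intros]:
  "smooth_on S f \<Longrightarrow> smooth_on S g \<Longrightarrow> open S \<Longrightarrow> smooth_on S (\<lambda>x. f x - g x)"
  using smooth_on_add[of S f "\<lambda>x. - g x"] smooth_on_minus by auto

lemma smooth_on_bilinear:
  "bounded_bilinear B \<Longrightarrow> smooth_on S f \<Longrightarrow> smooth_on S g \<Longrightarrow> open S \<Longrightarrow> smooth_on S (\<lambda>x. B (f x) (g x))"
  unfolding smooth_on_iff_Ck using Ck_on_bilinear by blast

lemmas smooth_on_mult [smooth_intros] = smooth_on_bilinear[OF bounded_bilinear_mult]
lemmas smooth_on_scaleR [smooth_intros] = smooth_on_bilinear[OF bounded_bilinear_scaleR]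

lemma smooth_on_inverse:
  fixes f :: "'a::real_normed_vector \<Rightarrow> 'b::real_normed_field"
  shows "smooth_on S f \<Longrightarrow> open S \<Longrightarrow> (\<And>x. x \<in> S \<Longrightarrow> f x \<noteq> 0) \<Longrightarrow> smooth_on S (\<lambda>x. inverse (f x))"
  unfolding smooth_on_iff_Ck using Ck_on_inverse[of S f] by blast

lemma smooth_on_power [smooth_intros]:
  fixes f :: "'a::real_normed_vector \<Rightarrow> 'b::real_normed_field"
  shows "smooth_on S f \<Longrightarrow> open S \<Longrightarrow> smooth_on S (\<lambda>x. f x ^ n)"
  by (induction n) (auto intro!: smooth_intros)

lemma smooth_on_Pair [smooth_intros]:
  assumes "smooth_on S f" "smooth_on S g" "open S"
  shows "smooth_on S (\<lambda>x. (f x, g x))"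
proof -
  have "bounded_linear (\<lambda>a::'b. (a, 0::'c))" "bounded_linear (\<lambda>b::'c. (0::'b, b))"
    by (auto intro!: bounded_linear_Pair bounded_linear_ident bounded_linear_zero)
  then have "smooth_on S (\<lambda>x. (f x, 0) + (0, g x))"
    using smooth_on_add[OF smooth_on_bounded_linear smooth_on_bounded_linear] assms by fast
  then show ?thesis by simp
qed

lemma smooth_on_compose:
  fixes f :: "'a::real_normed_vector \<Rightarrow> 'b::euclidean_space" and g :: "'b \<Rightarrow> 'c::real_normed_vector"
  shows "smooth_on T g \<Longrightarrow> smooth_on S f \<Longrightarrow> open S \<Longrightarrow> f ` S \<subseteq> T \<Longrightarrow> smooth_on S (\<lambda>x. g (f x))"
  unfolding smooth_on_iff_Ck using Ck_on_compose by blast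

text \<open>All complex derivatives of a holomorphic map are holomorphic, and its real directional
  derivatives are multiples of the complex one.\<close>

lemma smooth_on_holomorphic:
  assumes "open S" "f holomorphic_on S"
  shows "smooth_on S f"
proof -
  have "Ck_on n S f" for n
    using assms(2)
  proof (induction n arbitrary: f)
    case 0
    then show ?case unfolding Ck_on_0 differentiable_def
      using assms(1) holomorphic_derivI has_field_derivative_imp_has_derivative by blast
  next
    case (Suc n)
    show ?case
    proof (rule Ck_on_SucI[OF assms(1)])
      show "(f has_derivative (*) (deriv f x)) (at x)" if "x \<in> S" for x
        using holomorphic_derivI[OF Suc.prems assms(1) that] has_field_derivative_imp_has_derivative by blast
      show "Ck_on n S (\<lambda>x. deriv f x * v)" for v
        by (intro Suc.IH holomorphic_intros holomorphic_deriv Suc.prems assms(1))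
    qed
  qed
  then show ?thesis unfolding smooth_on_iff_Ck by blast
qed

section \<open>The order of vanishing as a growth rate\<close>

text \<open>Growth rates, unlike iterated derivatives, are easily followed through compositions and
  comparisons of functions, so all orders of vanishing are computed with them.\<close>

definition vanishes_to_order :: "nat \<Rightarrow> ('a::real_normed_vector \<Rightarrow> 'b::real_normed_vector) \<Rightarrow> bool" where
  "vanishes_to_order n f \<longleftrightarrow> (\<exists>C. \<forall>\<^sub>F x in nhds 0. norm (f x) \<le> C * norm x ^ n)"

lemma vanishes_to_order_mono:
  assumes "vanishes_to_order n f" "m \<le> n"
  shows "vanishes_to_order m f"
proof -
  obtain C where "\<forall>\<^sub>F x in nhds 0. norm (f x) \<le> C * norm x ^ n"
    using assms(1) unfolding vanishes_to_order_def by blast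
  moreover have "\<forall>\<^sub>F x in nhds (0::'a). x \<in> ball 0 1"
    by (rule eventually_nhds_in_open) auto
  ultimately have "\<forall>\<^sub>F x in nhds 0. norm (f x) \<le> \<bar>C\<bar> * norm x ^ m"
  proof eventually_elim
    case (elim x)
    have "C * norm x ^ n \<le> \<bar>C\<bar> * norm x ^ m"
      using elim(2) assms(2) by (intro mult_mono power_decreasing) auto
    then show ?case using elim by simp
  qed
  then show ?thesis unfolding vanishes_to_order_def by blast
qed

lemma vanishes_to_order_comparable:
  assumes "vanishes_to_order n f" "\<forall>\<^sub>F x in nhds 0. norm (g x) \<le> A * norm (f x)"
  shows "vanishes_to_order n g"
proof -
  obtain C where "\<forall>\<^sub>F x in nhds 0. norm (f x) \<le> C * norm x ^ n"
    using assms(1) unfolding vanishes_to_order_def by blast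
  then have "\<forall>\<^sub>F x in nhds 0. norm (g x) \<le> (\<bar>A\<bar> * C) * norm x ^ n"
    using assms(2)
  proof eventually_elim
    case (elim x)
    have "A * norm (f x) \<le> \<bar>A\<bar> * (C * norm x ^ n)"
      using elim(1) by (intro mult_mono) auto
    then show ?case using elim by (simp add: mult.assoc)
  qed
  then show ?thesis unfolding vanishes_to_order_def by blast
qed

lemma vanishes_to_order_add:
  assumes "vanishes_to_order n f" "vanishes_to_order n g"
  shows "vanishes_to_order n (\<lambda>x. f x + g x)"
proof -
  obtain A B where "\<forall>\<^sub>F x in nhds 0. norm (f x) \<le> A * norm x ^ n" "\<forall>\<^sub>F x in nhds 0. norm (g x) \<le> B * norm x ^ n"
    using assms unfolding vanishes_to_order_def by blast
  then have "\<forall>\<^sub>F x in nhds 0. norm (f x + g x) \<le> (A + B) * norm x ^ n"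
    by eventually_elim (simp add: distrib_right norm_triangle_mono)
  then show ?thesis unfolding vanishes_to_order_def by blast
qed

lemma vanishes_to_order_sum:
  fixes f :: "'i \<Rightarrow> 'a::real_normed_vector \<Rightarrow> 'b::real_normed_vector"
  assumes "finite I" "\<And>i. i \<in> I \<Longrightarrow> vanishes_to_order n (f i)"
  shows "vanishes_to_order n (\<lambda>x. \<Sum>i\<in>I. f i x)"
  using assms
proof (induction I rule: finite_induct)
  case empty
  have "\<forall>\<^sub>F x in nhds 0. norm (0::'b) \<le> 0 * norm (x::'a) ^ n" by simp
  then show ?case unfolding vanishes_to_order_def sum.empty by blast
next
  case (insert i I)
  then show ?case by (simp add: vanishes_to_order_add)
qed

lemma enat_le_vanishing_order_iff:
  "enat n \<le> vanishing_order f \<longleftrightarrow> (\<forall>vs. length vs < n \<longrightarrow> iter_deriv vs f 0 = 0)"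
  unfolding vanishing_order_def le_INF_iff by (auto simp: not_less)

text \<open>By induction the first derivatives are \<open>O(\<bar>x\<bar>\<^sup>n)\<close>, and the mean value inequality on the
  segment from the origin gains one power.\<close>

lemma iter_deriv_0_imp_vanishes_to_order:
  fixes f :: "'a::euclidean_space \<Rightarrow> 'b::real_normed_vector"
  assumes S: "open S" "0 \<in> S"
  shows "smooth_on S f \<Longrightarrow> (\<And>vs. length vs < n \<Longrightarrow> iter_deriv vs f 0 = 0) \<Longrightarrow> vanishes_to_order n f"
proof (induction n arbitrary: f)
  case 0
  have "isCont f 0"
    using smooth_on_continuous_on[OF 0(1)] S continuous_on_eq_continuous_at by blast
  then have "\<forall>\<^sub>F x in nhds 0. norm (f x) < norm (f 0) + 1"
    by (intro order_tendstoD(2)[of _ "norm (f 0)"] tendsto_norm)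
      (auto simp: continuous_at tendsto_at_iff_tendsto_nhds)
  then have "\<forall>\<^sub>F x in nhds 0. norm (f x) \<le> (norm (f 0) + 1) * norm x ^ 0"
    by eventually_elim simp
  then show ?case unfolding vanishes_to_order_def by blast
next
  case (Suc n)
  have "vanishes_to_order n (dir_deriv b f)" for b
  proof (rule Suc.IH[OF smooth_on_dir_deriv[OF Suc.prems(1)]])
    fix vs :: "'a list" assume "length vs < n"
    then show "iter_deriv vs (dir_deriv b f) 0 = 0"
      using Suc.prems(2)[of "b # vs"] by (simp only: iter_deriv_Cons) simp
  qed
  then obtain C where C: "\<And>b. \<forall>\<^sub>F x in nhds 0. norm (dir_deriv b f x) \<le> C b * norm x ^ n"
    unfolding vanishes_to_order_def by metis
  have "\<forall>\<^sub>F x in nhds 0. x \<in> S \<and> (\<forall>b\<in>Basis. norm (dir_deriv b f x) \<le> C b * norm x ^ n)"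
    by (intro eventually_conj eventually_nhds_in_open S eventually_ball_finite finite_Basis ballI C)
  then obtain d where d: "d > 0" and dS: "\<And>x. dist x 0 < d \<Longrightarrow> x \<in> S"
    and dC: "\<And>x b. dist x 0 < d \<Longrightarrow> b \<in> Basis \<Longrightarrow> norm (dir_deriv b f x) \<le> C b * norm x ^ n"
    unfolding eventually_nhds_metric by metis
  define K where "K = (\<Sum>b\<in>Basis. \<bar>C b\<bar>)"
  have "norm (f x) \<le> K * norm x ^ Suc n" if x: "dist x 0 < d" for x
  proof -
    have "onorm (\<lambda>v. dir_deriv v f (0 + t *\<^sub>R x)) \<le> K * norm x ^ n" if t: "t \<in> {0..1}" for t
    proof (rule onorm_le)
      fix v
      let ?y = "0 + t *\<^sub>R x"
      have yx: "norm ?y \<le> norm x"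
        using t by (simp add: mult_left_le_one_le)
      then have y: "dist ?y 0 < d" using x by (simp add: dist_norm)
      have "norm (dir_deriv v f ?y) = norm (\<Sum>b\<in>Basis. (v \<bullet> b) *\<^sub>R dir_deriv b f ?y)"
        by (subst dir_deriv_expand[OF smooth_on_differentiable[OF Suc.prems(1) dS[OF y]]]) (rule refl)
      also have "\<dots> \<le> (\<Sum>b\<in>Basis. norm v * (\<bar>C b\<bar> * norm x ^ n))"
      proof (rule sum_norm_le)
        fix b :: 'a assume b: "b \<in> Basis"
        have "norm (dir_deriv b f ?y) \<le> C b * norm ?y ^ n"
          using dC[OF y b] .
        also have "\<dots> \<le> \<bar>C b\<bar> * norm x ^ n"
          using yx by (intro mult_mono power_mono) auto
        finally show "norm ((v \<bullet> b) *\<^sub>R dir_deriv b f ?y) \<le> norm v * (\<bar>C b\<bar> * norm x ^ n)"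
          unfolding norm_scaleR using b by (intro mult_mono) (auto simp: Basis_le_norm)
      qed
      also have "\<dots> = K * norm x ^ n * norm v"
        by (simp add: K_def sum_distrib_left sum_distrib_right mult_ac)
      finally show "norm (dir_deriv v f ?y) \<le> K * norm x ^ n * norm v" .
    qed
    then have "norm (f (0 + x) - f 0) \<le> norm x * (K * norm x ^ n)"
    proof (rule differentiable_bound_segment[where G="ball 0 d" and f'="\<lambda>y v. dir_deriv v f y", rotated 2])
      show "0 + t *\<^sub>R x \<in> ball 0 d" if "t \<in> {0..1}" for t
        using that x by (simp add: dist_norm) (meson le_less_trans mult_left_le_one_le norm_ge_zero)
      show "(f has_derivative (\<lambda>v. dir_deriv v f y)) (at y within ball 0 d)" if "y \<in> ball 0 d" for y
        by (rule has_derivative_at_withinI, rule smooth_on_has_derivative[OF Suc.prems(1)], rule dS)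
          (use that in \<open>simp add: dist_commute\<close>)
    qed
    moreover have "f 0 = 0" using Suc.prems(2)[of "[]"] by simp
    ultimately show ?thesis by (simp add: mult_ac)
  qed
  then show ?case unfolding vanishes_to_order_def eventually_nhds_metric using d by blast
qed

text \<open>Iterated finite differences: they are small for a map of high order of vanishing,
  and approximate the iterated derivatives.\<close>

primrec fdiff :: "real \<Rightarrow> 'a list \<Rightarrow> ('a::real_vector \<Rightarrow> 'b::ab_group_add) \<Rightarrow> 'a \<Rightarrow> 'b" where
  "fdiff t [] f x = f x"
| "fdiff t (v # vs) f x = fdiff t vs f (x + t *\<^sub>R v) - fdiff t vs f x"

lemma fdiff_bound:
  assumes "vanishes_to_order n f"
  shows "\<exists>C. \<forall>\<^sub>F t in at_right 0. norm (fdiff t vs f (t *\<^sub>R u)) \<le> C * t ^ n"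
proof (induction vs arbitrary: u)
  case Nil
  obtain C where C: "\<forall>\<^sub>F x in nhds 0. norm (f x) \<le> C * norm x ^ n"
    using assms unfolding vanishes_to_order_def by blast
  have "((\<lambda>t. t *\<^sub>R u) \<longlongrightarrow> 0) (at_right 0)"
    by (rule tendsto_eq_intros | simp)+
  then have "\<forall>\<^sub>F t in at_right 0. norm (f (t *\<^sub>R u)) \<le> C * norm (t *\<^sub>R u) ^ n"
    by (rule eventually_compose_filterlim[OF C])
  moreover have "\<forall>\<^sub>F t in at_right (0::real). t > 0"
    by (simp add: eventually_at_filter)
  ultimately have "\<forall>\<^sub>F t in at_right 0. norm (fdiff t [] f (t *\<^sub>R u)) \<le> (C * norm u ^ n) * t ^ n"
    by eventually_elim (simp add: power_mult_distrib mult_ac)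
  then show ?case by blast
next
  case (Cons v vs)
  obtain C1 C2 where
    "\<forall>\<^sub>F t in at_right 0. norm (fdiff t vs f (t *\<^sub>R (u + v))) \<le> C1 * t ^ n"
    "\<forall>\<^sub>F t in at_right 0. norm (fdiff t vs f (t *\<^sub>R u)) \<le> C2 * t ^ n"
    using Cons.IH by meson
  then have "\<forall>\<^sub>F t in at_right 0. norm (fdiff t (v # vs) f (t *\<^sub>R u)) \<le> (C1 + C2) * t ^ n"
  proof eventually_elim
    case (elim t)
    then show ?case
      using norm_triangle_ineq4[of "fdiff t vs f (t *\<^sub>R (u + v))" "fdiff t vs f (t *\<^sub>R u)"]
      by (simp add: scaleR_add_right distrib_right)
  qed
  then show ?case by blast
qed

lemma fdiff_has_derivative:
  assumes f: "\<And>y. norm y < r \<Longrightarrow> f differentiable (at y)" and "t \<ge> 0"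
  shows "norm y + t * sum_list (map norm vs) < r \<Longrightarrow>
    (fdiff t vs f has_derivative (\<lambda>v. fdiff t vs (dir_deriv v f) y)) (at y)"
proof (induction vs arbitrary: y)
  case Nil
  then show ?case by (auto intro!: has_derivative_dir_deriv f)
next
  case (Cons v vs)
  have "norm y + t * sum_list (map norm vs) < r"
    using Cons.prems assms(2) by (simp add: distrib_left) (smt (verit) mult_nonneg_nonneg norm_ge_zero)
  moreover have "norm (y + t *\<^sub>R v) + t * sum_list (map norm vs) < r"
    using Cons.prems assms(2) norm_triangle_ineq[of y "t *\<^sub>R v"] by (simp add: distrib_left)
  moreover have "((\<lambda>y. y + t *\<^sub>R v) has_derivative (\<lambda>h. h)) (at y)"
    by (auto intro!: derivative_eq_intros)
  ultimately show ?case
    using Cons.IH has_derivative_compose[of "\<lambda>y. y + t *\<^sub>R v" "\<lambda>h. h" y UNIV "fdiff t vs f"]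
    by (auto intro!: has_derivative_diff)
qed

text \<open>Differences commute with derivatives, so that the mean value inequality in the direction of
  the first vector reduces the claim to a derivative of \<open>f\<close> and one vector less. The claim has
  to be made uniformly in the base point for this.\<close>

lemma fdiff_approx:
  fixes f :: "'a::real_normed_vector \<Rightarrow> 'b::real_normed_vector"
  assumes S: "open S" "0 \<in> S" and "e > 0"
  shows "smooth_on S f \<Longrightarrow> \<exists>d>0. \<forall>t x. 0 < t \<longrightarrow> t < d \<longrightarrow> norm x < d \<longrightarrow>
    norm (fdiff t vs f x - t ^ length vs *\<^sub>R iter_deriv vs f 0) \<le> e * t ^ length vs"
proof (induction vs arbitrary: f)
  case Nil
  have "isCont f 0"
    using smooth_on_continuous_on[OF Nil] S continuous_on_eq_continuous_at by blast
  then obtain d where "d > 0" "\<And>x. dist x 0 < d \<Longrightarrow> dist (f x) (f 0) < e"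
    using \<open>e > 0\<close> unfolding continuous_at_eps_delta by blast
  then show ?case by (intro exI[of _ d]) (auto simp: dist_norm intro: less_imp_le)
next
  case (Cons v vs)
  let ?k = "length vs"
  define L where "L = iter_deriv vs (dir_deriv v f) 0"
  obtain d1 where d1: "d1 > 0" and D1: "\<And>t x. 0 < t \<Longrightarrow> t < d1 \<Longrightarrow> norm x < d1 \<Longrightarrow>
      norm (fdiff t vs (dir_deriv v f) x - t ^ ?k *\<^sub>R L) \<le> e * t ^ ?k"
    using Cons.IH[OF smooth_on_dir_deriv[OF Cons.prems]] unfolding L_def by metis
  obtain r where r: "r > 0" "ball 0 r \<subseteq> S" using S open_contains_ball by blast
  have f: "f differentiable (at y)" if "norm y < r" for y
    using smooth_on_differentiable[OF Cons.prems] r that by (auto simp: subset_eq)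
  \<comment> \<open>Steps shorter than \<open>min d1 r / M\<close> keep all points of the difference within both radii.\<close>
  define M where "M = 1 + norm v + sum_list (map norm vs)"
  have nn: "sum_list (map norm vs) \<ge> 0" by (auto intro!: sum_list_nonneg)
  then have M: "M \<ge> 1" "M \<ge> 1 + norm v" by (auto simp: M_def)
  define d where "d = min d1 r / M"
  have d: "d > 0" using d1 r M by (simp add: d_def)
  have dM: "d * M = min d1 r" using M by (simp add: d_def)
  then have dd1: "d \<le> d1" using mult_left_mono[OF M(1), of d] d by simp
  have "norm (fdiff t (v # vs) f x - t ^ Suc ?k *\<^sub>R L) \<le> e * t ^ Suc ?k"
    if t: "0 < t" "t < d" and x: "norm x < d" for t x
  proof -
    define g where "g = (\<lambda>s. fdiff t vs f (x + s *\<^sub>R v) - s *\<^sub>R (t ^ ?k *\<^sub>R L))"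
    have pt: "norm (x + s *\<^sub>R v) + t * sum_list (map norm vs) < min d1 r" if "s \<in> {0..t}" for s
    proof -
      have "norm (x + s *\<^sub>R v) \<le> norm x + s * norm v"
        using norm_triangle_ineq[of x "s *\<^sub>R v"] that by simp
      also have "\<dots> \<le> norm x + d * norm v"
        using that t by (intro add_left_mono mult_right_mono) auto
      moreover have "t * sum_list (map norm vs) \<le> d * sum_list (map norm vs)"
        using t nn by (intro mult_right_mono) auto
      moreover have "d + d * norm v + d * sum_list (map norm vs) = min d1 r"
        using dM by (simp add: M_def distrib_left)
      ultimately show ?thesis using x by linarith
    qed
    have g': "(g has_derivative (\<lambda>h. h *\<^sub>R (fdiff t vs (dir_deriv v f) (x + s *\<^sub>R v) - t ^ ?k *\<^sub>R L))) (at s within {0..t})"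
      if "s \<in> {0..t}" for s
    proof -
      have "(fdiff t vs f has_derivative (\<lambda>h. fdiff t vs (dir_deriv h f) (x + s *\<^sub>R v))) (at (x + s *\<^sub>R v))"
        by (rule fdiff_has_derivative[of r f t "x + s *\<^sub>R v" vs, OF f])
          (use pt[OF that] t in auto)
      note D = this
      have "((\<lambda>s. x + s *\<^sub>R v) has_derivative (\<lambda>h. h *\<^sub>R v)) (at s within {0..t})"
        by (auto intro!: derivative_eq_intros)
      from has_derivative_compose[OF this D]
      have "((\<lambda>s. fdiff t vs f (x + s *\<^sub>R v)) has_derivative
          (\<lambda>h. h *\<^sub>R fdiff t vs (dir_deriv v f) (x + s *\<^sub>R v))) (at s within {0..t})"
        by (simp only: linear_scale[OF has_derivative_linear[OF D]])
      then show ?thesis unfolding g_def scaleR_diff_right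
        by (rule has_derivative_diff) (auto intro!: derivative_eq_intros)
    qed
    have "norm (g t - g 0) \<le> e * t ^ ?k * norm (t - 0)"
    proof (rule differentiable_bound[OF _ g'])
      fix s assume s: "s \<in> {0..t}"
      have "norm (fdiff t vs (dir_deriv v f) (x + s *\<^sub>R v) - t ^ ?k *\<^sub>R L) \<le> e * t ^ ?k"
        using pt[OF s] t dd1 mult_nonneg_nonneg[of t, OF _ nn] by (intro D1) linarith+
      then show "onorm (\<lambda>h. h *\<^sub>R (fdiff t vs (dir_deriv v f) (x + s *\<^sub>R v) - t ^ ?k *\<^sub>R L)) \<le> e * t ^ ?k"
        by (rule onorm_scaleR_left_le)
    qed (use t in auto)
    moreover have "g t - g 0 = fdiff t (v # vs) f x - t ^ Suc ?k *\<^sub>R L"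
      by (simp add: g_def)
    ultimately show ?thesis using t by (simp only:) (simp add: mult_ac)
  qed
  then show ?case using d unfolding iter_deriv_Cons L_def[symmetric] length_Cons by blast
qed

text \<open>The difference at the origin is \<open>t\<^sup>k\<close> times the derivative, up to \<open>o(t\<^sup>k)\<close>, and it is also
  \<open>O(t\<^sup>n)\<close> with \<open>n > k\<close>.\<close>

lemma vanishes_to_order_imp_iter_deriv_0:
  fixes f :: "'a::real_normed_vector \<Rightarrow> 'b::real_normed_vector"
  assumes S: "open S" "0 \<in> S" and f: "smooth_on S f" and n: "vanishes_to_order n f"
    and k: "length vs < n"
  shows "iter_deriv vs f 0 = 0"
proof -
  let ?k = "length vs" and ?L = "iter_deriv vs f 0"
  have "norm ?L \<le> e" if "e > 0" for e
  proof -
    have e: "e / 2 > 0" using that by simp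
    obtain d where d: "d > 0" "\<And>t x. 0 < t \<Longrightarrow> t < d \<Longrightarrow> norm x < d \<Longrightarrow>
      norm (fdiff t vs f x - t ^ ?k *\<^sub>R ?L) \<le> e / 2 * t ^ ?k"
      using fdiff_approx[OF S e f] by metis
    obtain C where C: "\<forall>\<^sub>F t in at_right 0. norm (fdiff t vs f (t *\<^sub>R 0)) \<le> C * t ^ n"
      using fdiff_bound[OF n] by blast
    have "((\<lambda>t. C * t ^ (n - ?k)) \<longlongrightarrow> C * 0 ^ (n - ?k)) (at_right 0)"
      by (intro tendsto_intros)
    then have "\<forall>\<^sub>F t in at_right 0. C * t ^ (n - ?k) < e / 2"
      by (rule order_tendstoD) (use e k in \<open>simp add: zero_power\<close>)
    moreover have "\<forall>\<^sub>F t in at_right 0. 0 < t \<and> t < d"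
      using d(1) by (auto simp: eventually_at_right[of 0 d])
    ultimately have "\<forall>\<^sub>F t in at_right (0::real). norm ?L \<le> e"
      using C
    proof eventually_elim
      case (elim t)
      have "t ^ ?k * norm ?L = norm (fdiff t vs f 0 - (fdiff t vs f 0 - t ^ ?k *\<^sub>R ?L))"
        using elim by simp
      also have "\<dots> \<le> C * t ^ n + e / 2 * t ^ ?k"
        using elim d(1) d(2)[of t 0] by (intro norm_triangle_le_diff) auto
      also have "t ^ n = t ^ (n - ?k) * t ^ ?k"
        using k by (simp add: power_add[symmetric])
      also have "C * (t ^ (n - ?k) * t ^ ?k) \<le> e / 2 * t ^ ?k"
        using elim by (simp add: mult.assoc[symmetric] mult_right_mono)
      finally show ?case using elim by (simp add: field_simps)
    qed
    then show ?thesis by (simp add: eventually_const_iff trivial_limit_at_right_real)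
  qed
  then show ?thesis by (meson field_le_epsilon norm_le_zero_iff add_0 dense_ge)
qed

theorem enat_le_vanishing_order_iff_vanishes_to_order:
  fixes f :: "'a::euclidean_space \<Rightarrow> 'b::real_normed_vector"
  assumes "open S" "0 \<in> S" "smooth_on S f"
  shows "enat n \<le> vanishing_order f \<longleftrightarrow> vanishes_to_order n f"
  unfolding enat_le_vanishing_order_iff
  using iter_deriv_0_imp_vanishes_to_order[OF assms] vanishes_to_order_imp_iter_deriv_0[OF assms] by blast

lemma vanishes_to_order_1:
  fixes f :: "'a::euclidean_space \<Rightarrow> 'b::real_normed_vector"
  assumes "open S" "0 \<in> S" "smooth_on S f" "f 0 = 0"
  shows "vanishes_to_order 1 f"
  by (rule iter_deriv_0_imp_vanishes_to_order[OF assms(1-3)]) (simp add: assms(4))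

lemma vanishes_to_order_dir_deriv:
  fixes f :: "'a::euclidean_space \<Rightarrow> 'b::real_normed_vector"
  assumes S: "open S" "0 \<in> S" and f: "smooth_on S f" and n: "vanishes_to_order (Suc n) f"
  shows "vanishes_to_order n (dir_deriv v f)"
proof (rule iter_deriv_0_imp_vanishes_to_order[OF S smooth_on_dir_deriv[OF f]])
  fix vs :: "'a list" assume "length vs < n"
  then have "iter_deriv (v # vs) f 0 = 0"
    by (intro vanishes_to_order_imp_iter_deriv_0[OF S f n]) simp
  then show "iter_deriv vs (dir_deriv v f) 0 = 0" by (simp only: iter_deriv_Cons)
qed

section \<open>Parameter integrals and implicit functions\<close>

lemma has_derivative_parameter_integral:
  fixes F :: "real \<times> 'a::euclidean_space \<Rightarrow> 'b::banach"
  assumes F: "smooth_on W F" and "open W" "open U" and sub: "{0..1} \<times> U \<subseteq> W" and x: "x \<in> U"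
  shows "((\<lambda>x. integral {0..1} (\<lambda>s. F (s, x))) has_derivative
    (\<lambda>v. integral {0..1} (\<lambda>s. dir_deriv (0, v) F (s, x)))) (at x)"
proof -
  obtain d where d: "d > 0" "ball x d \<subseteq> U" using \<open>open U\<close> x open_contains_ball by blast
  have dW: "(s, y) \<in> W" if "dist x y < d" "0 \<le> s" "s \<le> 1" for s y
    using that d sub by (auto simp: subset_eq)
  define D where "D = (\<lambda>y s. Blinfun (\<lambda>v. dir_deriv (0, v) F (s, y)))"
  have DF: "((\<lambda>y. F (s, y)) has_derivative (\<lambda>v. dir_deriv (0, v) F (s, y))) (at y within ball x d)"
    if "y \<in> ball x d" "s \<in> {0..1}" for y s
  proof -
    have 1: "((\<lambda>y. (s, y)) has_derivative (\<lambda>v. (0, v))) (at y within ball x d)"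
      by (auto intro!: derivative_eq_intros)
    have "(F has_derivative (\<lambda>v. dir_deriv v F (s, y))) (at (s, y))"
      by (rule smooth_on_has_derivative[OF F]) (use that dW in auto)
    from has_derivative_compose[OF 1 this] show ?thesis .
  qed
  have D: "blinfun_apply (D y s) = (\<lambda>v. dir_deriv (0, v) F (s, y))"
    if "y \<in> ball x d" "s \<in> {0..1}" for y s
    unfolding D_def
    by (rule bounded_linear_Blinfun_apply[OF has_derivative_bounded_linear[OF DF[OF that]]])
  have cF: "continuous_on (ball x d \<times> {0..1}) (\<lambda>(y, s). G (s, y))"
    if "smooth_on W G" for G :: "real \<times> 'a \<Rightarrow> 'b"
  proof -
    have "continuous_on (ball x d \<times> {0..1}) (\<lambda>z. G (snd z, fst z))"
      by (rule continuous_on_compose2[OF smooth_on_continuous_on[OF that]])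
        (use dW in \<open>auto intro!: continuous_intros\<close>)
    then show ?thesis by (simp add: case_prod_unfold)
  qed
  have cD: "continuous_on (ball x d \<times> cbox 0 1) (\<lambda>(y, s). D y s)"
  proof (rule continuous_on_blinfun_componentwise)
    fix i :: 'a
    have "continuous_on (ball x d \<times> {0..1}) (\<lambda>(y, s). dir_deriv (0, i) F (s, y))"
      by (rule cF[OF smooth_on_dir_deriv[OF F]])
    also have "?this \<longleftrightarrow> continuous_on (ball x d \<times> {0..1}) (\<lambda>z. blinfun_apply (case z of (y, s) \<Rightarrow> D y s) i)"
      by (rule continuous_on_cong) (use D in auto)
    finally show "continuous_on (ball x d \<times> cbox 0 1) (\<lambda>z. blinfun_apply (case z of (y, s) \<Rightarrow> D y s) i)"
      by simp
  qed
  have "((\<lambda>x. integral (cbox 0 1) (\<lambda>s. F (s, x))) has_derivative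
      blinfun_apply (integral (cbox 0 1) (D x))) (at x within ball x d)"
  proof (rule leibniz_rule[OF _ _ cD])
    fix y and s :: real assume "y \<in> ball x d" "s \<in> cbox 0 1"
    then show "((\<lambda>y. F (s, y)) has_derivative blinfun_apply (D y s)) (at y within ball x d)"
      using DF D by simp
  next
    fix y assume "y \<in> ball x d"
    then have "continuous_on {0..1} (\<lambda>s. F (s, y))"
      using dW by (intro continuous_on_compose2[OF smooth_on_continuous_on[OF F]] continuous_intros) auto
    then show "(\<lambda>s. F (s, y)) integrable_on cbox 0 1"
      by (simp add: integrable_continuous_interval)
  qed (use d in auto)
  moreover have "D x integrable_on {0..1}"
  proof (rule integrable_continuous_interval)
    have "continuous_on ({0..1}) (\<lambda>s. case (x, s) of (y, s) \<Rightarrow> D y s)"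
      by (rule continuous_on_compose2[OF cD]) (use d in \<open>auto intro!: continuous_intros\<close>)
    then show "continuous_on {0..1} (D x)" by simp
  qed
  then have "blinfun_apply (integral (cbox 0 1) (D x)) = (\<lambda>v. integral {0..1} (\<lambda>s. dir_deriv (0, v) F (s, x)))"
    by (intro ext) (use D[of x] d(1) in \<open>auto simp: blinfun_apply_integral intro!: integral_cong\<close>)
  ultimately show ?thesis
    using d(1) by (simp add: at_within_open[of x "ball x d"])
qed

text \<open>Differentiation under the integral sign turns a parameter integral into parameter
  integrals of the same kind.\<close>

lemma smooth_on_parameter_integral:
  fixes F :: "real \<times> 'a::euclidean_space \<Rightarrow> 'b::banach"
  assumes F: "smooth_on W F" and W: "open W" "open U" "{0..1} \<times> U \<subseteq> W"
  shows "smooth_on U (\<lambda>x. integral {0..1} (\<lambda>s. F (s, x)))"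
proof -
  have "Ck_on n U (\<lambda>x. integral {0..1} (\<lambda>s. F (s, x)))" for n
    using F
  proof (induction n arbitrary: F)
    case 0
    show ?case by (rule Ck_on_0I[OF has_derivative_parameter_integral[OF 0 W]])
  next
    case (Suc n)
    show ?case
      by (rule Ck_on_SucI[OF W(2) has_derivative_parameter_integral[OF Suc.prems W]])
        (assumption | rule Suc.IH smooth_on_dir_deriv Suc.prems)+
  qed
  then show ?thesis unfolding smooth_on_iff_Ck by blast
qed

text \<open>Hadamard's lemma: the quotient is the mean of the derivative over the segment to the
  hyperplane, hence smooth across it.\<close>

lemma hadamard_quotient:
  fixes g :: "real \<times> 'a::euclidean_space \<Rightarrow> real"
  assumes U: "open U" and star: "\<And>s t z. (t, z) \<in> U \<Longrightarrow> s \<in> {0..1} \<Longrightarrow> (s * t, z) \<in> U"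
    and g: "smooth_on U g"
  obtains k where "smooth_on U k" "\<And>t z. (t, z) \<in> U \<Longrightarrow> g (t, z) = g (0, z) + t * k (t, z)"
    "\<And>z. k (0, z) = dir_deriv (1, 0) g (0, z)"
proof
  define m where "m = (\<lambda>(s::real, x::real \<times> 'a). (s * fst x, snd x))"
  define W where "W = m -` U"
  have m: "smooth_on UNIV m"
    unfolding m_def case_prod_unfold by (intro smooth_intros open_UNIV)
  have W: "open W"
    unfolding W_def using smooth_on_continuous_on[OF m] U by (rule open_vimage[rotated])
  have F: "smooth_on W (\<lambda>x. dir_deriv (1, 0) g (m x))"
    by (rule smooth_on_compose[OF smooth_on_dir_deriv[OF g] smooth_on_subset[OF m] W])
      (auto simp: W_def)
  let ?k = "\<lambda>x. integral {0..1} (\<lambda>s. dir_deriv (1, 0) g (m (s, x)))"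
  show "smooth_on U ?k"
    by (rule smooth_on_parameter_integral[OF F W U]) (use star in \<open>auto simp: W_def m_def\<close>)
  show "?k (0, z) = dir_deriv (1, 0) g (0, z)" for z
    by (simp add: m_def)
  show "g (t, z) = g (0, z) + t * ?k (t, z)" if "(t, z) \<in> U" for t z
  proof -
    have "((\<lambda>s. t * dir_deriv (1, 0) g (m (s, (t, z)))) has_integral
        ((\<lambda>s. g (s * t, z)) 1 - (\<lambda>s. g (s * t, z)) 0)) {0..1}"
    proof (rule fundamental_theorem_of_calculus)
      fix s :: real assume "s \<in> {0..1}"
      then have D: "(g has_derivative (\<lambda>v. dir_deriv v g (s * t, z))) (at (s * t, z))"
        using smooth_on_has_derivative[OF g star[OF that]] by simp
      have "((\<lambda>s. (s * t, z)) has_derivative (\<lambda>h. (h * t) *\<^sub>R (1, 0))) (at s within {0..1})"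
        by (auto intro!: derivative_eq_intros)
      from has_derivative_compose[OF this D]
      show "((\<lambda>s. g (s * t, z)) has_vector_derivative t * dir_deriv (1, 0) g (m (s, (t, z)))) (at s within {0..1})"
        unfolding has_vector_derivative_def linear_scale[OF has_derivative_linear[OF D]] m_def
        by (simp add: mult.assoc)
    qed simp
    from integral_unique[OF this] show ?thesis by simp
  qed
qed

text \<open>On a box around the given zero the function is strictly increasing in the first variable, so it
  changes sign exactly once on each line. The derivatives of the resulting graph function
  are quotients of derivatives of the given one along the graph, so each order of
  differentiability of the graph function yields the next.\<close>

lemma implicit_graph:
  fixes f :: "real \<times> 'a::euclidean_space \<Rightarrow> real"
  assumes W: "open W" "(u0, y0) \<in> W" and f: "smooth_on W f" and f0: "f (u0, y0) = 0"
    and pos: "dir_deriv (1, 0) f (u0, y0) > 0"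
  obtains e d \<phi> where "e > 0" "d > 0" "smooth_on (ball y0 d) \<phi>"
    "{u0 - e<..<u0 + e} \<times> ball y0 d \<subseteq> W"
    "\<And>y. y \<in> ball y0 d \<Longrightarrow> \<bar>\<phi> y - u0\<bar> < e"
    "\<And>u y. \<bar>u - u0\<bar> < e \<Longrightarrow> y \<in> ball y0 d \<Longrightarrow> f (u, y) < 0 \<longleftrightarrow> u < \<phi> y"
    "\<And>u y. \<bar>u - u0\<bar> < e \<Longrightarrow> y \<in> ball y0 d \<Longrightarrow> f (u, y) = 0 \<longleftrightarrow> u = \<phi> y"
    "\<And>y. y \<in> ball y0 d \<Longrightarrow> (\<phi> has_derivative
      (\<lambda>v. - dir_deriv (0, v) f (\<phi> y, y) * inverse (dir_deriv (1, 0) f (\<phi> y, y)))) (at y)"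
proof -
  let ?fu = "dir_deriv (1, 0) f"
  have cf: "continuous_on W f" "continuous_on W ?fu"
    using f smooth_on_continuous_on smooth_on_dir_deriv by blast+
  have "open {x \<in> W. ?fu x > 0}"
    using continuous_open_preimage[OF cf(2) W(1) open_greaterThan[of 0]]
    by (simp add: vimage_def Int_def conj_commute)
  then obtain r where r: "r > 0" "ball (u0, y0) r \<subseteq> {x \<in> W. ?fu x > 0}"
    using W(2) pos open_contains_ball by blast
  define e where "e = r / 2"
  have e: "e > 0" using r by (simp add: e_def)
  have box: "(u, y) \<in> W \<and> ?fu (u, y) > 0" if "\<bar>u - u0\<bar> \<le> e" "dist y0 y < e" for u y
  proof -
    have "dist (u0, y0) (u, y) \<le> \<bar>u - u0\<bar> + dist y0 y"
      unfolding dist_Pair_Pair using sqrt_sum_squares_le_sum[of "dist u0 u" "dist y0 y"]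
      by (simp add: dist_real_def abs_minus_commute)
    also have "\<dots> < r" using that by (simp add: e_def)
    finally show ?thesis using r by (auto simp: subset_eq)
  qed
  have mono: "f (u1, y) < f (u2, y)" if "dist y0 y < e" "u1 < u2" "\<bar>u1 - u0\<bar> \<le> e" "\<bar>u2 - u0\<bar> \<le> e" for u1 u2 y
  proof (rule DERIV_pos_imp_increasing[OF that(2)])
    fix u assume "u1 \<le> u" "u \<le> u2"
    then have u: "\<bar>u - u0\<bar> \<le> e" using that by linarith
    have D: "(f has_derivative (\<lambda>v. dir_deriv v f (u, y))) (at (u, y))"
      using smooth_on_has_derivative[OF f] box[OF u that(1)] by blast
    have "((\<lambda>u. (u, y)) has_derivative (\<lambda>h. h *\<^sub>R (1, 0))) (at u)"
      by (auto intro!: derivative_eq_intros)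
    from has_derivative_compose[OF this D]
    have "((\<lambda>u. f (u, y)) has_real_derivative ?fu (u, y)) (at u)"
      unfolding has_field_derivative_def linear_scale[OF has_derivative_linear[OF D]]
      by (simp add: mult.commute[of _ "?fu (u, y)"])
    then show "\<exists>D. ((\<lambda>u. f (u, y)) has_real_derivative D) (at u) \<and> D > 0"
      using box[OF u that(1)] by blast
  qed
  have sgn: "f (u0 - e, y0) < 0" "f (u0 + e, y0) > 0"
    using mono[of y0 "u0 - e" u0] mono[of y0 u0 "u0 + e"] e f0 by auto
  have cy: "\<forall>\<^sub>F y in nhds y0. P (f (u, y))" if "\<bar>u - u0\<bar> \<le> e" "open {t. P t}" "P (f (u, y0))" for u P
  proof -
    have "isCont f (u, y0)"
      using cf(1) W(1) box[OF that(1)] e by (simp add: continuous_on_eq_continuous_at)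
    then have "((\<lambda>y. f (u, y)) \<longlongrightarrow> f (u, y0)) (nhds y0)"
      unfolding isCont_def tendsto_at_iff_tendsto_nhds
      by (rule filterlim_compose) (auto intro!: tendsto_intros simp: nhds_prod[symmetric] filterlim_ident)
    from topological_tendstoD[OF this that(2)] that(3) show ?thesis by simp
  qed
  have "\<forall>\<^sub>F y in nhds y0. f (u0 - e, y) < 0 \<and> f (u0 + e, y) > 0"
    using sgn e by (intro eventually_conj cy[of _ "\<lambda>t. t < 0"] cy[of _ "\<lambda>t. t > 0"])
      (auto simp: lessThan_def[symmetric] greaterThan_def[symmetric])
  then obtain d' where d': "d' > 0" "\<And>y. dist y y0 < d' \<Longrightarrow> f (u0 - e, y) < 0 \<and> f (u0 + e, y) > 0"
    unfolding eventually_nhds_metric by blast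
  define d where "d = min d' e"
  have d: "d > 0" "d \<le> e" "d \<le> d'" using d' e by (auto simp: d_def)
  define B where "B = {u0 - e<..<u0 + e} \<times> ball y0 d"
  have BW: "B \<subseteq> W" using box d by (force simp: B_def)
  have "\<exists>u. \<bar>u - u0\<bar> < e \<and> f (u, y) = 0" if y: "y \<in> ball y0 d" for y
  proof -
    have "continuous_on {u0 - e..u0 + e} (\<lambda>u. f (u, y))"
      using y d by (intro continuous_on_compose2[OF cf(1)] continuous_intros) (use box in force)
    then obtain u where u: "u0 - e \<le> u" "u \<le> u0 + e" "f (u, y) = 0"
      using IVT'[of "\<lambda>u. f (u, y)" "u0 - e" 0 "u0 + e"] d'(2)[of y] y d e
      by (force simp: dist_commute)
    moreover have "u \<noteq> u0 - e" "u \<noteq> u0 + e" using u d'(2)[of y] y d by (auto simp: dist_commute)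
    ultimately show ?thesis by (intro exI[of _ u]) auto
  qed
  then obtain \<phi> where \<phi>: "\<And>y. y \<in> ball y0 d \<Longrightarrow> \<bar>\<phi> y - u0\<bar> < e \<and> f (\<phi> y, y) = 0"
    by metis
  have lt: "f (u, y) < 0 \<longleftrightarrow> u < \<phi> y" and eq: "f (u, y) = 0 \<longleftrightarrow> u = \<phi> y"
    if "\<bar>u - u0\<bar> < e" "y \<in> ball y0 d" for u y
    using mono[of y u "\<phi> y"] mono[of y "\<phi> y" u] \<phi>[OF that(2)] that d
    by (cases u "\<phi> y" rule: linorder_cases; simp)+
  \<comment> \<open>The graph function is a slice of the inverse of \<open>(u, y) \<mapsto> (f (u, y), y)\<close>,
    which is differentiable.\<close>
  have \<phi>D: "(\<phi> has_derivative (\<lambda>v. - dir_deriv (0, v) f (\<phi> y, y) * inverse (?fu (\<phi> y, y)))) (at y)"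
    if y: "y \<in> ball y0 d" for y
  proof -
    define G where "G = (\<lambda>x. (f x, snd x))"
    have inj: "inj_on G B"
    proof (rule inj_onI)
      fix a b assume ab: "a \<in> B" "b \<in> B" "G a = G b"
      then have "snd a = snd b" "f (fst a, snd a) = f (fst b, snd a)" "dist y0 (snd a) < e"
        "\<bar>fst a - u0\<bar> \<le> e" "\<bar>fst b - u0\<bar> \<le> e"
        using d by (auto simp: G_def B_def)
      then show "a = b"
        using mono[of "snd a" "fst a" "fst b"] mono[of "snd a" "fst b" "fst a"]
        by (cases "fst a" "fst b" rule: linorder_cases) (auto simp: prod_eq_iff)
    qed
    let ?x = "(\<phi> y, y)" and ?g = "inv_into B G"
    have xB: "(\<phi> y, y) \<in> B" if "y \<in> ball y0 d" for y using \<phi>[OF that] that by (auto simp: B_def abs_less_iff)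
    have D: "(f has_derivative (\<lambda>v. dir_deriv v f ?x)) (at ?x)"
      using smooth_on_has_derivative[OF f] xB[OF y] BW by blast
    note L = has_derivative_linear[OF D]
    have fu: "?fu ?x \<noteq> 0" using box[of "\<phi> y" y] \<phi>[OF y] y d by auto
    have split: "dir_deriv (a, v) f ?x = a * ?fu ?x + dir_deriv (0, v) f ?x" for a v
      using linear_add[OF L, of "a *\<^sub>R (1, 0)" "(0, v)"] linear_scale[OF L, of a "(1, 0)"] by simp
    have GD: "(G has_derivative (\<lambda>v. (dir_deriv v f ?x, snd v))) (at ?x)"
      unfolding G_def by (intro has_derivative_Pair D has_derivative_snd has_derivative_ident)
    have "(?g has_derivative (\<lambda>(a, v). ((a - dir_deriv (0, v) f ?x) * inverse (?fu ?x), v))) (at (G ?x))"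
    proof (rule has_derivative_inverse_strong[OF _ _ _ _ GD])
      show "open B" by (simp add: B_def open_Times)
      show "continuous_on B G" unfolding G_def
        by (intro continuous_intros continuous_on_subset[OF cf(1) BW])
      show "(\<lambda>v. (dir_deriv v f ?x, snd v)) \<circ> (\<lambda>(a, v). ((a - dir_deriv (0, v) f ?x) * inverse (?fu ?x), v)) = id"
        by (rule ext) (use fu in \<open>simp add: case_prod_unfold split[of "_ * _"] prod_eq_iff mult.assoc\<close>)
    qed (use xB[OF y] inj in auto)
    moreover have "G ?x = (0, y)" using \<phi>[OF y] by (simp add: G_def)
    ultimately have gD: "(?g has_derivative (\<lambda>(a, v). ((a - dir_deriv (0, v) f ?x) * inverse (?fu ?x), v))) (at (0, y))"
      by simp
    have "((\<lambda>y. (0::real, y)) has_derivative (\<lambda>v. (0, v))) (at y)"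
      by (auto intro!: derivative_eq_intros)
    from has_derivative_fst[OF has_derivative_compose[OF this gD]]
    have "((\<lambda>y. fst (?g (0, y))) has_derivative (\<lambda>v. - dir_deriv (0, v) f ?x * inverse (?fu ?x))) (at y)"
      by simp
    moreover have "fst (?g (0, y)) = \<phi> y" if "y \<in> ball y0 d" for y
    proof -
      have "?g (G (\<phi> y, y)) = (\<phi> y, y)" by (rule inv_into_f_f[OF inj xB[OF that]])
      then show ?thesis using \<phi>[OF that] by (simp add: G_def)
    qed
    ultimately show ?thesis
      using has_derivative_cong_open[OF open_ball y, of "\<lambda>y. fst (?g (0, y))" \<phi>] by simp
  qed
  have "Ck_on n (ball y0 d) \<phi>" for n
  proof (induction n)
    case 0
    show ?case by (rule Ck_on_0I[OF \<phi>D])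
  next
    case (Suc n)
    have "(\<phi> y, y) \<in> B" if "y \<in> ball y0 d" for y
      using \<phi>[OF that] that by (auto simp: B_def abs_less_iff)
    then have graph: "(\<lambda>y. (\<phi> y, y)) ` ball y0 d \<subseteq> B" by blast
    have "Ck_on n (ball y0 d) (\<lambda>y. (\<phi> y, 0) + (0, y))"
    proof (rule Ck_on_add[OF open_ball])
      show "Ck_on n (ball y0 d) (\<lambda>y. (\<phi> y, 0::'a))"
        by (rule Ck_on_bounded_linear[OF open_ball _ Suc])
          (auto intro!: bounded_linear_Pair bounded_linear_ident bounded_linear_zero)
      show "Ck_on n (ball y0 d) (\<lambda>y. (0::real, y))"
        by (rule Ck_on_bounded_linear[OF open_ball _ Ck_on_ident])
          (auto intro!: bounded_linear_Pair bounded_linear_ident bounded_linear_zero)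
    qed
    then have g: "Ck_on n (ball y0 d) (\<lambda>y. (\<phi> y, y))" by simp
    have c: "Ck_on n (ball y0 d) (\<lambda>y. dir_deriv v f (\<phi> y, y))" for v
    proof (rule Ck_on_compose[OF open_ball _ g])
      show "Ck_on n W (dir_deriv v f)"
        using smooth_on_dir_deriv[OF f] unfolding smooth_on_iff_Ck by blast
    qed (use graph BW in blast)
    have nz: "?fu (\<phi> y, y) \<noteq> 0" if "y \<in> ball y0 d" for y
      using box[of "\<phi> y" y] \<phi>[OF that] that d by auto
    show ?case
    proof (rule Ck_on_SucI[OF open_ball \<phi>D])
      show "Ck_on n (ball y0 d) (\<lambda>y. - dir_deriv (0, v) f (\<phi> y, y) * inverse (?fu (\<phi> y, y)))" for v
        by (rule Ck_on_bilinear[OF open_ball bounded_bilinear_mult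
              Ck_on_bounded_linear[OF open_ball bounded_linear_minus[OF bounded_linear_ident] c]
              Ck_on_inverse[OF open_ball nz c]])
    qed
  qed
  then have "smooth_on (ball y0 d) \<phi>" unfolding smooth_on_iff_Ck by blast
  from that[OF e d(1) this BW[unfolded B_def] _ lt eq \<phi>D] \<phi> show thesis by blast
qed

section \<open>Wirtinger derivatives and Taylor polynomials\<close>

text \<open>The Wirtinger derivatives with respect to \<open>z\<close> and \<open>cnj z\<close>.\<close>

definition dz :: "(complex \<Rightarrow> complex) \<Rightarrow> complex \<Rightarrow> complex" where
  "dz f x = (dir_deriv 1 f x - \<i> * dir_deriv \<i> f x) / 2"

definition dzb :: "(complex \<Rightarrow> complex) \<Rightarrow> complex \<Rightarrow> complex" where
  "dzb f x = (dir_deriv 1 f x + \<i> * dir_deriv \<i> f x) / 2"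

lemma smooth_on_dz [smooth_intros]: "smooth_on S f \<Longrightarrow> open S \<Longrightarrow> smooth_on S (dz f)"
  unfolding dz_def[abs_def] divide_inverse by (intro smooth_intros smooth_on_dir_deriv)

lemma smooth_on_dzb [smooth_intros]: "smooth_on S f \<Longrightarrow> open S \<Longrightarrow> smooth_on S (dzb f)"
  unfolding dzb_def[abs_def] divide_inverse by (intro smooth_intros smooth_on_dir_deriv)

lemma smooth_on_dz_funpow: "smooth_on S f \<Longrightarrow> open S \<Longrightarrow> smooth_on S ((dz ^^ k) f)"
  by (induction k) (auto intro: smooth_intros)

lemma dir_deriv_wirtinger:
  assumes "f differentiable (at x)"
  shows "dir_deriv v f x = v * dz f x + cnj v * dzb f x"
proof -
  have "dir_deriv v f x = (v \<bullet> 1) *\<^sub>R dir_deriv 1 f x + (v \<bullet> \<i>) *\<^sub>R dir_deriv \<i> f x"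
    by (subst dir_deriv_expand[OF assms]) (simp add: Basis_complex_def)
  also have "\<dots> = of_real (Re v) * dir_deriv 1 f x + of_real (Im v) * dir_deriv \<i> f x"
    by (simp add: scaleR_conv_of_real inner_complex_def)
  also have "\<dots> = (of_real (Re v) + \<i> * of_real (Im v)) * dz f x + (of_real (Re v) - \<i> * of_real (Im v)) * dzb f x"
    by (simp add: dz_def dzb_def field_simps)
  also have "of_real (Re v) + \<i> * of_real (Im v) = v" by (simp add: complex_eq_iff)
  also have "of_real (Re v) - \<i> * of_real (Im v) = cnj v" by (simp add: complex_eq_iff)
  finally show ?thesis .
qed

lemma dz_cong_open: "open S \<Longrightarrow> x \<in> S \<Longrightarrow> (\<And>y. y \<in> S \<Longrightarrow> f y = g y) \<Longrightarrow> dz f x = dz g x"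
  using dir_deriv_cong_open[of S x f g] by (simp add: dz_def)

lemma dzb_cong_open: "open S \<Longrightarrow> x \<in> S \<Longrightarrow> (\<And>y. y \<in> S \<Longrightarrow> f y = g y) \<Longrightarrow> dzb f x = dzb g x"
  using dir_deriv_cong_open[of S x f g] by (simp add: dzb_def)

lemma dz_add:
  "f differentiable (at x) \<Longrightarrow> g differentiable (at x) \<Longrightarrow> dz (\<lambda>y. f y + g y) x = dz f x + dz g x"
  by (simp add: dz_def dir_deriv_eq[OF has_derivative_add[OF has_derivative_dir_deriv has_derivative_dir_deriv]]
      field_simps)

lemma dz_funpow_add:
  assumes "open S" "smooth_on S f" "smooth_on S g"
  shows "x \<in> S \<Longrightarrow> (dz ^^ k) (\<lambda>y. f y + g y) x = (dz ^^ k) f x + (dz ^^ k) g x"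
proof (induction k arbitrary: x)
  case (Suc k)
  have "(dz ^^ Suc k) (\<lambda>y. f y + g y) x = dz (\<lambda>y. (dz ^^ k) f y + (dz ^^ k) g y) x"
    using dz_cong_open[OF assms(1) Suc.prems Suc.IH] by simp
  also have "\<dots> = (dz ^^ Suc k) f x + (dz ^^ Suc k) g x"
    using smooth_on_differentiable[OF smooth_on_dz_funpow] assms Suc.prems by (simp add: dz_add)
  finally show ?case .
qed simp

lemma cnj_dz_funpow_of_real:
  fixes f :: "complex \<Rightarrow> real"
  assumes S: "open S" and f: "smooth_on S (\<lambda>x. complex_of_real (f x))"
  shows "x \<in> S \<Longrightarrow> cnj ((dz ^^ k) (\<lambda>x. of_real (f x)) x) = (dzb ^^ k) (\<lambda>x. of_real (f x)) x"
proof (induction k arbitrary: x)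
  case (Suc k)
  let ?g = "(dz ^^ k) (\<lambda>x. of_real (f x))"
  have D: "?g differentiable (at x)"
    by (rule smooth_on_differentiable[OF smooth_on_dz_funpow[OF f S] Suc.prems])
  have "(dzb ^^ Suc k) (\<lambda>x. of_real (f x)) x = dzb (\<lambda>y. cnj (?g y)) x"
    using dzb_cong_open[OF S Suc.prems Suc.IH] by simp
  also have "\<dots> = cnj (dz ?g x)"
    unfolding dzb_def[of "\<lambda>y. cnj (?g y)"] dz_def[of ?g]
    by (simp add: dir_deriv_eq[OF bounded_linear.has_derivative[OF bounded_linear_cnj has_derivative_dir_deriv[OF D]]])
  finally show ?case by simp
qed simp

lemma vanishes_to_order_dz:
  assumes "open S" "0 \<in> S" "smooth_on S f" "vanishes_to_order (Suc n) f"
  shows "vanishes_to_order n (dz f)"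
proof -
  obtain A B where "\<forall>\<^sub>F x in nhds 0. norm (dir_deriv 1 f x) \<le> A * norm x ^ n"
    "\<forall>\<^sub>F x in nhds 0. norm (dir_deriv \<i> f x) \<le> B * norm x ^ n"
    using vanishes_to_order_dir_deriv[OF assms] unfolding vanishes_to_order_def by meson
  then have "\<forall>\<^sub>F x in nhds 0. norm (dz f x) \<le> (A + B) * norm x ^ n"
  proof eventually_elim
    case (elim x)
    have "norm (dz f x) \<le> norm (dir_deriv 1 f x) + norm (dir_deriv \<i> f x)"
      using norm_triangle_ineq4[of "dir_deriv 1 f x" "\<i> * dir_deriv \<i> f x"]
        norm_ge_zero[of "dir_deriv 1 f x"] norm_ge_zero[of "dir_deriv \<i> f x"]
      unfolding dz_def norm_divide norm_mult norm_ii norm_numeral by linarith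
    then show ?case using elim by (simp add: distrib_right)
  qed
  then show ?thesis unfolding vanishes_to_order_def by blast
qed

lemma dz_funpow_eq_0:
  assumes S: "open S" "0 \<in> S"
  shows "smooth_on S f \<Longrightarrow> vanishes_to_order (Suc k) f \<Longrightarrow> (dz ^^ k) f 0 = 0"
proof (induction k arbitrary: f)
  case 0
  then show ?case using vanishes_to_order_imp_iter_deriv_0[OF S, of f 1 "[]"] by simp
next
  case (Suc k)
  then show ?case
    using Suc.IH[OF smooth_on_dz vanishes_to_order_dz[OF S]] S by (simp add: funpow_Suc_right del: funpow.simps)
qed

text \<open>The general form of degree \<open>k\<close> in \<open>z\<close> and \<open>cnj z\<close>; its harmonic terms are those with
  \<open>i = 0\<close> and \<open>i = k\<close>.\<close>

definition hform :: "(nat \<Rightarrow> complex) \<Rightarrow> nat \<Rightarrow> complex \<Rightarrow> complex" where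
  "hform c k z = (\<Sum>i\<le>k. c i * z ^ i * cnj z ^ (k - i))"

lemma hform_scaleR: "hform c k (t *\<^sub>R z) = t ^ k *\<^sub>R hform c k z"
  unfolding hform_def scaleR_sum_right
proof (rule sum.cong[OF refl])
  fix i assume "i \<in> {..k}"
  then have "t ^ k = t ^ i * t ^ (k - i)" by (simp add: power_add[symmetric])
  then show "c i * (t *\<^sub>R z) ^ i * cnj (t *\<^sub>R z) ^ (k - i) = t ^ k *\<^sub>R (c i * z ^ i * cnj z ^ (k - i))"
    by (simp add: scaleR_conv_of_real power_mult_distrib)
qed

lemma smooth_on_hform [smooth_intros]:
  "smooth_on S f \<Longrightarrow> open S \<Longrightarrow> smooth_on S (\<lambda>x. hform c k (f x))"
  unfolding hform_def by (intro smooth_intros finite_atMost)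

lemma vanishes_to_order_hform: "vanishes_to_order k (hform c k)"
proof -
  have "norm (hform c k z) \<le> (\<Sum>i\<le>k. norm (c i)) * norm z ^ k" for z
    unfolding hform_def sum_distrib_right
  proof (rule sum_norm_le)
    fix i assume "i \<in> {..k}"
    then have "norm z ^ k = norm z ^ i * norm z ^ (k - i)" by (simp add: power_add[symmetric])
    then show "norm (c i * z ^ i * cnj z ^ (k - i)) \<le> norm (c i) * norm z ^ k"
      by (simp add: norm_mult norm_power)
  qed
  then show ?thesis unfolding vanishes_to_order_def by (intro exI always_eventually allI)
qed

text \<open>On the unit circle \<open>z\<^sup>k\<close> times the form is the polynomial with coefficients \<open>c\<close> in \<open>z\<^sup>2\<close>,
  which then has infinitely many roots.\<close>

lemma hform_eq_0:
  assumes "\<And>z. hform c k z = 0" "i \<le> k"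
  shows "c i = 0"
proof (rule ccontr)
  assume "c i \<noteq> 0"
  then have "finite {x. (\<Sum>i\<le>k. c i * x ^ i) = 0}"
    using polyfun_finite_roots[of c k] assms(2) by blast
  moreover have "sphere 0 1 \<subseteq> {x. (\<Sum>i\<le>k. c i * x ^ i) = 0}"
  proof
    fix x :: complex assume x: "x \<in> sphere 0 1"
    define z where "z = csqrt x"
    have z: "z * z = x" "norm z = 1" using x by (auto simp: z_def power2_eq_square[symmetric])
    then have u: "z * cnj z = 1" by (simp add: complex_norm_square[symmetric])
    have "(\<Sum>i\<le>k. c i * x ^ i) = z ^ k * hform c k z"
      unfolding hform_def sum_distrib_left
    proof (rule sum.cong[OF refl])
      fix i assume "i \<in> {..k}"
      then have "z ^ k = z ^ i * z ^ (k - i)" by (simp add: power_add[symmetric])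
      then have "z ^ k * (c i * z ^ i * cnj z ^ (k - i)) = c i * (z * z) ^ i * (z * cnj z) ^ (k - i)"
        by (simp add: power_mult_distrib mult_ac)
      then show "c i * x ^ i = z ^ k * (c i * z ^ i * cnj z ^ (k - i))"
        by (simp only: u z power_one mult_1_right)
    qed
    then show "x \<in> {x. (\<Sum>i\<le>k. c i * x ^ i) = 0}" using assms(1) by simp
  qed
  moreover have "infinite (sphere (0::complex) 1)"
  proof -
    have "connected (sphere (0::complex) 1)" by (simp add: connected_sphere)
    moreover have "1 \<in> sphere (0::complex) 1" "- 1 \<in> sphere (0::complex) 1" by auto
    ultimately show ?thesis
      by (metis connected_finite_iff_sing empty_iff one_neq_neg_one singletonD)
  qed
  ultimately show False using finite_subset by blast
qed

text \<open>The real part of \<open>e z\<^sup>m\<close> is a form as well, with terms for \<open>i = 0\<close> and \<open>i = m\<close> only, where \<open>c\<close>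
  has none; so the two cannot cancel.\<close>

lemma Re_monomial_add_hform_eq_0:
  assumes eq: "\<And>z. of_real (Re (e * z ^ m)) + hform c m z = 0" and m: "m > 0"
    and "c 0 = 0" "c m = 0" "i \<le> m"
  shows "c i = 0"
proof -
  define h where "h = (\<lambda>i. if i = m then e / 2 else if i = 0 then cnj e / 2 else 0)"
  have "of_real (Re (e * z ^ m)) = hform h m z" for z
  proof -
    have "hform h m z = (\<Sum>i\<in>{0, m}. h i * z ^ i * cnj z ^ (m - i))"
      unfolding hform_def by (rule sum.mono_neutral_right) (auto simp: h_def)
    also have "\<dots> = (e * z ^ m + cnj (e * z ^ m)) / 2"
      using m by (simp add: h_def add_divide_distrib)
    also have "\<dots> = of_real (Re (e * z ^ m))" unfolding complex_add_cnj by simp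
    finally show ?thesis by (rule sym)
  qed
  then have "hform (\<lambda>i. h i + c i) m z = 0" for z
    using eq[of z] by (simp add: hform_def sum.distrib distrib_right)
  from hform_eq_0[OF this assms(5)] show ?thesis
    using assms by (auto simp: h_def split: if_splits)
qed

text \<open>The Taylor polynomial is integrated up, along rays, from those of the two Wirtinger
  derivatives; this produces the homogeneous part of degree \<open>k + 1\<close> as
  \<open>(z A\<^sub>k + cnj z B\<^sub>k) / (k + 1)\<close>.\<close>

lemma wirtinger_taylor:
  assumes S: "open S" "0 \<in> S"
  shows "smooth_on S f \<Longrightarrow> \<exists>c. vanishes_to_order (Suc r) (\<lambda>z. f z - (\<Sum>k\<le>r. hform (c k) k z)) \<and>
    (\<forall>k\<le>r. c k k = (dz ^^ k) f 0 / fact k \<and> c k 0 = (dzb ^^ k) f 0 / fact k)"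
proof (induction r arbitrary: f)
  case 0
  have "vanishes_to_order 1 (\<lambda>z. f z - f 0)"
    by (rule iter_deriv_0_imp_vanishes_to_order[OF S]) (use 0 S in \<open>auto intro!: smooth_intros\<close>)
  then show ?case by (intro exI[of _ "\<lambda>_ _. f 0"]) (simp add: hform_def)
next
  case (Suc r)
  obtain A where A: "vanishes_to_order (Suc r) (\<lambda>z. dz f z - (\<Sum>k\<le>r. hform (A k) k z))"
    "\<And>k. k \<le> r \<Longrightarrow> A k k = (dz ^^ k) (dz f) 0 / fact k"
    using Suc.IH[OF smooth_on_dz[OF Suc.prems S(1)]] by blast
  obtain B where B: "vanishes_to_order (Suc r) (\<lambda>z. dzb f z - (\<Sum>k\<le>r. hform (B k) k z))"
    "\<And>k. k \<le> r \<Longrightarrow> B k 0 = (dzb ^^ k) (dzb f) 0 / fact k"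
    using Suc.IH[OF smooth_on_dzb[OF Suc.prems S(1)]] by blast
  define c where "c = (\<lambda>k i. case k of 0 \<Rightarrow> f 0 | Suc k \<Rightarrow>
    ((if i = 0 then 0 else A k (i - 1)) + (if i \<le> k then B k i else 0)) / of_nat (Suc k))"
  have c0: "hform (c 0) 0 z = f 0" for z by (simp add: hform_def c_def)
  have cSuc: "of_nat (Suc k) * hform (c (Suc k)) (Suc k) z = z * hform (A k) k z + cnj z * hform (B k) k z" for k z
  proof -
    have "of_nat (Suc k) * hform (c (Suc k)) (Suc k) z =
      (\<Sum>i\<le>Suc k. (if i = 0 then 0 else A k (i - 1)) * z ^ i * cnj z ^ (Suc k - i)) +
      (\<Sum>i\<le>Suc k. (if i \<le> k then B k i else 0) * z ^ i * cnj z ^ (Suc k - i))"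
      unfolding hform_def sum_distrib_left sum.distrib[symmetric]
      by (rule sum.cong[OF refl]) (simp add: c_def field_simps del: of_nat_Suc)
    also have "(\<Sum>i\<le>Suc k. (if i = 0 then 0 else A k (i - 1)) * z ^ i * cnj z ^ (Suc k - i)) = z * hform (A k) k z"
      unfolding sum.atMost_Suc_shift hform_def sum_distrib_left by (simp add: mult_ac)
    also have "(\<Sum>i\<le>Suc k. (if i \<le> k then B k i else 0) * z ^ i * cnj z ^ (Suc k - i)) = cnj z * hform (B k) k z"
      unfolding sum.atMost_Suc hform_def sum_distrib_left
      by (simp add: mult_ac Suc_diff_le)
    finally show ?thesis .
  qed
  obtain C1 where C1: "\<forall>\<^sub>F z in nhds 0. norm (dz f z - (\<Sum>k\<le>r. hform (A k) k z)) \<le> C1 * norm z ^ Suc r"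
    using A(1) unfolding vanishes_to_order_def by blast
  obtain C2 where C2: "\<forall>\<^sub>F z in nhds 0. norm (dzb f z - (\<Sum>k\<le>r. hform (B k) k z)) \<le> C2 * norm z ^ Suc r"
    using B(1) unfolding vanishes_to_order_def by blast
  have "\<forall>\<^sub>F z in nhds 0. z \<in> S \<and> norm (dz f z - (\<Sum>k\<le>r. hform (A k) k z)) \<le> C1 * norm z ^ Suc r \<and>
      norm (dzb f z - (\<Sum>k\<le>r. hform (B k) k z)) \<le> C2 * norm z ^ Suc r"
    by (intro eventually_conj C1 C2 eventually_nhds_in_open S)
  then obtain d where d: "d > 0" and ball: "\<And>z. norm z < d \<Longrightarrow> z \<in> S \<and>
      norm (dz f z - (\<Sum>k\<le>r. hform (A k) k z)) \<le> C1 * norm z ^ Suc r \<and>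
      norm (dzb f z - (\<Sum>k\<le>r. hform (B k) k z)) \<le> C2 * norm z ^ Suc r"
    unfolding eventually_nhds_metric dist_0_norm by (auto simp: dist_norm)
  define K where "K = \<bar>C1\<bar> + \<bar>C2\<bar>"
  have "norm (f z - (\<Sum>k\<le>Suc r. hform (c k) k z)) \<le> K * norm z ^ Suc (Suc r)" if z: "norm z < d" for z
  proof -
    \<comment> \<open>The remainder along the ray through \<open>z\<close>; by \<open>cSuc\<close> its derivative is made of the
      remainders of the two Wirtinger derivatives.\<close>
    define g where "g = (\<lambda>t. f (t *\<^sub>R z) - (\<Sum>k\<le>Suc r. t ^ k *\<^sub>R hform (c k) k z))"
    define g' where "g' = (\<lambda>t. z * (dz f (t *\<^sub>R z) - (\<Sum>k\<le>r. hform (A k) k (t *\<^sub>R z))) +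
      cnj z * (dzb f (t *\<^sub>R z) - (\<Sum>k\<le>r. hform (B k) k (t *\<^sub>R z))))"
    have tz: "norm (t *\<^sub>R z) \<le> norm z" "norm (t *\<^sub>R z) < d" if "t \<in> {0..1}" for t
      using that z mult_left_le_one_le[of "norm z" t] by auto
    have D: "(g has_derivative (\<lambda>h. h *\<^sub>R g' t)) (at t within {0..1})" if t: "t \<in> {0..1}" for t
    proof -
      have F: "(f has_derivative (\<lambda>v. v * dz f (t *\<^sub>R z) + cnj v * dzb f (t *\<^sub>R z))) (at (t *\<^sub>R z))"
        using smooth_on_has_derivative[OF Suc.prems] ball[OF tz(2)[OF t]]
          dir_deriv_wirtinger[OF smooth_on_differentiable[OF Suc.prems]] by simp
      have 1: "((\<lambda>t. t *\<^sub>R z) has_derivative (\<lambda>h. h *\<^sub>R z)) (at t within {0..1})"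
        by (auto intro!: derivative_eq_intros)
      have P: "((\<lambda>t. \<Sum>k\<le>Suc r. t ^ k *\<^sub>R hform (c k) k z) has_derivative
          (\<lambda>h. \<Sum>k\<le>Suc r. (h * (of_nat k * t ^ (k - 1))) *\<^sub>R hform (c k) k z)) (at t within {0..1})"
        by (intro has_derivative_sum) (auto intro!: derivative_eq_intros simp: mult_ac)
      have "(\<Sum>k\<le>Suc r. (h * (of_nat k * t ^ (k - 1))) *\<^sub>R hform (c k) k z) =
        h *\<^sub>R (z * (\<Sum>k\<le>r. hform (A k) k (t *\<^sub>R z)) + cnj z * (\<Sum>k\<le>r. hform (B k) k (t *\<^sub>R z)))" for h
      proof -
        have "(\<Sum>k\<le>Suc r. (h * (of_nat k * t ^ (k - 1))) *\<^sub>R hform (c k) k z) =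
          (\<Sum>k\<le>r. (h * t ^ k) *\<^sub>R (of_nat (Suc k) * hform (c (Suc k)) (Suc k) z))"
          unfolding sum.atMost_Suc_shift by (simp add: scaleR_conv_of_real mult_ac del: of_nat_Suc)
        also have "\<dots> = h *\<^sub>R (z * (\<Sum>k\<le>r. hform (A k) k (t *\<^sub>R z)) + cnj z * (\<Sum>k\<le>r. hform (B k) k (t *\<^sub>R z)))"
          unfolding cSuc hform_scaleR sum_distrib_left scaleR_sum_right sum.distrib[symmetric] scaleR_add_right
          by (intro sum.cong[OF refl]) (simp add: scaleR_add_right)
        finally show ?thesis .
      qed
      with has_derivative_diff[OF has_derivative_compose[OF 1 F] P] show ?thesis
        unfolding g_def g'_def
        by (simp add: algebra_simps scaleR_add_right scaleR_diff_right)
    qed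
    have "norm (g 1 - g 0) \<le> (norm z * (K * norm z ^ Suc r)) * norm (1 - 0 :: real)"
    proof (rule differentiable_bound[OF _ D])
      fix t :: real assume t: "t \<in> {0..1}"
      have "norm (g' t) \<le> norm z * (C1 * norm (t *\<^sub>R z) ^ Suc r) + norm z * (C2 * norm (t *\<^sub>R z) ^ Suc r)"
        unfolding g'_def using ball[OF tz(2)[OF t]]
        by (intro norm_triangle_le add_mono) (auto simp: norm_mult simp del: norm_scaleR power_Suc intro!: mult_left_mono)
      also have "\<dots> \<le> norm z * (\<bar>C1\<bar> * norm z ^ Suc r) + norm z * (\<bar>C2\<bar> * norm z ^ Suc r)"
        using tz(1)[OF t] by (intro add_mono mult_left_mono mult_mono power_mono) auto
      finally have "norm (g' t) \<le> norm z * (K * norm z ^ Suc r)"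
        by (simp add: K_def algebra_simps)
      then show "onorm (\<lambda>h. h *\<^sub>R g' t) \<le> norm z * (K * norm z ^ Suc r)"
        by (rule onorm_scaleR_left_le)
    qed auto
    moreover have "g 0 = 0"
      unfolding g_def sum.atMost_Suc_shift by (simp add: c0)
    ultimately show ?thesis by (simp add: g_def mult_ac)
  qed
  then have "vanishes_to_order (Suc (Suc r)) (\<lambda>z. f z - (\<Sum>k\<le>Suc r. hform (c k) k z))"
    unfolding vanishes_to_order_def eventually_nhds_metric using d by (intro exI[of _ K] exI[of _ d]) (simp add: dist_norm)
  moreover have "c k k = (dz ^^ k) f 0 / fact k \<and> c k 0 = (dzb ^^ k) f 0 / fact k" if "k \<le> Suc r" for k
    using that A(2) B(2) by (cases k) (auto simp: c_def funpow_Suc_right simp del: funpow.simps)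
  ultimately show ?case by blast
qed

text \<open>Averaging each coefficient with the conjugate of its mirror image makes the homogeneous parts
  real valued, at the same order of approximation since \<open>g\<close> is real valued.\<close>

lemma real_taylor_no_harmonic:
  fixes g :: "complex \<Rightarrow> real"
  assumes S: "open S" "0 \<in> S" and g: "smooth_on S g"
    and dz: "\<And>k. k \<le> r \<Longrightarrow> (dz ^^ k) (\<lambda>z. of_real (g z)) 0 = 0"
  obtains c where "vanishes_to_order (Suc r) (\<lambda>z. g z - Re (\<Sum>k\<le>r. hform (c k) k z))"
    "\<And>k z. hform (c k) k z \<in> \<real>" "\<And>k. k \<le> r \<Longrightarrow> c k 0 = 0 \<and> c k k = 0"
proof -
  have f: "smooth_on S (\<lambda>z. complex_of_real (g z))" by (intro smooth_intros g S)
  obtain c where c: "vanishes_to_order (Suc r) (\<lambda>z. of_real (g z) - (\<Sum>k\<le>r. hform (c k) k z))"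
    and ck: "\<And>k. k \<le> r \<Longrightarrow> c k k = (dz ^^ k) (\<lambda>z. of_real (g z)) 0 / fact k \<and>
      c k 0 = (dzb ^^ k) (\<lambda>z. of_real (g z)) 0 / fact k"
    using wirtinger_taylor[OF S f] by blast
  define c' where "c' = (\<lambda>k i. (c k i + cnj (c k (k - i))) / 2)"
  have c': "hform (c' k) k z = of_real (Re (hform (c k) k z))" for k z
  proof -
    have "cnj (hform (c k) k z) = (\<Sum>i\<le>k. cnj (c k i) * z ^ (k - i) * cnj z ^ i)"
      unfolding hform_def cnj_sum by (intro sum.cong) (auto simp: mult_ac)
    also have "\<dots> = (\<Sum>i\<le>k. cnj (c k (k - i)) * z ^ i * cnj z ^ (k - i))"
      by (rule sum.reindex_bij_witness[of _ "\<lambda>i. k - i" "\<lambda>i. k - i"]) auto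
    finally have "hform (c k) k z + cnj (hform (c k) k z) =
        (\<Sum>i\<le>k. c k i * z ^ i * cnj z ^ (k - i) + cnj (c k (k - i)) * z ^ i * cnj z ^ (k - i))"
      by (simp only: hform_def sum.distrib)
    moreover have "hform (c' k) k z =
        (\<Sum>i\<le>k. (c k i * z ^ i * cnj z ^ (k - i) + cnj (c k (k - i)) * z ^ i * cnj z ^ (k - i)) / 2)"
      unfolding hform_def c'_def by (intro sum.cong refl) (simp add: field_simps)
    ultimately have "hform (c' k) k z = (hform (c k) k z + cnj (hform (c k) k z)) / 2"
      by (simp only: sum_divide_distrib)
    then show ?thesis by (simp only: complex_add_cnj) simp
  qed
  have "vanishes_to_order (Suc r) (\<lambda>z. g z - Re (\<Sum>k\<le>r. hform (c' k) k z))"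
  proof -
    obtain C where "\<forall>\<^sub>F z in nhds 0. norm (of_real (g z) - (\<Sum>k\<le>r. hform (c k) k z)) \<le> C * norm z ^ Suc r"
      using c unfolding vanishes_to_order_def by blast
    then have "\<forall>\<^sub>F z in nhds 0. norm (g z - Re (\<Sum>k\<le>r. hform (c' k) k z)) \<le> C * norm z ^ Suc r"
    proof eventually_elim
      case (elim z)
      have "g z - Re (\<Sum>k\<le>r. hform (c' k) k z) = Re (of_real (g z) - (\<Sum>k\<le>r. hform (c k) k z))"
        by (simp add: c')
      then show ?case using elim abs_Re_le_cmod order_trans by (metis real_norm_def)
    qed
    then show ?thesis unfolding vanishes_to_order_def by blast
  qed
  moreover have "c' k 0 = 0 \<and> c' k k = 0" if "k \<le> r" for k
    using ck[OF that] dz[OF that] cnj_dz_funpow_of_real[OF S(1) f S(2), of k]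
    by (simp add: c'_def)
  ultimately show thesis using that[of c'] c' by simp
qed

section \<open>Removing the harmonic terms\<close>

lemma dz_field_derivative: "(f has_field_derivative f') (at x) \<Longrightarrow> dz f x = f'"
  unfolding dz_def by (simp add: dir_deriv_eq[OF has_field_derivative_imp_has_derivative] algebra_simps)

lemma dz_Re: "(f has_field_derivative f') (at x) \<Longrightarrow> dz (\<lambda>z. of_real (Re (f z))) x = f' / 2"
  unfolding dz_def
  by (subst (1 2) dir_deriv_eq[OF bounded_linear.has_derivative[OF bounded_linear_of_real
        bounded_linear.has_derivative[OF bounded_linear_Re has_field_derivative_imp_has_derivative]]])
    (auto simp: complex_eq_iff)

lemma dz_funpow_monomial: "(dz ^^ k) (\<lambda>z. \<gamma> * z ^ n) 0 = (if k = n then \<gamma> * fact n else 0)"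
proof (induction k arbitrary: \<gamma> n)
  case 0
  then show ?case by (cases n) auto
next
  case (Suc k)
  have "dz (\<lambda>z. \<gamma> * z ^ n) = (\<lambda>z. (\<gamma> * of_nat n) * z ^ (n - 1))"
    by (rule ext, rule dz_field_derivative) (auto intro!: derivative_eq_intros)
  then show ?case using Suc[of "\<gamma> * of_nat n" "n - 1"]
    by (cases n) (auto simp: funpow_Suc_right simp del: funpow.simps of_nat_Suc)
qed

lemma dz_funpow_Re_monomial:
  assumes "n > 0"
  shows "(dz ^^ k) (\<lambda>z. of_real (Re (\<gamma> * z ^ n))) 0 = (if k = n then \<gamma> * fact n / 2 else 0)"
proof (cases k)
  case (Suc j)
  have "dz (\<lambda>z. of_real (Re (\<gamma> * z ^ n))) = (\<lambda>z. (\<gamma> * of_nat n / 2) * z ^ (n - 1))"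
    by (rule ext, rule trans, rule dz_Re) (auto intro!: derivative_eq_intros)
  then show ?thesis using dz_funpow_monomial[of j "\<gamma> * of_nat n / 2" "n - 1"] assms unfolding Suc
    by (cases n) (auto simp: funpow_Suc_right simp del: funpow.simps of_nat_Suc)
qed (use assms in simp)

text \<open>Let \<open>Re w = \<phi> (Im w, z)\<close> be a hypersurface and \<open>q\<close> its point with \<open>(Im w, z) = y\<close>. In the
  coordinates \<open>w - fst q + h (z - snd q)\<close> and \<open>z - snd q\<close> it is a graph again; \<open>sheared \<phi> y h\<close> is the
  new graph function on \<open>Im w = 0\<close>.\<close>

definition sheared :: "(real \<times> complex \<Rightarrow> real) \<Rightarrow> real \<times> complex \<Rightarrow> (complex \<Rightarrow> complex) \<Rightarrow> complex \<Rightarrow> real" where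
  "sheared \<phi> y h z = \<phi> (fst y - Im (h z), snd y + z) - \<phi> y + Re (h z)"

text \<open>Multiplication by this number absorbs the linear term of \<open>\<phi>\<close> in \<open>t = Im w\<close>:
  \<open>Re (c w) = Re w - a Im w\<close> for \<open>c = 1 + \<i> a\<close>.\<close>

definition normal_factor :: "(real \<times> complex \<Rightarrow> real) \<Rightarrow> real \<times> complex \<Rightarrow> complex" where
  "normal_factor \<phi> y = Complex 1 (dir_deriv (1, 0) \<phi> y)"

lemma sheared_smooth:
  assumes D: "open D" and y: "y \<in> D" and \<phi>: "smooth_on D \<phi>" and h: "smooth_on UNIV h" "h 0 = 0"
  obtains S where "open S" "0 \<in> S" "smooth_on S (sheared \<phi> y h)"
    "\<And>z. z \<in> S \<Longrightarrow> (fst y - Im (h z), snd y + z) \<in> D"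
proof
  define m where "m = (\<lambda>z. (fst y - Im (h z), snd y + z))"
  have m: "smooth_on UNIV m" unfolding m_def by (intro smooth_intros h open_UNIV)
  show S: "open (m -` D)" using smooth_on_continuous_on[OF m] D by (rule open_vimage[rotated])
  show "0 \<in> m -` D" using y h by (simp add: m_def)
  have "smooth_on (m -` D) (\<lambda>z. \<phi> (m z))"
    by (rule smooth_on_compose[OF \<phi> smooth_on_subset[OF m] S]) auto
  then show "smooth_on (m -` D) (sheared \<phi> y h)"
    unfolding sheared_def[abs_def] m_def[symmetric] 
    by (intro smooth_intros S smooth_on_subset[OF h(1)]) (auto simp: m_def)
  show "(fst y - Im (h z), snd y + z) \<in> D" if "z \<in> m -` D" for z using that by (simp add: m_def)
qed

text \<open>To first order \<open>\<phi>\<close> changes by \<open>- a Im (\<beta> z\<^sup>n)\<close> with the derivative \<open>a\<close> of \<open>\<phi>\<close> at \<open>y\<close>; together with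
  the change \<open>Re (\<beta> z\<^sup>n)\<close> of \<open>Re h\<close> this is the real part of the monomial times \<open>normal_factor \<phi> y\<close>.\<close>

lemma sheared_add_monomial:
  assumes D: "open D" and y: "y \<in> D" and \<phi>: "smooth_on D \<phi>" and h: "smooth_on UNIV h" "h 0 = 0"
    and n: "n > 0"
  shows "vanishes_to_order (Suc n) (\<lambda>z. sheared \<phi> y (\<lambda>z. h z + \<beta> * z ^ n) z - sheared \<phi> y h z
    - Re (normal_factor \<phi> y * \<beta> * z ^ n))"
proof -
  define k where "k = (\<lambda>z. h z + \<beta> * z ^ n)"
  define a where "a = dir_deriv (1, 0) \<phi> y"
  let ?p = "\<lambda>\<theta> z. (- Im (h z) - \<theta> * Im (\<beta> * z ^ n), z)"
  \<comment> \<open>The \<open>t\<close>-derivative of \<open>\<phi>\<close> differs from its value at \<open>y\<close> by at most a multiple of the distance.\<close>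
  have trans: "smooth_on ((+) y -` D) (\<lambda>x. dir_deriv (1, 0) \<phi> (y + x) - a)" "open ((+) y -` D)"
  proof -
    show o: "open ((+) y -` D)" by (rule open_vimage[OF D]) (intro continuous_intros)
    show "smooth_on ((+) y -` D) (\<lambda>x. dir_deriv (1, 0) \<phi> (y + x) - a)"
      by (intro smooth_intros smooth_on_compose[OF smooth_on_dir_deriv[OF \<phi>]] o) auto
  qed
  have "vanishes_to_order 1 (\<lambda>x. dir_deriv (1, 0) \<phi> (y + x) - a)"
    by (rule vanishes_to_order_1[OF trans(2) _ trans(1)]) (use y in \<open>auto simp: a_def\<close>)
  then obtain L where "\<forall>\<^sub>F x in nhds 0. norm (dir_deriv (1, 0) \<phi> (y + x) - a) \<le> L * norm x ^ 1"
    unfolding vanishes_to_order_def by blast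
  then have "\<forall>\<^sub>F x in nhds 0. norm (dir_deriv (1, 0) \<phi> (y + x) - a) \<le> L * norm x ^ 1 \<and> x \<in> (+) y -` D"
    by (rule eventually_conj) (rule eventually_nhds_in_open[OF trans(2)], use y in simp)
  then obtain d where d: "d > 0" and L: "\<And>x. norm x < d \<Longrightarrow>
      norm (dir_deriv (1, 0) \<phi> (y + x) - a) \<le> L * norm x \<and> y + x \<in> D"
    unfolding eventually_nhds_metric by (auto simp: dist_norm)
  have "vanishes_to_order 1 h" by (rule vanishes_to_order_1[OF open_UNIV _ h]) simp
  then obtain H where "\<forall>\<^sub>F z in nhds 0. norm (h z) \<le> H * norm z ^ 1"
    unfolding vanishes_to_order_def by blast
  moreover define K where "K = \<bar>H\<bar> + norm \<beta> + 1"
  have K: "K > 0" by (simp add: K_def add_nonneg_pos)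
  then have "\<forall>\<^sub>F z in nhds 0. z \<in> ball (0::complex) (min 1 (d / K))"
    by (intro eventually_nhds_in_open) (use d in auto)
  ultimately have "\<forall>\<^sub>F z in nhds 0. norm (sheared \<phi> y k z - sheared \<phi> y h z - Re (normal_factor \<phi> y * \<beta> * z ^ n))
    \<le> (norm \<beta> * (\<bar>L\<bar> * K)) * norm z ^ Suc n"
  proof eventually_elim
    case (elim z)
    define \<epsilon> where "\<epsilon> = Im (\<beta> * z ^ n)"
    have z: "norm z < 1" "K * norm z < d"
      using elim(2) K by (auto simp: pos_less_divide_eq mult.commute)
    have \<epsilon>: "\<bar>\<epsilon>\<bar> \<le> norm \<beta> * norm z ^ n"
      using abs_Im_le_cmod[of "\<beta> * z ^ n"] by (simp add: \<epsilon>_def norm_mult norm_power)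
    also have "\<dots> \<le> norm \<beta> * norm z"
      using power_decreasing[of 1 n "norm z"] z n by (intro mult_left_mono) auto
    finally have \<epsilon>1: "\<bar>\<epsilon>\<bar> \<le> norm \<beta> * norm z" .
    have p: "norm (?p \<theta> z) \<le> K * norm z" if "\<theta> \<in> {0..1}" for \<theta>
    proof -
      have "norm (?p \<theta> z) \<le> norm (- Im (h z) - \<theta> * \<epsilon>) + norm z"
        unfolding \<epsilon>_def by (rule norm_Pair_le)
      also have "norm (- Im (h z) - \<theta> * \<epsilon>) \<le> norm (h z) + \<bar>\<epsilon>\<bar>"
      proof -
        have "\<bar>\<theta> * \<epsilon>\<bar> \<le> \<bar>\<epsilon>\<bar>" using that by (auto simp: abs_mult intro!: mult_left_le_one_le)
        then show ?thesis using abs_Im_le_cmod[of "h z"] unfolding real_norm_def by linarith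
      qed
      also have "norm (h z) \<le> \<bar>H\<bar> * norm z"
        using elim(1) mult_right_mono[OF abs_ge_self[of H] norm_ge_zero[of z]] by simp
      finally show ?thesis using \<epsilon>1 by (simp add: K_def distrib_right)
    qed
    \<comment> \<open>The remainder along the segment between the two arguments of \<open>\<phi>\<close>, which is moved by \<open>- \<epsilon>\<close> in \<open>t\<close>\<close>
    define g where "g = (\<lambda>\<theta>. \<phi> (y + ?p \<theta> z) + a * (\<theta> * \<epsilon>))"
    have D: "(g has_derivative (\<lambda>r. r *\<^sub>R (- \<epsilon> * (dir_deriv (1, 0) \<phi> (y + ?p \<theta> z) - a)))) (at \<theta> within {0..1})"
      if "\<theta> \<in> {0..1}" for \<theta>
    proof -
      have "y + ?p \<theta> z \<in> D" using L[of "?p \<theta> z"] p[OF that] z by simp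
      note F = smooth_on_has_derivative[OF \<phi> this]
      have "((\<lambda>\<theta>. y + ?p \<theta> z) has_derivative (\<lambda>r. (- r * \<epsilon>) *\<^sub>R (1, 0))) (at \<theta> within {0..1})"
        by (auto intro!: derivative_eq_intros simp: \<epsilon>_def)
      from has_derivative_compose[OF this F, unfolded linear_scale[OF has_derivative_linear[OF F]]]
      have "((\<lambda>\<theta>. \<phi> (y + ?p \<theta> z)) has_derivative (\<lambda>r. (- r * \<epsilon>) *\<^sub>R dir_deriv (1, 0) \<phi> (y + ?p \<theta> z))) (at \<theta> within {0..1})" .
      then show ?thesis unfolding g_def
        by (auto intro!: derivative_eq_intros simp: algebra_simps)
    qed
    have "norm (g 1 - g 0) \<le> (\<bar>\<epsilon>\<bar> * (\<bar>L\<bar> * (K * norm z))) * norm (1 - 0 :: real)"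
    proof (rule differentiable_bound[OF _ D])
      fix \<theta> :: real assume \<theta>: "\<theta> \<in> {0..1}"
      have "norm (dir_deriv (1, 0) \<phi> (y + ?p \<theta> z) - a) \<le> L * norm (?p \<theta> z)"
        using L[of "?p \<theta> z"] p[OF \<theta>] z by simp
      also have "\<dots> \<le> \<bar>L\<bar> * (K * norm z)"
        using p[OF \<theta>] by (intro mult_mono) auto
      finally have "\<bar>\<epsilon>\<bar> * norm (dir_deriv (1, 0) \<phi> (y + ?p \<theta> z) - a) \<le> \<bar>\<epsilon>\<bar> * (\<bar>L\<bar> * (K * norm z))"
        by (rule mult_left_mono) simp
      then show "onorm (\<lambda>r. r *\<^sub>R (- \<epsilon> * (dir_deriv (1, 0) \<phi> (y + ?p \<theta> z) - a))) \<le> \<bar>\<epsilon>\<bar> * (\<bar>L\<bar> * (K * norm z))"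
        by (intro onorm_scaleR_left_le) (simp only: real_norm_def abs_mult abs_minus_cancel)
    qed auto
    also have "\<dots> \<le> (norm \<beta> * norm z ^ n) * (\<bar>L\<bar> * (K * norm z))"
      using \<epsilon> K by (simp add: mult_right_mono)
    also have "g 1 - g 0 = sheared \<phi> y k z - sheared \<phi> y h z - Re (normal_factor \<phi> y * \<beta> * z ^ n)"
      by (cases y) (simp add: g_def sheared_def k_def normal_factor_def a_def \<epsilon>_def algebra_simps)
    finally show ?case by (simp add: mult_ac)
  qed
  then show ?thesis unfolding vanishes_to_order_def k_def by blast
qed

lemma dz_funpow_sheared_add_monomial:
  assumes D: "open D" and y: "y \<in> D" and \<phi>: "smooth_on D \<phi>" and h: "smooth_on UNIV h" "h 0 = 0"
    and n: "n > 0" and "k \<le> n"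
  shows "(dz ^^ k) (\<lambda>z. of_real (sheared \<phi> y (\<lambda>z. h z + \<beta> * z ^ n) z)) 0 =
    (dz ^^ k) (\<lambda>z. of_real (sheared \<phi> y h z)) 0 + (if k = n then normal_factor \<phi> y * \<beta> * fact n / 2 else 0)"
proof -
  let ?h' = "\<lambda>z. h z + \<beta> * z ^ n"
  have h': "smooth_on UNIV ?h'" "?h' 0 = 0"
    using n h by (auto intro!: smooth_intros)
  obtain S where S: "open S" "0 \<in> S" "smooth_on S (sheared \<phi> y h)"
    by (rule sheared_smooth[OF D y \<phi> h])
  obtain S' where S': "open S'" "0 \<in> S'" "smooth_on S' (sheared \<phi> y ?h')"
    by (rule sheared_smooth[OF D y \<phi> h'])
  define T where "T = S \<inter> S'"
  have T: "open T" "0 \<in> T" using S S' by (auto simp: T_def)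
  have s: "smooth_on T (sheared \<phi> y h)" "smooth_on T (sheared \<phi> y ?h')"
    unfolding T_def by (rule smooth_on_subset[OF S(3)], blast) (rule smooth_on_subset[OF S'(3)], blast)
  define E where "E = (\<lambda>z. sheared \<phi> y ?h' z - sheared \<phi> y h z - Re (normal_factor \<phi> y * \<beta> * z ^ n))"
  have sE: "smooth_on T (\<lambda>z. complex_of_real (E z))" and sM: "smooth_on T (\<lambda>z. complex_of_real (Re (normal_factor \<phi> y * \<beta> * z ^ n)))"
    and sh: "smooth_on T (\<lambda>z. complex_of_real (sheared \<phi> y h z))"
    unfolding E_def by (intro smooth_intros s T)+
  have "vanishes_to_order (Suc n) (\<lambda>z. complex_of_real (E z))"
    using sheared_add_monomial[OF D y \<phi> h n, of \<beta>]
    unfolding vanishes_to_order_def E_def[symmetric] norm_of_real real_norm_def .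
  then have E0: "(dz ^^ k) (\<lambda>z. of_real (E z)) 0 = 0"
    by (rule dz_funpow_eq_0[OF T sE vanishes_to_order_mono]) (use \<open>k \<le> n\<close> in simp)
  have "(\<lambda>z. complex_of_real (sheared \<phi> y ?h' z)) =
    (\<lambda>z. complex_of_real (sheared \<phi> y h z) + (of_real (Re (normal_factor \<phi> y * \<beta> * z ^ n)) + of_real (E z)))"
    by (simp add: E_def)
  then have "(dz ^^ k) (\<lambda>z. of_real (sheared \<phi> y ?h' z)) 0 =
    (dz ^^ k) (\<lambda>z. of_real (sheared \<phi> y h z)) 0 + ((dz ^^ k) (\<lambda>z. of_real (Re (normal_factor \<phi> y * \<beta> * z ^ n))) 0
      + (dz ^^ k) (\<lambda>z. of_real (E z)) 0)"
    using dz_funpow_add[OF T(1) sh smooth_on_add[OF sM sE T(1)] T(2)] dz_funpow_add[OF T(1) sM sE T(2)] by simp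
  then show ?thesis unfolding E0 dz_funpow_Re_monomial[OF n] by simp
qed

text \<open>A Wirtinger derivative in the second of two variables, to see that the derivatives
  of a smooth family depend smoothly on the parameter.\<close>

definition dz_snd :: "('a::euclidean_space \<times> complex \<Rightarrow> complex) \<Rightarrow> 'a \<times> complex \<Rightarrow> complex" where
  "dz_snd G x = (dir_deriv (0, 1) G x - \<i> * dir_deriv (0, \<i>) G x) / 2"

lemma smooth_on_dz_snd_funpow: "smooth_on W G \<Longrightarrow> open W \<Longrightarrow> smooth_on W ((dz_snd ^^ k) G)"
proof (induction k)
  case (Suc k)
  then show ?case unfolding funpow.simps o_def dz_snd_def[of "(dz_snd ^^ k) G", abs_def] divide_inverse
    by (intro smooth_intros smooth_on_dir_deriv)
qed simp

lemma dz_funpow_slice: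
  assumes W: "open W" and G: "smooth_on W G"
  shows "(y, z) \<in> W \<Longrightarrow> (dz ^^ k) (\<lambda>z. G (y, z)) z = (dz_snd ^^ k) G (y, z)"
proof (induction k arbitrary: z)
  case (Suc k)
  have o: "open (Pair y -` W)" by (rule open_vimage[OF W]) (intro continuous_intros)
  have "(dz ^^ Suc k) (\<lambda>z. G (y, z)) z = dz (\<lambda>z. (dz_snd ^^ k) G (y, z)) z"
    using dz_cong_open[OF o, of z "(dz ^^ k) (\<lambda>z. G (y, z))"] Suc by simp
  also have "\<dots> = dz_snd ((dz_snd ^^ k) G) (y, z)"
  proof -
    have "((\<lambda>z. (y, z)) has_derivative (\<lambda>v. (0, v))) (at z)" by (auto intro!: derivative_eq_intros)
    note D = has_derivative_compose[OF this
        smooth_on_has_derivative[OF smooth_on_dz_snd_funpow[OF G W, of k] Suc.prems]]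
    show ?thesis
      unfolding dz_def[of "\<lambda>z. (dz_snd ^^ k) G (y, z)"] dz_snd_def[of "(dz_snd ^^ k) G"]
      by (simp add: dir_deriv_eq[OF D])
  qed
  finally show ?case by simp
qed simp

text \<open>The coefficients are found one by one: the \<open>n\<close>-th one adds a multiple of
  \<open>normal_factor \<phi> y\<close>, which is never zero, to the \<open>n\<close>-th pure derivative and does not change the lower ones.\<close>

lemma exists_shear:
  assumes D: "open D" and \<phi>: "smooth_on D \<phi>"
  shows "\<exists>b. (\<forall>i. smooth_on D (b i)) \<and> (\<forall>y\<in>D. \<forall>k\<le>n.
    (dz ^^ k) (\<lambda>z. of_real (sheared \<phi> y (\<lambda>z. \<Sum>i<n. b i y * z ^ Suc i) z)) 0 = 0)"
proof (induction n)
  case 0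
  show ?case by (intro exI[of _ "\<lambda>_ _. 0"]) (auto simp: sheared_def intro: smooth_on_const)
next
  case (Suc n)
  then obtain b where b: "\<And>i. smooth_on D (b i)" and b0: "\<And>y k. y \<in> D \<Longrightarrow> k \<le> n \<Longrightarrow>
    (dz ^^ k) (\<lambda>z. of_real (sheared \<phi> y (\<lambda>z. \<Sum>i<n. b i y * z ^ Suc i) z)) 0 = 0"
    by blast
  define H where "H = (\<lambda>y z. \<Sum>i<n. b i y * z ^ Suc i)"
  have H: "smooth_on UNIV (H y)" "H y 0 = 0" for y
    unfolding H_def by (auto intro!: smooth_intros)
  define G where "G = (\<lambda>x. complex_of_real (sheared \<phi> (fst x) (H (fst x)) (snd x)))"
  have DU: "open (D \<times> (UNIV :: complex set))" by (intro open_Times D open_UNIV)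
  define m where "m = (\<lambda>x. (fst (fst x) - Im (H (fst x) (snd x)), snd (fst x) + snd x))"
  have 1: "smooth_on (D \<times> (UNIV :: complex set)) (\<lambda>x. f (fst x))" if "smooth_on D f" for f :: "_ \<Rightarrow> 'c::real_normed_vector"
    by (rule smooth_on_compose[OF that]) (auto intro!: smooth_intros DU)
  have sH: "smooth_on (D \<times> UNIV) (\<lambda>x. H (fst x) (snd x))"
    unfolding H_def by (intro smooth_intros 1 b DU finite_lessThan)
  have m: "smooth_on (D \<times> UNIV) m"
    unfolding m_def by (intro smooth_intros sH DU)
  define W where "W = (D \<times> UNIV) \<inter> m -` D"
  have W: "open W"
    unfolding W_def by (rule continuous_open_preimage[OF smooth_on_continuous_on[OF m] DU D])
  have G: "smooth_on W G"
  proof -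
    have WD: "W \<subseteq> D \<times> UNIV" by (auto simp: W_def)
    have "smooth_on W (\<lambda>x. \<phi> (m x))"
      by (rule smooth_on_compose[OF \<phi> smooth_on_subset[OF m WD] W]) (auto simp: W_def)
    then show ?thesis unfolding G_def sheared_def m_def
      by (intro smooth_intros W smooth_on_subset[OF sH WD] smooth_on_subset[OF 1[OF \<phi>] WD])
  qed
  have W0: "(y, 0) \<in> W" if "y \<in> D" for y using that H by (simp add: W_def m_def)
  have nf: "smooth_on D (normal_factor \<phi>)" "normal_factor \<phi> y \<noteq> 0" for y
  proof -
    have "normal_factor \<phi> = (\<lambda>y. 1 + \<i> * of_real (dir_deriv (1, 0) \<phi> y))"
      by (rule ext) (simp add: normal_factor_def complex_eq_iff)
    then show "smooth_on D (normal_factor \<phi>)" by (auto intro!: smooth_intros smooth_on_dir_deriv \<phi> D)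
  qed (simp add: normal_factor_def complex_eq_iff)
  \<comment> \<open>The \<open>n + 1\<close>-st pure derivative changes by \<open>normal_factor \<phi> y * \<beta> y * fact (n + 1) / 2\<close>.\<close>
  define \<beta> where "\<beta> = (\<lambda>y. (- 2 / fact (Suc n)) * ((dz_snd ^^ Suc n) G (y, 0) * inverse (normal_factor \<phi> y)))"
  have \<beta>: "smooth_on D \<beta>"
    unfolding \<beta>_def
    by (intro smooth_intros D smooth_on_inverse nf smooth_on_compose[OF smooth_on_dz_snd_funpow[OF G W]])
      (use W0 in auto)
  define b' where "b' = b(n := \<beta>)"
  have "smooth_on D (b' i)" for i using b \<beta> by (simp add: b'_def)
  moreover have "(dz ^^ k) (\<lambda>z. of_real (sheared \<phi> y (\<lambda>z. \<Sum>i<Suc n. b' i y * z ^ Suc i) z)) 0 = 0"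
    if y: "y \<in> D" and k: "k \<le> Suc n" for y k
  proof -
    have "(\<lambda>z. \<Sum>i<Suc n. b' i y * z ^ Suc i) = (\<lambda>z. H y z + \<beta> y * z ^ Suc n)"
      by (rule ext) (simp add: b'_def H_def)
    then have "(dz ^^ k) (\<lambda>z. of_real (sheared \<phi> y (\<lambda>z. \<Sum>i<Suc n. b' i y * z ^ Suc i) z)) 0 =
      (dz ^^ k) (\<lambda>z. G (y, z)) 0 + (if k = Suc n then normal_factor \<phi> y * \<beta> y * fact (Suc n) / 2 else 0)"
      using dz_funpow_sheared_add_monomial[OF D y \<phi> H[of y], where n="Suc n" and k=k and \<beta>="\<beta> y"] k by (simp add: G_def)
    also have "\<dots> = 0"
    proof (cases "k = Suc n")
      case True
      then show ?thesis
        using dz_funpow_slice[OF W G W0[OF y], of "Suc n"] nf(2)[of y]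
        by (simp add: \<beta>_def field_simps del: funpow.simps fact_Suc)
    next
      case False
      then show ?thesis using b0[OF y, of k] k by (simp add: G_def H_def)
    qed
    finally show ?thesis .
  qed
  ultimately show ?case by blast
qed

section \<open>Orders of vanishing along analytic discs\<close>

text \<open>The coefficient \<open>b\<close> may be \<open>0\<close>: then \<open>l\<close> need not be the exact order, and the zero function has
  leading terms of all orders. This treats discs with a vanishing component uniformly.\<close>

definition leading_term :: "(complex \<Rightarrow> complex) \<Rightarrow> nat \<Rightarrow> complex \<Rightarrow> bool" where
  "leading_term H l b \<longleftrightarrow> (\<exists>g. (g \<longlongrightarrow> b) (nhds 0) \<and> (\<forall>\<^sub>F s in nhds 0. H s = s ^ l * g s))"

lemma leading_term_lower:
  assumes "leading_term H l b" "m < l"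
  shows "leading_term H m 0"
proof -
  obtain g where g: "(g \<longlongrightarrow> b) (nhds 0)" "\<forall>\<^sub>F s in nhds 0. H s = s ^ l * g s"
    using assms(1) unfolding leading_term_def by blast
  have "((\<lambda>s. s ^ (l - m) * g s) \<longlongrightarrow> 0 ^ (l - m) * b) (nhds 0)"
    by (intro tendsto_intros g) (simp add: filterlim_ident)
  then have "((\<lambda>s. s ^ (l - m) * g s) \<longlongrightarrow> 0) (nhds 0)"
    using assms(2) by (simp add: zero_power)
  moreover have eq: "s ^ l * g s = s ^ m * (s ^ (l - m) * g s)" for s
    using assms(2) unfolding mult.assoc[symmetric] power_add[symmetric] by simp
  then have "\<forall>\<^sub>F s in nhds 0. H s = s ^ m * (s ^ (l - m) * g s)"
    using g(2) by (simp only: eq)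
  ultimately show ?thesis
    unfolding leading_term_def by (intro exI[of _ "\<lambda>s. s ^ (l - m) * g s"] conjI)
qed

lemma leading_term_vanishes:
  assumes "leading_term H l b"
  shows "vanishes_to_order l H"
proof -
  obtain g where g: "(g \<longlongrightarrow> b) (nhds 0)" "\<forall>\<^sub>F s in nhds 0. H s = s ^ l * g s"
    using assms(1) unfolding leading_term_def by blast
  have "\<forall>\<^sub>F s in nhds 0. norm (g s) < norm b + 1"
    by (rule order_tendstoD(2)[OF tendsto_norm[OF g(1)]]) simp
  then have "\<forall>\<^sub>F s in nhds 0. norm (H s) \<le> (norm b + 1) * norm s ^ l"
    using g(2) by eventually_elim (simp add: norm_mult norm_power mult.commute mult_right_mono)
  then show ?thesis unfolding vanishes_to_order_def by blast
qed

lemma leading_term_holomorphic: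
  assumes H: "H holomorphic_on ball 0 1" "H 0 = 0"
  shows "(\<forall>l. leading_term H l 0) \<and> H constant_on ball 0 1 \<or> (\<exists>l b. l > 0 \<and> b \<noteq> 0 \<and> leading_term H l b)"
proof (cases "H constant_on ball 0 1")
  case True
  then have "\<And>s. s \<in> ball 0 1 \<Longrightarrow> H s = 0"
    using H(2) unfolding constant_on_def by force
  moreover have "\<forall>\<^sub>F s in nhds 0. s \<in> ball (0::complex) 1"
    by (rule eventually_nhds_in_open) auto
  ultimately have "\<forall>\<^sub>F s in nhds 0. H s = s ^ l * 0" for l
    by (auto elim: eventually_mono)
  then have "leading_term H l 0" for l
    unfolding leading_term_def by (intro exI[of _ "\<lambda>_. 0"] conjI tendsto_const)
  then show ?thesis using True by blast
next
  case False
  have 0: "(0::complex) \<in> ball 0 1" by simp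
  obtain g r n where g: "0 < n" "0 < r" "ball (0::complex) r \<subseteq> ball 0 1" "g holomorphic_on ball 0 r"
    "\<And>w. w \<in> ball 0 r \<Longrightarrow> H w = (w - 0) ^ n * g w" "\<And>w. w \<in> ball 0 r \<Longrightarrow> g w \<noteq> 0"
    by (rule holomorphic_factor_zero_nonconstant[OF H(1) open_ball connected_ball 0 H(2) False], rule that)
  have "isCont g 0"
    using holomorphic_on_imp_continuous_on[OF g(4)] g(2)
      continuous_on_eq_continuous_at[OF open_ball, of 0 r g] by (metis centre_in_ball)
  then have "(g \<longlongrightarrow> g 0) (nhds 0)"
    by (simp add: isCont_def tendsto_at_iff_tendsto_nhds)
  moreover have "\<forall>\<^sub>F s in nhds 0. s \<in> ball (0::complex) r"
    by (rule eventually_nhds_in_open) (use g(2) in auto)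
  then have "\<forall>\<^sub>F s in nhds 0. H s = s ^ n * g s"
    by (rule eventually_mono) (use g(5) in auto)
  ultimately have "leading_term H n (g 0)" unfolding leading_term_def by blast
  then show ?thesis using g(1) g(6)[of 0] g(2) by auto
qed

lemma leading_term_ray:
  assumes "leading_term H l b"
  obtains u where "(u \<longlongrightarrow> b * s ^ l) (at_right 0)" "\<forall>\<^sub>F t in at_right 0. H (t *\<^sub>R s) = t ^ l *\<^sub>R u t"
proof -
  obtain g where g: "(g \<longlongrightarrow> b) (nhds 0)" "\<forall>\<^sub>F s in nhds 0. H s = s ^ l * g s"
    using assms(1) unfolding leading_term_def by blast
  have ts: "((\<lambda>t. t *\<^sub>R s) \<longlongrightarrow> 0) (at_right 0)"
    by (rule tendsto_eq_intros | simp)+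
  show thesis
  proof
    show "((\<lambda>t. g (t *\<^sub>R s) * s ^ l) \<longlongrightarrow> b * s ^ l) (at_right 0)"
      by (intro tendsto_intros filterlim_compose[OF g(1) ts])
    show "\<forall>\<^sub>F t in at_right 0. H (t *\<^sub>R s) = t ^ l *\<^sub>R (g (t *\<^sub>R s) * s ^ l)"
      using eventually_compose_filterlim[OF g(2) ts]
      by eventually_elim (simp add: scaleR_conv_of_real power_mult_distrib mult_ac)
  qed
qed

lemma vanishes_to_order_ray:
  fixes G :: "complex \<Rightarrow> real"
  assumes "vanishes_to_order (Suc M) G"
  shows "((\<lambda>t. G (t *\<^sub>R s) / t ^ M) \<longlongrightarrow> 0) (at_right 0)"
proof -
  obtain C where C: "\<forall>\<^sub>F x in nhds 0. norm (G x) \<le> C * norm x ^ Suc M"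
    using assms unfolding vanishes_to_order_def by blast
  have ts: "((\<lambda>t. t *\<^sub>R s) \<longlongrightarrow> 0) (at_right 0)"
    by (rule tendsto_eq_intros | simp)+
  have lim: "((\<lambda>t. C * norm s ^ Suc M * t) \<longlongrightarrow> C * norm s ^ Suc M * 0) (at_right (0::real))"
    by (intro tendsto_intros)
  have "\<forall>\<^sub>F t in at_right (0::real). t > 0" by (simp add: eventually_at_filter)
  then have "\<forall>\<^sub>F t in at_right 0. norm (G (t *\<^sub>R s) / t ^ M) \<le> C * norm s ^ Suc M * t"
    using eventually_compose_filterlim[OF C ts]
    by eventually_elim (simp add: field_simps power_mult_distrib)
  then show ?thesis by (rule Lim_null_comparison) (use lim in \<open>simp only: mult_zero_right\<close>)
qed

text \<open>The leading behaviour of the defining function on a ray, where \<open>W\<close> and \<open>Z\<close> are the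
  components of the disc and \<open>e\<close> gives the lowest homogeneous part of \<open>T\<close>.\<close>

lemma ray_limit:
  fixes T :: "complex \<Rightarrow> real" and N :: "real \<times> complex \<Rightarrow> real"
  assumes W: "leading_term W M b" and Z: "leading_term Z l b'" and M: "M > 0" "l > 0" "M \<le> m * l"
    and T: "vanishes_to_order (Suc m) (\<lambda>z. T z - Re (hform e m z))"
    and N: "(N \<longlongrightarrow> 0) (nhds 0)"
    and G: "\<forall>\<^sub>F s in nhds 0. G s = Re (c * W s) - T (Z s) - Im (W s) * N (Im (W s), Z s)"
  shows "((\<lambda>t. G (t *\<^sub>R s) / t ^ M) \<longlongrightarrow>
    Re (c * b * s ^ M) - (if M = m * l then Re (hform e m (b' * s ^ l)) else 0)) (at_right 0)"
proof -
  have ts: "((\<lambda>t. t *\<^sub>R s) \<longlongrightarrow> 0) (at_right 0)"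
    by (rule tendsto_eq_intros | simp)+
  have pos: "\<forall>\<^sub>F t in at_right (0::real). t > 0" by (simp add: eventually_at_filter)
  obtain u where u: "(u \<longlongrightarrow> b * s ^ M) (at_right 0)" "\<forall>\<^sub>F t in at_right 0. W (t *\<^sub>R s) = t ^ M *\<^sub>R u t"
    using leading_term_ray[OF W] .
  obtain v where v: "(v \<longlongrightarrow> b' * s ^ l) (at_right 0)" "\<forall>\<^sub>F t in at_right 0. Z (t *\<^sub>R s) = t ^ l *\<^sub>R v t"
    using leading_term_ray[OF Z] .
  have W0: "((\<lambda>t. t ^ M *\<^sub>R u t) \<longlongrightarrow> 0 ^ M *\<^sub>R (b * s ^ M)) (at_right 0)"
    by (intro tendsto_intros u)
  have Z0: "((\<lambda>t. t ^ l *\<^sub>R v t) \<longlongrightarrow> 0 ^ l *\<^sub>R (b' * s ^ l)) (at_right 0)"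
    by (intro tendsto_intros v)
  have Z0': "((\<lambda>t. t ^ l *\<^sub>R v t) \<longlongrightarrow> 0) (at_right 0)" using Z0 M by (simp add: zero_power)
  have "((\<lambda>t. (Im (t ^ M *\<^sub>R u t), t ^ l *\<^sub>R v t)) \<longlongrightarrow> (Im (0 ^ M *\<^sub>R (b * s ^ M)), 0)) (at_right 0)"
    by (intro tendsto_Pair tendsto_Im W0 Z0')
  then have WZ: "((\<lambda>t. (Im (t ^ M *\<^sub>R u t), t ^ l *\<^sub>R v t)) \<longlongrightarrow> 0) (at_right 0)"
    using M by (simp add: zero_power zero_prod_def)
  define E where "E = (\<lambda>z. T z - Re (hform e m z))"
  obtain C where C: "\<forall>\<^sub>F z in nhds 0. norm (E z) \<le> C * norm z ^ Suc m"
    using T unfolding vanishes_to_order_def E_def by blast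
  have E: "((\<lambda>t. E (t ^ l *\<^sub>R v t) / t ^ M) \<longlongrightarrow> 0) (at_right 0)"
  proof (rule Lim_null_comparison)
    have lt: "M < l * Suc m" using M by (simp add: mult.commute)
    show "\<forall>\<^sub>F t in at_right 0. norm (E (t ^ l *\<^sub>R v t) / t ^ M) \<le> C * norm (v t) ^ Suc m * t ^ (l * Suc m - M)"
      using eventually_compose_filterlim[OF C Z0'] pos
    proof eventually_elim
      case (elim t)
      have "t ^ (l * Suc m) = t ^ (l * Suc m - M) * t ^ M"
        using lt by (simp only: power_add[symmetric]) simp
      moreover have "norm (t ^ l *\<^sub>R v t) ^ Suc m = t ^ (l * Suc m) * norm (v t) ^ Suc m"
        using elim by (simp only: norm_scaleR power_mult_distrib abs_of_pos zero_less_power power_mult)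
      ultimately have "norm (E (t ^ l *\<^sub>R v t)) \<le> C * norm (v t) ^ Suc m * t ^ (l * Suc m - M) * t ^ M"
        using elim by (simp only: mult_ac)
      moreover have "norm (E (t ^ l *\<^sub>R v t) / t ^ M) = norm (E (t ^ l *\<^sub>R v t)) / t ^ M" "t ^ M > 0"
        using elim(2) by (simp_all del: norm_scaleR)
      ultimately show ?case by (simp only: pos_divide_le_eq)
    qed
    have "((\<lambda>t. C * norm (v t) ^ Suc m * t ^ (l * Suc m - M)) \<longlongrightarrow>
        C * norm (b' * s ^ l) ^ Suc m * 0 ^ (l * Suc m - M)) (at_right 0)"
      by (intro tendsto_intros v)
    then show "((\<lambda>t. C * norm (v t) ^ Suc m * t ^ (l * Suc m - M)) \<longlongrightarrow> 0) (at_right 0)"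
      using lt by (simp only: zero_power zero_less_diff mult_zero_right)
  qed
  have hf: "((\<lambda>t. Re (hform e m (v t))) \<longlongrightarrow> Re (hform e m (b' * s ^ l))) (at_right 0)"
    unfolding hform_def by (intro tendsto_intros v)
  have "((\<lambda>t. Re (c * u t) - (t ^ (m * l - M) * Re (hform e m (v t)) + E (t ^ l *\<^sub>R v t) / t ^ M)
      - Im (u t) * N (Im (t ^ M *\<^sub>R u t), t ^ l *\<^sub>R v t)) \<longlongrightarrow>
    Re (c * (b * s ^ M)) - (0 ^ (m * l - M) * Re (hform e m (b' * s ^ l)) + 0) - Im (b * s ^ M) * 0) (at_right 0)"
    by (intro tendsto_intros u v hf E filterlim_compose[OF N WZ])
  also have "Re (c * (b * s ^ M)) - (0 ^ (m * l - M) * Re (hform e m (b' * s ^ l)) + 0) - Im (b * s ^ M) * 0 =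
    Re (c * b * s ^ M) - (if M = m * l then Re (hform e m (b' * s ^ l)) else 0)"
    using M by (auto simp: zero_power mult.assoc)
  finally show ?thesis
  proof (rule Lim_transform_eventually)
    show "\<forall>\<^sub>F t in at_right 0. Re (c * u t) - (t ^ (m * l - M) * Re (hform e m (v t)) + E (t ^ l *\<^sub>R v t) / t ^ M)
        - Im (u t) * N (Im (t ^ M *\<^sub>R u t), t ^ l *\<^sub>R v t) = G (t *\<^sub>R s) / t ^ M"
      using eventually_compose_filterlim[OF G ts] u(2) v(2) pos
    proof eventually_elim
      case (elim t)
      have "(t ^ l) ^ m = t ^ (m * l - M) * t ^ M"
        using M by (simp only: power_add[symmetric] power_mult[symmetric]) (simp add: mult.commute)
      then have TE: "T (t ^ l *\<^sub>R v t) = t ^ M * (t ^ (m * l - M) * Re (hform e m (v t))) + E (t ^ l *\<^sub>R v t)"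
        by (simp add: E_def hform_scaleR)
      have "c * t ^ M *\<^sub>R u t = t ^ M *\<^sub>R (c * u t)" by simp
      then have "Re (c * t ^ M *\<^sub>R u t) = t ^ M * Re (c * u t)" by simp
      moreover have "t ^ M \<noteq> 0" "t \<noteq> 0" using elim(4) by simp_all
      ultimately show ?case
        unfolding elim(1) elim(2) elim(3) TE by (simp add: diff_divide_distrib add_divide_distrib)
    qed
  qed
qed

text \<open>If the lowest homogeneous part of \<open>T\<close> has degree \<open>m\<close> and no harmonic terms, then the order of
  the defining function along a disc exceeds that of the disc at most by the factor \<open>m\<close>. If
  the real part of \<open>c W\<close> has lower order than \<open>T \<circ> Z\<close>, then it determines the order; otherwise
  the leading part of \<open>T \<circ> Z\<close> survives since it cannot be cancelled by a harmonic function.\<close>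

lemma disc_order_bound:
  fixes T :: "complex \<Rightarrow> real" and N :: "real \<times> complex \<Rightarrow> real"
  assumes W: "W holomorphic_on ball 0 1" "W 0 = 0" and Z: "Z holomorphic_on ball 0 1" "Z 0 = 0"
    and nc: "\<not> (W constant_on ball 0 1 \<and> Z constant_on ball 0 1)" and c: "c \<noteq> 0"
    and T: "vanishes_to_order (Suc m) (\<lambda>z. T z - Re (hform e m z))" and m: "m > 0"
    and e: "e 0 = 0" "e m = 0" "i \<le> m" "e i \<noteq> 0" "\<And>z. hform e m z \<in> \<real>"
    and N: "(N \<longlongrightarrow> 0) (nhds 0)"
    and G: "\<forall>\<^sub>F s in nhds 0. G s = Re (c * W s) - T (Z s) - Im (W s) * N (Im (W s), Z s)"
  obtains n where "n > 0" "vanishes_to_order n W" "vanishes_to_order n Z" "\<not> vanishes_to_order (Suc (m * n)) G"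
proof -
  have dichotomy:
    "(\<exists>l1 l2 b1 b2. l1 > 0 \<and> l2 > 0 \<and> b1 \<noteq> 0 \<and> leading_term W l1 b1 \<and> leading_term Z l2 b2 \<and> l1 < m * l2) \<or>
     (\<exists>l b1 b2. l > 0 \<and> b2 \<noteq> 0 \<and> leading_term W (m * l) b1 \<and> leading_term Z l b2)"
    (is "?A \<or> ?B")
    using leading_term_holomorphic[OF W]
  proof (elim disjE conjE exE)
    assume 0: "\<forall>l. leading_term W l 0" "W constant_on ball 0 1"
    then obtain l b where "l > 0" "b \<noteq> 0" "leading_term Z l b"
      using leading_term_holomorphic[OF Z] nc by blast
    then show ?thesis using 0 by blast
  next
    fix l1 b1 assume 1: "l1 > 0" "b1 \<noteq> 0" "leading_term W l1 b1"
    show ?thesis using leading_term_holomorphic[OF Z]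
    proof (elim disjE conjE exE)
      assume "\<forall>l. leading_term Z l 0"
      moreover have "l1 < m * Suc l1" using m by (cases m) auto
      ultimately show ?thesis using 1 by blast
    next
      fix l2 b2 assume 2: "l2 > 0" "b2 \<noteq> 0" "leading_term Z l2 b2"
      show ?thesis
      proof (cases "l1 < m * l2")
        case True
        then show ?thesis using 1 2 by blast
      next
        case False
        then have "leading_term W (m * l2) b1 \<or> leading_term W (m * l2) 0"
          using 1(3) leading_term_lower[OF 1(3), of "m * l2"] by (cases "l1 = m * l2") auto
        then show ?thesis using 2 by blast
      qed
    qed
  qed
  then show thesis
  proof
    assume ?A
    then obtain l1 l2 b1 b2 where l: "l1 > 0" "l2 > 0" "b1 \<noteq> 0" "leading_term W l1 b1" "leading_term Z l2 b2"
      "l1 < m * l2" by blast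
    define n where "n = min l1 l2"
    \<comment> \<open>On this ray the limit is \<open>\<bar>c b1\<bar>\<^sup>2\<close>.\<close>
    obtain s where s: "cnj (c * b1) = s ^ l1" using exists_complex_root[of l1 "cnj (c * b1)"] l(1) by auto
    have "\<not> vanishes_to_order (Suc l1) G"
    proof
      assume "vanishes_to_order (Suc l1) G"
      from vanishes_to_order_ray[OF this, of s]
      have "Re (c * b1 * s ^ l1) = 0"
        using ray_limit[OF l(4,5,1,2) _ T N G, of s] l(6) tendsto_unique[OF trivial_limit_at_right_real]
        by fastforce
      moreover have "c * b1 * s ^ l1 = of_real ((norm (c * b1))\<^sup>2)"
        unfolding s[symmetric] complex_norm_square ..
      ultimately show False using l(3) c by simp
    qed
    moreover have "l1 \<le> m * n" using l m by (auto simp: n_def min_def)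
    ultimately have "\<not> vanishes_to_order (Suc (m * n)) G"
      using vanishes_to_order_mono by (meson Suc_le_mono)
    then show thesis
      using that[of n] l vanishes_to_order_mono leading_term_vanishes
      by (metis min.cobounded1 min.cobounded2 min_less_iff_conj n_def)
  next
    assume ?B
    then obtain l b1 b2 where l: "l > 0" "b2 \<noteq> 0" "leading_term W (m * l) b1" "leading_term Z l b2" by blast
    have "\<not> vanishes_to_order (Suc (m * l)) G"
    proof
      assume v: "vanishes_to_order (Suc (m * l)) G"
      have "of_real (Re (- (c * b1 / b2 ^ m) * z ^ m)) + hform e m z = 0" for z
      proof -
        obtain s where s: "z / b2 = s ^ l" using exists_complex_root[of l "z / b2"] l(1) by auto
        have "Re (c * b1 * s ^ (m * l)) - Re (hform e m (b2 * s ^ l)) = 0"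
          using ray_limit[OF l(3,4) _ l(1) _ T N G, of s] m l(1) vanishes_to_order_ray[OF v, of s]
            tendsto_unique[OF trivial_limit_at_right_real] by fastforce
        moreover have "b2 * s ^ l = z" using l(2) by (simp add: s[symmetric])
        moreover have "s ^ (m * l) = z ^ m / b2 ^ m"
          by (simp only: mult.commute[of m] power_mult s[symmetric] power_divide)
        ultimately have "Re (- (c * b1 / b2 ^ m) * z ^ m) + Re (hform e m z) = 0" by simp
        then have "complex_of_real (Re (- (c * b1 / b2 ^ m) * z ^ m)) + of_real (Re (hform e m z)) = 0"
          unfolding of_real_add[symmetric] by simp
        then show ?thesis using e(5)[of z] by simp
      qed
      from Re_monomial_add_hform_eq_0[OF this m e(1,2,3)] show False using e(4) by simp
    qed
    moreover have "l \<le> m * l" using m by simp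
    ultimately show thesis
      using that[of l] l vanishes_to_order_mono leading_term_vanishes by metis
  qed
qed

section \<open>The type in normal coordinates\<close>

text \<open>A defining function and \<open>Re w - \<phi> (Im w, z)\<close> both vanish on the graph of \<open>\<phi>\<close>, and their derivatives
  in the transversal direction \<open>(1, 0)\<close> are nonzero. By the mean value inequality in this
  direction each is bounded by a multiple of the other.\<close>

lemma defining_function_comparable:
  fixes \<rho> :: "complex2 \<Rightarrow> real" and \<phi> :: "real \<times> complex \<Rightarrow> real"
  assumes V: "open V" "q \<in> V" and \<rho>: "smooth_on V \<rho>" and nz: "frechet_derivative \<rho> (at q) \<noteq> (\<lambda>_. 0)"
    and D: "open D" "(Im (fst q), snd q) \<in> D" and \<phi>: "smooth_on D \<phi>" "\<phi> (Im (fst q), snd q) = Re (fst q)"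
    and zero: "\<forall>\<^sub>F v in nhds (Im (fst q), snd q). \<rho> (Complex (\<phi> v) (fst v), snd v) = 0"
  obtains A where "\<forall>\<^sub>F x in nhds q. \<bar>\<rho> x\<bar> \<le> A * \<bar>Re (fst x) - \<phi> (Im (fst x), snd x)\<bar>"
    "\<forall>\<^sub>F x in nhds q. \<bar>Re (fst x) - \<phi> (Im (fst x), snd x)\<bar> \<le> A * \<bar>\<rho> x\<bar>"
proof -
  define y where "y = (Im (fst q), snd q)"
  define \<gamma> where "\<gamma> = (\<lambda>v. (Complex (\<phi> v) (fst v), snd v :: complex))"
  let ?e = "(1, 0) :: complex2"
  define \<kappa> where "\<kappa> = dir_deriv ?e \<rho> q"
  have \<gamma>q: "\<gamma> y = q" using \<phi>(2) by (cases q) (simp add: \<gamma>_def y_def)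
  have D\<rho>: "(\<rho> has_derivative (\<lambda>v. dir_deriv v \<rho> x)) (at x)" if "x \<in> V" for x
    by (rule smooth_on_has_derivative[OF \<rho> that])
  note L = has_derivative_linear[OF D\<rho>[OF V(2)]]
  have D\<gamma>: "(\<gamma> has_derivative (\<lambda>d. (Complex (dir_deriv d \<phi> y) (fst d), snd d))) (at y)"
    unfolding \<gamma>_def Complex_eq
    using smooth_on_has_derivative[OF \<phi>(1) D(2)]
    by (auto intro!: derivative_eq_intros simp: y_def)
  have tangent: "dir_deriv (Complex (dir_deriv d \<phi> y) (fst d), snd d) \<rho> q = 0" for d
  proof -
    obtain S where S: "open S" "y \<in> S" "\<And>v. v \<in> S \<Longrightarrow> \<rho> (\<gamma> v) = 0"
      using zero unfolding eventually_nhds y_def \<gamma>_def by blast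
    have "((\<lambda>v. \<rho> (\<gamma> v)) has_derivative (\<lambda>d. dir_deriv (Complex (dir_deriv d \<phi> y) (fst d), snd d) \<rho> q)) (at y)"
      by (rule has_derivative_compose[OF D\<gamma>]) (use D\<rho>[OF V(2)] \<gamma>q in simp)
    moreover have "((\<lambda>v. \<rho> (\<gamma> v)) has_derivative (\<lambda>_. 0)) (at y)"
      using has_derivative_cong_open[OF S(1,2), of "\<lambda>v. \<rho> (\<gamma> v)" "\<lambda>_. 0"] S(3) by simp
    ultimately show ?thesis using has_derivative_unique by (metis (no_types, lifting))
  qed
  \<comment> \<open>\<open>(1, 0)\<close> and the tangent vectors of the graph span the space.\<close>
  have "\<kappa> \<noteq> 0"
  proof
    assume \<kappa>: "\<kappa> = 0"
    have "dir_deriv x \<rho> q = 0" for x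
    proof -
      define d where "d = (Im (fst x), snd x)"
      have "x = (Complex (dir_deriv d \<phi> y) (fst d), snd d) + (Re (fst x) - dir_deriv d \<phi> y) *\<^sub>R ?e"
        by (cases x) (simp add: d_def complex_eq_iff)
      then have "dir_deriv x \<rho> q = dir_deriv (Complex (dir_deriv d \<phi> y) (fst d), snd d) \<rho> q
          + (Re (fst x) - dir_deriv d \<phi> y) *\<^sub>R \<kappa>"
        unfolding \<kappa>_def linear_scale[OF L, symmetric] linear_add[OF L, symmetric] by simp
      then show ?thesis using \<kappa> tangent by simp
    qed
    then show False using nz unfolding dir_deriv_def by blast
  qed
  have "isCont (dir_deriv ?e \<rho>) q"
    using smooth_on_continuous_on[OF smooth_on_dir_deriv[OF \<rho>]] V continuous_on_eq_continuous_at by blast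
  then have "((\<lambda>x. \<bar>dir_deriv ?e \<rho> x - \<kappa>\<bar>) \<longlongrightarrow> \<bar>\<kappa> - \<kappa>\<bar>) (nhds q)"
    unfolding isCont_def tendsto_at_iff_tendsto_nhds by (intro tendsto_intros) (simp add: \<kappa>_def)
  then have "\<forall>\<^sub>F x in nhds q. \<bar>dir_deriv ?e \<rho> x - \<kappa>\<bar> < \<bar>\<kappa>\<bar> / 2"
    by (rule order_tendstoD) (use \<open>\<kappa> \<noteq> 0\<close> in simp)
  then have "\<forall>\<^sub>F x in nhds q. x \<in> V \<and> \<bar>dir_deriv ?e \<rho> x - \<kappa>\<bar> < \<bar>\<kappa>\<bar> / 2"
    by (intro eventually_conj eventually_nhds_in_open V)
  then obtain d where d: "d > 0" "\<And>x. x \<in> ball q d \<Longrightarrow> x \<in> V \<and> \<bar>dir_deriv ?e \<rho> x - \<kappa>\<bar> < \<bar>\<kappa>\<bar> / 2"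
    unfolding eventually_nhds_metric by (auto simp: dist_commute)
  define Y where "Y = (\<lambda>x::complex2. (Im (fst x), snd x))"
  have Y: "(Y \<longlongrightarrow> y) (nhds q)"
    unfolding Y_def y_def by (intro tendsto_intros) (simp_all add: filterlim_ident)
  have "isCont \<gamma> y" using has_derivative_continuous[OF D\<gamma>] .
  then have "(\<gamma> \<longlongrightarrow> \<gamma> y) (nhds y)" by (simp add: isCont_def tendsto_at_iff_tendsto_nhds)
  then have "(\<gamma> \<longlongrightarrow> q) (nhds y)" unfolding \<gamma>q .
  then have "\<forall>\<^sub>F v in nhds y. \<gamma> v \<in> ball q d"
    by (rule topological_tendstoD) (use d(1) in auto)
  then have "\<forall>\<^sub>F v in nhds y. \<gamma> v \<in> ball q d \<and> \<rho> (\<gamma> v) = 0"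
    using zero unfolding y_def \<gamma>_def by (rule eventually_conj)
  from eventually_compose_filterlim[OF this Y]
  have ev: "\<forall>\<^sub>F x in nhds q. x \<in> ball q d \<and> \<gamma> (Y x) \<in> ball q d \<and> \<rho> (\<gamma> (Y x)) = 0"
    using d(1) by (intro eventually_conj[OF eventually_nhds_in_open[of "ball q d"]]) auto
  have main: "\<bar>\<rho> x - \<kappa> * r\<bar> \<le> \<bar>\<kappa>\<bar> / 2 * \<bar>r\<bar>"
    if x: "x \<in> ball q d" "\<gamma> (Y x) \<in> ball q d" "\<rho> (\<gamma> (Y x)) = 0" and r: "r = Re (fst x) - \<phi> (Y x)" for x r
  proof -
    define g where "g = (\<lambda>s. \<rho> (\<gamma> (Y x) + (s * r) *\<^sub>R ?e) - \<kappa> * r * s)"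
    have xr: "x = \<gamma> (Y x) + r *\<^sub>R ?e"
      by (cases x) (simp add: \<gamma>_def r Y_def complex_eq_iff)
    have pt: "\<gamma> (Y x) + (s * r) *\<^sub>R ?e \<in> ball q d" if "s \<in> {0..1}" for s
    proof -
      have "(1 - s) *\<^sub>R \<gamma> (Y x) + s *\<^sub>R x \<in> ball q d"
        using convex_ball[of q d] x that unfolding convex_alt by auto
      also have "(1 - s) *\<^sub>R \<gamma> (Y x) + s *\<^sub>R x = \<gamma> (Y x) + (s * r) *\<^sub>R ?e"
        by (subst (2) xr) (simp only: scaleR_add_right scaleR_scaleR scaleR_left_diff_distrib, simp)
      finally show ?thesis .
    qed
    have D: "(g has_derivative (\<lambda>h. h *\<^sub>R (r * (dir_deriv ?e \<rho> (\<gamma> (Y x) + (s * r) *\<^sub>R ?e) - \<kappa>)))) (at s within {0..1})"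
      if "s \<in> {0..1}" for s
    proof -
      note F = D\<rho>[OF conjunct1[OF d(2)[OF pt[OF that]]]]
      have "((\<lambda>s. \<gamma> (Y x) + (s * r) *\<^sub>R ?e) has_derivative (\<lambda>h. (h * r) *\<^sub>R ?e)) (at s within {0..1})"
        by (auto intro!: derivative_eq_intros)
      from has_derivative_compose[OF this F, unfolded linear_scale[OF has_derivative_linear[OF F]]]
      have "((\<lambda>s. \<rho> (\<gamma> (Y x) + (s * r) *\<^sub>R ?e)) has_derivative
          (\<lambda>h. (h * r) *\<^sub>R dir_deriv ?e \<rho> (\<gamma> (Y x) + (s * r) *\<^sub>R ?e))) (at s within {0..1})" .
      then show ?thesis unfolding g_def
        by (auto intro!: derivative_eq_intros simp: algebra_simps)
    qed
    have "norm (g 1 - g 0) \<le> (\<bar>\<kappa>\<bar> / 2 * \<bar>r\<bar>) * norm (1 - 0 :: real)"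
    proof (rule differentiable_bound[OF _ D])
      fix s :: real assume "s \<in> {0..1}"
      then have "\<bar>dir_deriv ?e \<rho> (\<gamma> (Y x) + (s * r) *\<^sub>R ?e) - \<kappa>\<bar> \<le> \<bar>\<kappa>\<bar> / 2"
        using d(2)[OF pt] by (simp add: less_imp_le)
      then have "\<bar>r * (dir_deriv ?e \<rho> (\<gamma> (Y x) + (s * r) *\<^sub>R ?e) - \<kappa>)\<bar> \<le> \<bar>\<kappa>\<bar> / 2 * \<bar>r\<bar>"
        unfolding abs_mult mult.commute[of "\<bar>r\<bar>"] by (rule mult_right_mono) simp
      then show "onorm (\<lambda>h. h *\<^sub>R (r * (dir_deriv ?e \<rho> (\<gamma> (Y x) + (s * r) *\<^sub>R ?e) - \<kappa>))) \<le> \<bar>\<kappa>\<bar> / 2 * \<bar>r\<bar>"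
        by (intro onorm_scaleR_left_le) simp
    qed auto
    moreover have "g 1 = \<rho> x - \<kappa> * r"
      by (simp only: g_def mult_1 mult_1_right xr[symmetric])
    moreover have "g 0 = 0"
      using x(3) by (simp add: g_def zero_prod_def[symmetric])
    ultimately show ?thesis by simp
  qed
  define A where "A = 2 * \<bar>\<kappa>\<bar> + 2 / \<bar>\<kappa>\<bar>"
  have bnd: "\<bar>\<rho> x\<bar> \<le> A * \<bar>r\<bar> \<and> \<bar>r\<bar> \<le> A * \<bar>\<rho> x\<bar>"
    if x: "x \<in> ball q d" "\<gamma> (Y x) \<in> ball q d" "\<rho> (\<gamma> (Y x)) = 0" and r: "r = Re (fst x) - \<phi> (Y x)" for x r
  proof
    have m: "\<bar>\<rho> x\<bar> \<le> 3 / 2 * (\<bar>\<kappa>\<bar> * \<bar>r\<bar>)" "\<bar>\<kappa>\<bar> * \<bar>r\<bar> \<le> 2 * \<bar>\<rho> x\<bar>"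
      using main[OF that] abs_mult[of \<kappa> r] by linarith+
    have "3 / 2 * (\<bar>\<kappa>\<bar> * \<bar>r\<bar>) = (3 / 2 * \<bar>\<kappa>\<bar>) * \<bar>r\<bar>" by simp
    also have "\<dots> \<le> A * \<bar>r\<bar>" by (intro mult_right_mono) (auto simp: A_def)
    finally show "\<bar>\<rho> x\<bar> \<le> A * \<bar>r\<bar>" using m by linarith
    have "\<bar>r\<bar> \<le> (2 / \<bar>\<kappa>\<bar>) * \<bar>\<rho> x\<bar>"
      using m(2) \<open>\<kappa> \<noteq> 0\<close> by (simp add: field_simps)
    also have "\<dots> \<le> A * \<bar>\<rho> x\<bar>" by (intro mult_right_mono) (auto simp: A_def)
    finally show "\<bar>r\<bar> \<le> A * \<bar>\<rho> x\<bar>" .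
  qed
  have "\<forall>\<^sub>F x in nhds q. \<bar>\<rho> x\<bar> \<le> A * \<bar>Re (fst x) - \<phi> (Y x)\<bar> \<and> \<bar>Re (fst x) - \<phi> (Y x)\<bar> \<le> A * \<bar>\<rho> x\<bar>"
    using ev by (rule eventually_mono) (use bnd in blast)
  then show thesis using that[of A] unfolding Y_def eventually_conj_iff by blast
qed

lemma vanishes_to_order_lowest_part:
  fixes T :: "complex \<Rightarrow> real"
  assumes T: "vanishes_to_order (Suc r) (\<lambda>z. T z - Re (\<Sum>k\<le>r. hform (c k) k z))"
    and 0: "\<And>k i. k < m \<Longrightarrow> i \<le> k \<Longrightarrow> c k i = 0" and m: "m \<le> r"
  shows "vanishes_to_order (Suc m) (\<lambda>z. T z - Re (hform (c m) m z))"
proof -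
  have "vanishes_to_order (Suc m) (\<lambda>z. \<Sum>k\<in>{m<..r}. hform (c k) k z)"
    by (rule vanishes_to_order_sum) (auto intro: vanishes_to_order_mono[OF vanishes_to_order_hform])
  then have "vanishes_to_order (Suc m) (\<lambda>z. Re (\<Sum>k\<in>{m<..r}. hform (c k) k z))"
    by (rule vanishes_to_order_comparable[where A=1]) (use abs_Re_le_cmod in \<open>simp add: del: Re_sum\<close>)
  moreover have "vanishes_to_order (Suc m) (\<lambda>z. T z - Re (\<Sum>k\<le>r. hform (c k) k z))"
    by (rule vanishes_to_order_mono[OF T]) (use m in simp)
  ultimately have "vanishes_to_order (Suc m) (\<lambda>z. T z - Re (\<Sum>k\<le>r. hform (c k) k z) + Re (\<Sum>k\<in>{m<..r}. hform (c k) k z))"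
    by (rule vanishes_to_order_add[rotated])
  moreover have "(\<Sum>k\<le>r. hform (c k) k z) = hform (c m) m z + (\<Sum>k\<in>{m<..r}. hform (c k) k z)" for z
  proof -
    have "{..r} = {..<m} \<union> insert m {m<..r}" using m by auto
    then have "(\<Sum>k\<le>r. hform (c k) k z) = (\<Sum>k<m. hform (c k) k z) + (\<Sum>k\<in>insert m {m<..r}. hform (c k) k z)"
      by (simp only:) (rule sum.union_disjoint, auto)
    moreover have "hform (c k) k z = 0" if "k < m" for k
      unfolding hform_def by (rule sum.neutral) (use 0 that in auto)
    ultimately show ?thesis by simp
  qed
  ultimately show ?thesis by (simp add: algebra_simps del: Re_sum)
qed

lemma analytic_disc_smooth:
  assumes "analytic_disc h q"
  shows "smooth_on (ball 0 1) h"
proof -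
  have "smooth_on (ball 0 1) (\<lambda>s. (fst (h s), snd (h s)))"
    using assms unfolding analytic_disc_def by (intro smooth_on_Pair smooth_on_holomorphic open_ball) auto
  then show ?thesis by simp
qed

lemma analytic_disc_tendsto:
  assumes "analytic_disc h q"
  shows "(h \<longlongrightarrow> q) (nhds 0)"
proof -
  have "(0::complex) \<in> ball 0 1" by simp
  then have "isCont h 0"
    using smooth_on_continuous_on[OF analytic_disc_smooth[OF assms]]
      continuous_on_eq_continuous_at[OF open_ball, of 0 1 h] by blast
  then have "(h \<longlongrightarrow> h 0) (nhds 0)" unfolding isCont_def tendsto_at_iff_tendsto_nhds .
  then show ?thesis using assms by (simp add: analytic_disc_def)
qed

lemma vanishing_order_along_disc:
  fixes \<rho> :: "complex2 \<Rightarrow> real"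
  assumes V: "open V" "q \<in> V" and \<rho>: "smooth_on V \<rho>" and h: "analytic_disc h q"
  shows "enat n \<le> vanishing_order (\<rho> \<circ> h) \<longleftrightarrow> vanishes_to_order n (\<lambda>s. \<rho> (h s))"
proof -
  note sm = analytic_disc_smooth[OF h]
  define S where "S = ball 0 1 \<inter> h -` V"
  have S: "open S"
    unfolding S_def by (rule continuous_open_preimage[OF smooth_on_continuous_on[OF sm] open_ball V(1)])
  have "0 \<in> S" using h V(2) by (simp add: S_def analytic_disc_def)
  moreover have "smooth_on S (\<lambda>s. \<rho> (h s))"
    by (rule smooth_on_compose[OF \<rho> smooth_on_subset[OF sm] S]) (auto simp: S_def)
  ultimately show ?thesis
    using enat_le_vanishing_order_iff_vanishes_to_order[OF S] by (simp add: comp_def)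
qed

lemma vanishing_order_disc:
  assumes h: "analytic_disc h q"
  shows "enat n \<le> vanishing_order (\<lambda>s. h s - q) \<longleftrightarrow> vanishes_to_order n (\<lambda>s. h s - q)"
  by (rule enat_le_vanishing_order_iff_vanishes_to_order[of "ball 0 1"])
    (auto intro!: smooth_intros analytic_disc_smooth[OF h])

text \<open>Let \<open>F\<close> be the defining function given by the normal form, in terms of \<open>W = w - fst q + H (z - snd q)\<close>
  and \<open>Z = z - snd q\<close>, and \<open>\<rho>\<close> one comparable to it. The type of \<open>\<rho>\<close> is the degree of the lowest
  homogeneous part of \<open>T\<close>: this is an upper bound by \<open>disc_order_bound\<close>, and attained on the
  disc \<open>W = 0\<close>.\<close>

context
  fixes \<rho> F :: "complex2 \<Rightarrow> real" and q :: complex2 and V :: "complex2 set" and A :: real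
    and H :: "complex \<Rightarrow> complex" and c :: complex and T :: "complex \<Rightarrow> real" and N :: "real \<times> complex \<Rightarrow> real"
  assumes V: "open V" "q \<in> V" and \<rho>: "smooth_on V \<rho>"
    and comparable: "\<forall>\<^sub>F x in nhds q. \<bar>\<rho> x\<bar> \<le> A * \<bar>F x\<bar>" "\<forall>\<^sub>F x in nhds q. \<bar>F x\<bar> \<le> A * \<bar>\<rho> x\<bar>"
    and H: "H holomorphic_on UNIV" "H 0 = 0" and c: "c \<noteq> 0" and N: "(N \<longlongrightarrow> 0) (nhds 0)"
    and F: "\<forall>\<^sub>F x in nhds q. F x = Re (c * (fst x - fst q + H (snd x - snd q))) - T (snd x - snd q)
      - Im (fst x - fst q + H (snd x - snd q)) * N (Im (fst x - fst q + H (snd x - snd q)), snd x - snd q)"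
begin

lemma dangelo_type_le:
  assumes T: "vanishes_to_order (Suc m) (\<lambda>z. T z - Re (hform e m z))" and m: "m > 0"
    and e: "e 0 = 0" "e m = 0" "i \<le> m" "e i \<noteq> 0" "\<And>z. hform e m z \<in> \<real>"
  shows "dangelo_type \<rho> q \<le> ereal (real m)"
  unfolding dangelo_type_def
proof (rule SUP_least)
  fix h assume "h \<in> {h. analytic_disc h q}"
  then have h: "analytic_disc h q" by simp
  then have hol: "(\<lambda>s. fst (h s)) holomorphic_on ball 0 1" "(\<lambda>s. snd (h s)) holomorphic_on ball 0 1"
    and h0: "h 0 = q" and nc: "\<not> h constant_on ball 0 1"
    unfolding analytic_disc_def by auto
  define Z where "Z = (\<lambda>s. snd (h s) - snd q)"
  define W where "W = (\<lambda>s. fst (h s) - fst q + H (Z s))"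
  have Z: "Z holomorphic_on ball 0 1" "Z 0 = 0"
    unfolding Z_def using h0 by (auto intro!: holomorphic_intros hol)
  have HZ: "(\<lambda>s. H (Z s)) holomorphic_on ball 0 1"
    using holomorphic_on_compose_gen[OF Z(1) H(1)] by (simp add: comp_def)
  have W: "W holomorphic_on ball 0 1" "W 0 = 0"
    unfolding W_def using h0 Z(2) H(2) by (auto intro!: holomorphic_intros hol HZ)
  have nc': "\<not> (W constant_on ball 0 1 \<and> Z constant_on ball 0 1)"
  proof
    assume "W constant_on ball 0 1 \<and> Z constant_on ball 0 1"
    then obtain a b where ab: "\<And>s. s \<in> ball 0 1 \<Longrightarrow> W s = a" "\<And>s. s \<in> ball 0 1 \<Longrightarrow> Z s = b"
      unfolding constant_on_def by blast
    have "h s = (a + fst q - H b, b + snd q)" if "s \<in> ball 0 1" for s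
      using ab[OF that] by (auto simp: W_def Z_def prod_eq_iff)
    then show False using nc unfolding constant_on_def by blast
  qed
  have FWZ: "\<forall>\<^sub>F s in nhds 0. F (h s) = Re (c * W s) - T (Z s) - Im (W s) * N (Im (W s), Z s)"
    using eventually_compose_filterlim[OF F analytic_disc_tendsto[OF h]] unfolding W_def Z_def .
  obtain n where n: "n > 0" "vanishes_to_order n W" "vanishes_to_order n Z"
    "\<not> vanishes_to_order (Suc (m * n)) (\<lambda>s. F (h s))"
    by (rule disc_order_bound[OF W Z nc' c T m e N FWZ])
  have "\<not> vanishes_to_order (Suc (m * n)) (\<lambda>s. \<rho> (h s))"
    using n(4) vanishes_to_order_comparable[of _ "\<lambda>s. \<rho> (h s)" "\<lambda>s. F (h s)" A]
      eventually_compose_filterlim[OF comparable(2) analytic_disc_tendsto[OF h]] by auto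
  then have "\<not> enat (Suc (m * n)) \<le> vanishing_order (\<rho> \<circ> h)"
    using vanishing_order_along_disc[OF V \<rho> h] by blast
  then obtain a where a: "vanishing_order (\<rho> \<circ> h) = enat a" "a \<le> m * n"
    by (cases "vanishing_order (\<rho> \<circ> h)") auto
  have "vanishes_to_order n (\<lambda>s. h s - q)"
  proof -
    have "vanishes_to_order 1 H"
      using H by (intro vanishes_to_order_1[OF open_UNIV] smooth_on_holomorphic) auto
    then obtain B where B: "\<forall>\<^sub>F z in nhds 0. norm (H z) \<le> B * norm z ^ 1"
      unfolding vanishes_to_order_def by blast
    have "isCont Z 0"
      using holomorphic_on_imp_continuous_on[OF Z(1)] continuous_on_eq_continuous_at[OF open_ball, of 0 1 Z]
      by (metis centre_in_ball zero_less_one)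
    then have "(Z \<longlongrightarrow> Z 0) (nhds 0)"
      unfolding isCont_def tendsto_at_iff_tendsto_nhds .
    then have "(Z \<longlongrightarrow> 0) (nhds 0)" unfolding Z(2) .
    from eventually_compose_filterlim[OF B this]
    have "vanishes_to_order n (\<lambda>s. H (Z s))"
      by (intro vanishes_to_order_comparable[OF n(3)]) simp
    then have HZ: "vanishes_to_order n (\<lambda>s. - H (Z s))"
      by (rule vanishes_to_order_comparable[where A=1]) simp
    have 1: "vanishes_to_order n (\<lambda>s. (W s + - H (Z s), 0 :: complex))"
      by (rule vanishes_to_order_comparable[OF vanishes_to_order_add[OF n(2) HZ], where A=1]) simp
    have 2: "vanishes_to_order n (\<lambda>s. (0 :: complex, Z s))"
      by (rule vanishes_to_order_comparable[OF n(3), where A=1]) simp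
    have "(\<lambda>s. (W s + - H (Z s), 0) + (0, Z s)) = (\<lambda>s. h s - q)"
      by (rule ext) (simp add: W_def Z_def prod_eq_iff)
    with vanishes_to_order_add[OF 1 2] show ?thesis by simp
  qed
  then have "enat n \<le> vanishing_order (\<lambda>s. h s - q)" using vanishing_order_disc[OF h] by blast
  then show "ereal_of_enat (vanishing_order (\<rho> \<circ> h)) / ereal_of_enat (vanishing_order (\<lambda>s. h s - q)) \<le> ereal (real m)"
  proof (cases "vanishing_order (\<lambda>s. h s - q)")
    case (enat b)
    then have "m * n \<le> m * b"
      using \<open>enat n \<le> vanishing_order (\<lambda>s. h s - q)\<close> by (intro mult_le_mono2) simp
    then have "a \<le> m * b" using a(2) by linarith
    then have "real a \<le> real m * real b" by (simp only: of_nat_mult[symmetric] of_nat_le_iff)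
    moreover have "b > 0" using \<open>enat n \<le> vanishing_order (\<lambda>s. h s - q)\<close> enat n(1) by simp
    ultimately show ?thesis by (simp add: a(1) enat divide_le_eq)
  next
    case infinity
    then show ?thesis by (simp add: a(1))
  qed
qed

text \<open>The disc \<open>W = 0\<close> has order one, and the defining function has the order of \<open>T\<close> along it.\<close>

lemma le_dangelo_type:
  assumes T: "vanishes_to_order j T"
  shows "ereal (real j) \<le> dangelo_type \<rho> q"
proof -
  define h where "h = (\<lambda>s. (fst q - H s, snd q + s))"
  have h: "analytic_disc h q"
    unfolding analytic_disc_def
  proof (intro conjI notI)
    show "(\<lambda>s. fst (h s)) holomorphic_on ball 0 1" "(\<lambda>s. snd (h s)) holomorphic_on ball 0 1"
      using holomorphic_on_subset[OF H(1)] by (auto simp: h_def intro!: holomorphic_intros)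
    show "h 0 = q" using H(2) by (simp add: h_def)
    assume "h constant_on ball 0 1"
    then obtain a where "\<And>s. s \<in> ball 0 1 \<Longrightarrow> h s = a" unfolding constant_on_def by blast
    from this[of 0] this[of "1/2"] show False by (auto simp: h_def norm_divide)
  qed
  have "\<forall>\<^sub>F s in nhds 0. F (h s) = - T s"
    using eventually_compose_filterlim[OF F analytic_disc_tendsto[OF h]] by (simp add: h_def)
  then have "\<forall>\<^sub>F s in nhds 0. norm (\<rho> (h s)) \<le> A * norm (T s)"
    using eventually_compose_filterlim[OF comparable(1) analytic_disc_tendsto[OF h]]
    by eventually_elim simp
  from vanishes_to_order_comparable[OF T this]
  have j: "enat j \<le> vanishing_order (\<rho> \<circ> h)" using vanishing_order_along_disc[OF V \<rho> h] by blast
  have "\<not> vanishes_to_order 2 (\<lambda>s. h s - q)"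
  proof
    assume "vanishes_to_order 2 (\<lambda>s. h s - q)"
    then have "vanishes_to_order (Suc 1) (\<lambda>s. Re s)"
      unfolding numeral_2_eq_2 One_nat_def
    proof (rule vanishes_to_order_comparable[where A=1], intro always_eventually allI)
      fix s
      have "norm (Re s) \<le> norm (snd (h s - q))" using abs_Re_le_cmod[of s] by (simp add: h_def)
      also have "\<dots> \<le> norm (h s - q)" by (metis norm_snd_le prod.collapse)
      finally show "norm (Re s) \<le> 1 * norm (h s - q)" by simp
    qed
    from vanishes_to_order_ray[OF this, of 1]
    have "((\<lambda>t. 1) \<longlongrightarrow> (0::real)) (at_right (0::real))"
      by (rule Lim_transform_eventually) (auto simp: eventually_at_filter)
    then show False by (simp add: tendsto_const_iff trivial_limit_at_right_real)
  qed
  moreover have "vanishes_to_order 1 (\<lambda>s. h s - q)"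
    by (rule vanishes_to_order_1[of "ball 0 1"])
      (use h in \<open>auto intro!: smooth_intros analytic_disc_smooth[OF h] simp: analytic_disc_def\<close>)
  ultimately have "vanishing_order (\<lambda>s. h s - q) = enat 1"
    using vanishing_order_disc[OF h, of 1] vanishing_order_disc[OF h, of 2]
    by (cases "vanishing_order (\<lambda>s. h s - q)") auto
  then have "ereal (real j) \<le> ereal_of_enat (vanishing_order (\<rho> \<circ> h)) / ereal_of_enat (vanishing_order (\<lambda>s. h s - q))"
    using j by (cases "vanishing_order (\<rho> \<circ> h)") (auto simp: one_ereal_def[symmetric] one_enat_def[symmetric])
  then show ?thesis unfolding dangelo_type_def by (rule SUP_upper2[rotated, where i=h]) (use h in simp)
qed

text \<open>If all parts of degree at most \<open>r\<close> vanish then the type is at least \<open>r + 1\<close>; otherwise it is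
  at most the degree of the lowest nonvanishing one.\<close>

lemma dangelo_type_eq_imp_homogeneous:
  assumes T: "vanishes_to_order (Suc r) (\<lambda>z. T z - Re (\<Sum>k\<le>r. hform (e k) k z))"
    and e: "\<And>k. k \<le> r \<Longrightarrow> e k 0 = 0 \<and> e k k = 0" "\<And>k z. hform (e k) k z \<in> \<real>"
    and type: "dangelo_type \<rho> q = ereal (real r)"
  shows "(\<forall>k<r. \<forall>i\<le>k. e k i = 0) \<and> (\<exists>i\<le>r. e r i \<noteq> 0)"
proof -
  define P where "P = (\<lambda>m. m \<le> r \<and> (\<exists>i\<le>m. e m i \<noteq> 0))"
  have "\<exists>m. P m"
  proof (rule ccontr)
    assume "\<not> (\<exists>m. P m)"
    then have "hform (e k) k z = 0" if "k \<le> r" for k z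
      unfolding hform_def using that by (intro sum.neutral) (auto simp: P_def)
    then have "vanishes_to_order (Suc r) T" using T by simp
    from le_dangelo_type[OF this] show False using type by simp
  qed
  then have m: "P (LEAST m. P m)" by (rule LeastI_ex)
  define m where "m = (LEAST m. P m)"
  have Pm: "P m" using m unfolding m_def .
  have low: "e k i = 0" if "k < m" "i \<le> k" for k i
  proof -
    have "\<not> P k" using not_less_Least[of k P] that(1) unfolding m_def by simp
    then show ?thesis using that Pm by (auto simp: P_def)
  qed
  obtain i where i: "i \<le> m" "e m i \<noteq> 0" "m \<le> r" using Pm by (auto simp: P_def)
  have "m > 0" using i e(1)[of 0] by (cases m) auto
  have "dangelo_type \<rho> q \<le> ereal (real m)"
    using dangelo_type_le[OF vanishes_to_order_lowest_part[OF T low i(3)] \<open>m > 0\<close> _ _ i(1,2) e(2)] e(1)[OF i(3)]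
    by blast
  then have "m = r" using type i(3) by simp
  then show ?thesis using low i by blast
qed

end

section \<open>Polynomials with given homogeneous parts\<close>

definition zzpoly :: "(nat \<Rightarrow> nat \<Rightarrow> complex) \<Rightarrow> nat \<Rightarrow> complex poly poly" where
  "zzpoly c r = (\<Sum>k\<le>r. \<Sum>i\<le>k. monom (monom (c k i) i) (k - i))"

lemma zzbar_eval_zzpoly: "zzbar_eval (zzpoly c r) z = (\<Sum>k\<le>r. hform (c k) k z)"
  by (simp add: zzbar_eval_def zzpoly_def hform_def poly_sum poly_monom poly_power mult.assoc)

lemma coeff_zzpoly: "coeff (coeff (zzpoly c r) j) i = (if i + j \<le> r then c (i + j) i else 0)"
proof -
  have "coeff (coeff (zzpoly c r) j) i = (\<Sum>k\<le>r. \<Sum>l\<le>k. if l = i \<and> k - l = j then c k l else 0)"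
    unfolding zzpoly_def coeff_sum by (intro sum.cong refl) (auto simp: coeff_monom)
  also have "\<dots> = (\<Sum>k\<le>r. if k = i + j then c k i else 0)"
  proof (rule sum.cong[OF refl])
    fix k
    have "(\<Sum>l\<le>k. if l = i \<and> k - l = j then c k l else 0) = (\<Sum>l\<le>k. if l = i then (if k - i = j then c k i else 0) else 0)"
      by (intro sum.cong refl) auto
    then show "(\<Sum>l\<le>k. if l = i \<and> k - l = j then c k l else 0) = (if k = i + j then c k i else 0)"
      by auto
  qed
  finally show ?thesis by simp
qed

section \<open>The normal form\<close>

text \<open>The implicit function theorem, in the coordinates \<open>(Re w, (Im w, z))\<close>. The derivative of the graph
  function at \<open>p\<close> vanishes as the gradient is a multiple of \<open>(1, 0)\<close>; this will yield \<open>c p = 1\<close>.\<close>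

lemma smooth_boundary_graph:
  assumes normal: "outward_unit_normal \<Omega> p (1, 0)" and p: "p \<in> frontier \<Omega>"
  obtains e d \<phi> where "e > 0" "d > 0" "smooth_on (ball (Im (fst p), snd p) d) \<phi>"
    "\<And>y. y \<in> ball (Im (fst p), snd p) d \<Longrightarrow> \<bar>\<phi> y - Re (fst p)\<bar> < e"
    "\<And>x. \<bar>Re (fst x) - Re (fst p)\<bar> < e \<Longrightarrow> (Im (fst x), snd x) \<in> ball (Im (fst p), snd p) d \<Longrightarrow>
      (x \<in> \<Omega> \<longleftrightarrow> Re (fst x) < \<phi> (Im (fst x), snd x)) \<and>
      (x \<in> frontier \<Omega> \<longleftrightarrow> Re (fst x) = \<phi> (Im (fst x), snd x))"
    "dir_deriv (1, 0) \<phi> (Im (fst p), snd p) = 0"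
proof -
  obtain V \<rho> g where V: "local_defining_function \<Omega> p V \<rho>" and g: "GDERIV \<rho> p :> g" "(1, 0) = sgn g"
    using normal unfolding outward_unit_normal_def by blast
  have V': "open V" "p \<in> V" "smooth_on V \<rho>"
    and sign: "\<And>x. x \<in> V \<Longrightarrow> (x \<in> \<Omega> \<longleftrightarrow> \<rho> x < 0) \<and> (x \<in> frontier \<Omega> \<longleftrightarrow> \<rho> x = 0)"
    using V unfolding local_defining_function_def by auto
  have "g \<noteq> 0"
  proof
    assume "g = 0"
    then have "(1::complex, 0::complex) = 0" using g(2) by (simp add: sgn_zero)
    then show False by (simp add: prod_eq_iff)
  qed
  then have "norm g > 0" "g = norm g *\<^sub>R (1, 0)"
    unfolding g(2) sgn_div_norm by simp_all
  then obtain G where G: "G > 0" "g = G *\<^sub>R (1, 0)" by blast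
  define m where "m = (\<lambda>x. (Complex (fst x) (fst (snd x)), snd (snd x) :: complex))"
  have m: "smooth_on UNIV m"
    unfolding m_def Complex_eq by (intro smooth_intros open_UNIV)
  define y0 where "y0 = (Im (fst p), snd p)"
  have mp: "m (Re (fst p), y0) = p" by (simp add: m_def y0_def)
  define f where "f = (\<lambda>x. \<rho> (m x))"
  have W: "open (m -` V)" using smooth_on_continuous_on[OF m] V'(1) by (rule open_vimage[rotated])
  have f: "smooth_on (m -` V) f"
    unfolding f_def by (rule smooth_on_compose[OF V'(3) smooth_on_subset[OF m] W]) auto
  have df: "dir_deriv v f (Re (fst p), y0) = G * fst v" for v
  proof -
    have "(m has_derivative m) (at (Re (fst p), y0))"
      unfolding m_def Complex_eq by (auto intro!: derivative_eq_intros)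
    moreover have "(\<rho> has_derivative (\<lambda>h. h \<bullet> g)) (at (m (Re (fst p), y0)))"
      using g(1) by (simp add: gderiv_def mp)
    ultimately have "(f has_derivative (\<lambda>v. m v \<bullet> g)) (at (Re (fst p), y0))"
      unfolding f_def by (rule has_derivative_compose)
    from dir_deriv_eq[OF this] show ?thesis by (simp add: G(2) m_def inner_complex_def)
  qed
  have f0: "f (Re (fst p), y0) = 0" using sign[OF V'(2)] p by (simp add: f_def mp)
  have y0W: "(Re (fst p), y0) \<in> m -` V" using V'(2) by (simp add: mp)
  have pos: "dir_deriv (1, 0) f (Re (fst p), y0) > 0" using G(1) by (simp add: df)
  obtain e d \<phi> where *: "e > 0" "d > 0" "smooth_on (ball y0 d) \<phi>"
    "{Re (fst p) - e<..<Re (fst p) + e} \<times> ball y0 d \<subseteq> m -` V"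
    "\<And>y. y \<in> ball y0 d \<Longrightarrow> \<bar>\<phi> y - Re (fst p)\<bar> < e"
    "\<And>u y. \<bar>u - Re (fst p)\<bar> < e \<Longrightarrow> y \<in> ball y0 d \<Longrightarrow> f (u, y) < 0 \<longleftrightarrow> u < \<phi> y"
    "\<And>u y. \<bar>u - Re (fst p)\<bar> < e \<Longrightarrow> y \<in> ball y0 d \<Longrightarrow> f (u, y) = 0 \<longleftrightarrow> u = \<phi> y"
    "\<And>y. y \<in> ball y0 d \<Longrightarrow> (\<phi> has_derivative
      (\<lambda>v. - dir_deriv (0, v) f (\<phi> y, y) * inverse (dir_deriv (1, 0) f (\<phi> y, y)))) (at y)"
    by (rule implicit_graph[OF W y0W f f0 pos], rule that)
  have graph: "(x \<in> \<Omega> \<longleftrightarrow> Re (fst x) < \<phi> (Im (fst x), snd x)) \<and>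
      (x \<in> frontier \<Omega> \<longleftrightarrow> Re (fst x) = \<phi> (Im (fst x), snd x))"
    if "\<bar>Re (fst x) - Re (fst p)\<bar> < e" "(Im (fst x), snd x) \<in> ball y0 d" for x
  proof -
    have x: "m (Re (fst x), (Im (fst x), snd x)) = x" by (simp add: m_def)
    have "(Re (fst x), (Im (fst x), snd x)) \<in> m -` V"
      using *(4) that by (auto simp: subset_eq abs_less_iff)
    then have "x \<in> V" by (simp add: x)
    then show ?thesis using sign[of x] *(6,7)[OF that] by (simp add: f_def x)
  qed
  have "\<phi> y0 = Re (fst p)"
    using *(7)[of "Re (fst p)" y0] *(1,2) f0 by simp
  then have "dir_deriv (1, 0) \<phi> y0 = 0"
    using dir_deriv_eq[OF *(8)[of y0]] *(2) by (simp add: df)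
  then show thesis using that[OF *(1,2) *(3,5)[unfolded y0_def] graph[unfolded y0_def]] unfolding y0_def by blast
qed

text \<open>The coordinate map \<open>\<Psi>\<close> brings \<open>\<Omega> \<inter> U\<close> near \<open>q\<close> into the form required by the theorem.\<close>

definition normal_form_at ::
    "complex2 set \<Rightarrow> complex2 set \<Rightarrow> nat \<Rightarrow> complex2 \<Rightarrow> (complex2 \<Rightarrow> complex2) \<Rightarrow> complex \<Rightarrow> bool" where
  "normal_form_at \<Omega> U r q \<Psi> c \<longleftrightarrow> (\<exists>(V :: complex2 set) (P :: complex poly poly) (R :: complex \<Rightarrow> real)
          (Q :: real \<times> complex \<Rightarrow> real).
          open V \<and> (0, 0) \<in> V \<and>
          zzbar_real_valued P \<and> zzbar_degree_le r P \<and> no_harmonic_terms P \<and>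
          smooth_on (snd ` V) R \<and> vanishing_order R > enat r \<and>
          smooth_on ((\<lambda>(w, z). (Im (w / c), z)) ` V) Q \<and>
          vanishing_order (\<lambda>(w, z). Q (Im (w / c), z)) \<ge> 1 \<and>
          \<Psi> ` (\<Omega> \<inter> U) \<inter> V =
            {(w, z) \<in> V. Re w + Re (zzbar_eval P z) + R z
                          + Im (w / c) * Q (Im (w / c), z) < 0} \<and>
          (\<forall>k. pseudoconvex_point \<Omega> q \<and> of_finite_type \<Omega> q (2 * k) \<and> r = 2 * k
                 \<longrightarrow> zzbar_homogeneous (2 * k) P))"

text \<open>With \<open>\<phi>~ (t, z)\<close> the sheared graph function, Hadamard's lemma gives
  \<open>\<phi>~ (t, z) = T z + t k (t, z)\<close> where \<open>T\<close> is the part on \<open>t = 0\<close> and \<open>k (0, 0) = a\<close>. After the dilation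
  by \<open>c\<close> the inequality \<open>Re w < \<phi>~ (Im w, z)\<close> becomes the asserted one, where \<open>P\<close> is the negative Taylor
  polynomial of \<open>T\<close>, \<open>R\<close> its negative remainder, and \<open>Q = a - k\<close>.\<close>

lemma normal_form_at_point:
  fixes \<Omega> U :: "complex2 set" and \<phi> :: "real \<times> complex \<Rightarrow> real" and q :: complex2
  defines "y \<equiv> (Im (fst q), snd q)"
  assumes D: "open D" and \<phi>: "smooth_on D \<phi>" and U: "open U" "q \<in> U" "q \<in> frontier \<Omega>" "r > 0"
    and UD: "\<And>x. x \<in> U \<Longrightarrow> (Im (fst x), snd x) \<in> D"
    and graph_U: "\<And>v. v \<in> D \<Longrightarrow> (Complex (\<phi> v) (fst v), snd v) \<in> U"
    and graph: "\<And>x. x \<in> U \<Longrightarrow> (x \<in> \<Omega> \<longleftrightarrow> Re (fst x) < \<phi> (Im (fst x), snd x)) \<and>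
      (x \<in> frontier \<Omega> \<longleftrightarrow> Re (fst x) = \<phi> (Im (fst x), snd x))"
    and H: "H holomorphic_on UNIV" "H 0 = 0"
    and dz: "\<And>k. k \<le> r \<Longrightarrow> (dz ^^ k) (\<lambda>z. of_real (sheared \<phi> y H z)) 0 = 0"
    and \<Psi>: "\<And>x. \<Psi> x = (c * (fst x - fst q + H (snd x - snd q)), snd x - snd q)"
    and c: "c = normal_factor \<phi> y"
  shows "normal_form_at \<Omega> U r q \<Psi> c"
proof -
  define a where "a = dir_deriv (1, 0) \<phi> y"
  have c0: "c \<noteq> 0" by (simp add: c normal_factor_def complex_eq_iff)
  have Rec: "Re (c * w) = Re w - a * Im w" for w
    by (simp add: c normal_factor_def a_def)
  have yD: "y \<in> D" using UD[OF U(2)] by (simp add: y_def)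
  have \<phi>y: "\<phi> y = Re (fst q)" using graph[OF U(2)] U(3) by (simp add: y_def)
  have sH: "smooth_on UNIV H" by (intro smooth_on_holomorphic open_UNIV H)
  \<comment> \<open>The inverse of the shear, and the new coordinates near \<open>q\<close>\<close>
  define X where "X = (\<lambda>(w, z). (fst q + w - H z, snd q + z))"
  have sX: "smooth_on UNIV X"
    unfolding X_def case_prod_unfold
    by (intro smooth_intros smooth_on_compose[OF sH, of UNIV snd] open_UNIV) auto
  have "open (X -` U)" using smooth_on_continuous_on[OF sX] U(1) by (rule open_vimage[rotated])
  moreover have "(0, 0) \<in> X -` U" using U(2) H(2) by (simp add: X_def)
  ultimately obtain \<epsilon> where \<epsilon>: "\<epsilon> > 0" "ball (0, 0) \<epsilon> \<subseteq> X -` U"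
    using open_contains_ball by blast
  \<comment> \<open>\<open>\<bar>w\<bar> \<le> \<bar>Re w\<bar> + \<bar>Im w\<bar>\<close>\<close>
  define \<delta> where "\<delta> = \<epsilon> / 3"
  have \<delta>: "\<delta> > 0" using \<epsilon> by (simp add: \<delta>_def)
  have XU: "X (w, z) \<in> U" if "\<bar>Re w\<bar> < \<delta>" "\<bar>Im w\<bar> < \<delta>" "norm z < \<delta>" for w z
  proof -
    have "norm (w, z) \<le> norm w + norm z" by (rule norm_Pair_le)
    also have "\<dots> \<le> \<bar>Re w\<bar> + \<bar>Im w\<bar> + norm z" using cmod_le[of w] by simp
    also have "\<dots> < \<epsilon>" using that by (simp add: \<delta>_def)
    finally have "(w, z) \<in> ball (0, 0) \<epsilon>" by (simp add: zero_prod_def[symmetric])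
    then show ?thesis using \<epsilon>(2) by blast
  qed
  define B where "B = {- \<delta><..<\<delta>} \<times> ball (0::complex) \<delta>"
  have B: "open B" "(0, 0) \<in> B" using \<delta> by (auto simp: B_def open_Times)
  define m where "m = (\<lambda>x. (fst y + fst x - Im (H (snd x)), snd y + snd x))"
  have sHs: "smooth_on UNIV (\<lambda>x::real \<times> complex. H (snd x))"
    by (intro smooth_on_compose[OF sH] smooth_intros open_UNIV) auto
  have sm: "smooth_on UNIV m" unfolding m_def by (intro smooth_intros sHs open_UNIV)
  have mD: "m x \<in> D" if "x \<in> B" for x
    using UD[OF XU[of "of_real 0 + \<i> * of_real (fst x)" "snd x"]] that \<delta>
    by (auto simp: B_def X_def m_def y_def)
  define g where "g = (\<lambda>x. \<phi> (m x) - \<phi> y + Re (H (snd x)))"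
  have sg: "smooth_on B g"
    unfolding g_def
    by (intro smooth_intros B smooth_on_compose[OF \<phi> smooth_on_subset[OF sm]] smooth_on_subset[OF sHs])
      (use mD in auto)
  define T where "T = sheared \<phi> y H"
  have gT: "g (0, z) = T z" for z by (simp add: g_def T_def sheared_def m_def)
  obtain k where k: "smooth_on B k" "\<And>t z. (t, z) \<in> B \<Longrightarrow> g (t, z) = g (0, z) + t * k (t, z)"
    "\<And>z. k (0, z) = dir_deriv (1, 0) g (0, z)"
  proof (rule hadamard_quotient[OF B(1) _ sg])
    fix s t :: real and z assume "(t, z) \<in> B" "s \<in> {0..1}"
    then have "\<bar>t\<bar> < \<delta>" "\<bar>s * t\<bar> \<le> \<bar>t\<bar>" "norm z < \<delta>"
      by (auto simp: B_def abs_mult mult_left_le_one_le)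
    then show "(s * t, z) \<in> B" by (auto simp: B_def)
  qed (rule that)
  have k0: "k (0, 0) = a"
  proof -
    have D\<phi>: "(\<phi> has_derivative (\<lambda>v. dir_deriv v \<phi> y)) (at y)"
      by (rule smooth_on_has_derivative[OF \<phi> yD])
    have m0: "m (0, 0) = y" using H(2) by (simp add: m_def)
    have mt: "((\<lambda>t. m (t, 0)) has_derivative (\<lambda>h. h *\<^sub>R (1, 0))) (at 0)"
      unfolding m_def using H(2) by (auto intro!: derivative_eq_intros)
    have "((\<lambda>t. \<phi> (m (t, 0))) has_derivative (\<lambda>h. dir_deriv (h *\<^sub>R (1, 0)) \<phi> y)) (at 0)"
      by (rule has_derivative_compose[OF mt]) (use D\<phi> m0 in simp)
    then have 1: "((\<lambda>t. g (t, 0)) has_derivative (\<lambda>h. h *\<^sub>R a)) (at 0)"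
      unfolding g_def linear_scale[OF has_derivative_linear[OF D\<phi>]] a_def[symmetric]
      by (auto intro!: derivative_eq_intros)
    have "((\<lambda>t. (t, 0::complex)) has_derivative (\<lambda>h. (h, 0))) (at 0)"
      by (auto intro!: derivative_eq_intros)
    from has_derivative_compose[OF this smooth_on_has_derivative[OF sg B(2)]]
    have "((\<lambda>t. g (t, 0)) has_derivative (\<lambda>h. dir_deriv (h, 0) g (0, 0))) (at 0)" .
    from has_derivative_unique[OF this 1] have "dir_deriv (1, 0) g (0, 0) = 1 *\<^sub>R a" by metis
    then show ?thesis using k(3) by simp
  qed
  have bB: "(0, z) \<in> B" if "z \<in> ball 0 \<delta>" for z using that \<delta> by (simp add: B_def)
  have sT: "smooth_on (ball 0 \<delta>) T"
  proof -
    have "smooth_on (ball 0 \<delta>) (\<lambda>z. g (0, z))"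
      by (rule smooth_on_compose[OF sg]) (use bB in \<open>auto intro!: smooth_intros\<close>)
    then show ?thesis by (simp add: gT)
  qed
  have b0: "(0::complex) \<in> ball 0 \<delta>" using \<delta> by simp
  obtain e where e: "vanishes_to_order (Suc r) (\<lambda>z. T z - Re (\<Sum>k\<le>r. hform (e k) k z))"
    "\<And>k z. hform (e k) k z \<in> \<real>" "\<And>k. k \<le> r \<Longrightarrow> e k 0 = 0 \<and> e k k = 0"
    by (rule real_taylor_no_harmonic[OF open_ball b0 sT dz[folded T_def]], assumption, rule that)
  define P where "P = zzpoly (\<lambda>k i. - e k i) r"
  have hneg: "hform (\<lambda>i. - e k i) k z = - hform (e k) k z" for k z
    by (simp add: hform_def sum_negf)
  have P: "zzbar_eval P z = - (\<Sum>k\<le>r. hform (e k) k z)" for z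
    by (simp add: P_def zzbar_eval_zzpoly hneg sum_negf)
  define R where "R = (\<lambda>z. - T z - Re (zzbar_eval P z))"
  have sR: "smooth_on (ball 0 \<delta>) R"
    unfolding R_def P by (intro smooth_intros sT open_ball finite_atMost)
  have R: "vanishes_to_order (Suc r) R"
    by (rule vanishes_to_order_comparable[OF e(1), where A=1]) (simp add: R_def P abs_minus_commute del: Re_sum)
  define Q where "Q = (\<lambda>x. a - k x)"
  have sQ: "smooth_on B Q" unfolding Q_def by (intro smooth_intros k(1) B)
  define V :: "complex2 set" where "V = (\<lambda>(w, z). (w / c, z)) -` {x. \<bar>Re (fst x)\<bar> < \<delta> \<and> \<bar>Im (fst x)\<bar> < \<delta> \<and> norm (snd x) < \<delta>}"
  have V: "(w, z) \<in> V \<longleftrightarrow> \<bar>Re (w / c)\<bar> < \<delta> \<and> \<bar>Im (w / c)\<bar> < \<delta> \<and> norm z < \<delta>" for w z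
    by (simp add: V_def)
  have oV: "open V" unfolding V_def case_prod_unfold
    by (intro open_vimage open_Collect_conj open_Collect_less continuous_intros) (use c0 in auto)
  have rep: "\<Psi> ` (\<Omega> \<inter> U) \<inter> V = {(w, z) \<in> V. Re w + Re (zzbar_eval P z) + R z
      + Im (w / c) * Q (Im (w / c), z) < 0}"
  proof -
    have iff: "(w, z) \<in> \<Psi> ` (\<Omega> \<inter> U) \<longleftrightarrow> Re w + Re (zzbar_eval P z) + R z + Im (w / c) * Q (Im (w / c), z) < 0"
      if wz: "(w, z) \<in> V" for w z
    proof -
      define v where "v = w / c"
      have v: "\<bar>Re v\<bar> < \<delta>" "\<bar>Im v\<bar> < \<delta>" "norm z < \<delta>" and w: "w = c * v"
        using wz c0 by (auto simp: V v_def)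
      let ?x = "X (v, z)"
      have x1: "\<Psi> ?x = (w, z)" by (simp add: \<Psi> X_def w)
      have x2: "x = ?x" if "\<Psi> x = (w, z)" for x
        using that c0 by (cases x) (auto simp: \<Psi> X_def w)
      have "(w, z) \<in> \<Psi> ` (\<Omega> \<inter> U) \<longleftrightarrow> ?x \<in> \<Omega> \<inter> U"
      proof
        assume "(w, z) \<in> \<Psi> ` (\<Omega> \<inter> U)"
        then obtain x where "x \<in> \<Omega> \<inter> U" "\<Psi> x = (w, z)" by force
        then show "?x \<in> \<Omega> \<inter> U" using x2[of x] by simp
      next
        assume "?x \<in> \<Omega> \<inter> U"
        then have "\<Psi> ?x \<in> \<Psi> ` (\<Omega> \<inter> U)" by (rule imageI)
        then show "(w, z) \<in> \<Psi> ` (\<Omega> \<inter> U)" unfolding x1 .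
      qed
      also have "\<dots> \<longleftrightarrow> Re (fst ?x) < \<phi> (Im (fst ?x), snd ?x)"
        using graph[OF XU[OF v]] XU[OF v] by blast
      also have "(Im (fst ?x), snd ?x) = m (Im v, z)" by (simp add: X_def m_def y_def)
      also have "Re (fst ?x) < \<phi> (m (Im v, z)) \<longleftrightarrow> Re v < g (Im v, z)"
        by (auto simp: g_def X_def \<phi>y)
      also have "g (Im v, z) = T z + Im v * k (Im v, z)"
        using k(2)[of "Im v" z] v by (simp add: gT B_def abs_less_iff)
      also have "Re v < T z + Im v * k (Im v, z) \<longleftrightarrow> Re w + Re (zzbar_eval P z) + R z + Im v * Q (Im v, z) < 0"
        unfolding w Rec by (simp add: R_def Q_def algebra_simps)
      finally show ?thesis unfolding v_def .
    qed
    then show ?thesis by blast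
  qed
  have homogeneous: "zzbar_homogeneous r P" if type: "of_finite_type \<Omega> q r"
  proof -
    obtain V' \<rho> where V': "local_defining_function \<Omega> q V' \<rho>" and type: "dangelo_type \<rho> q = ereal (real r)"
      using type unfolding of_finite_type_def by blast
    have \<rho>: "open V'" "q \<in> V'" "smooth_on V' \<rho>" "frechet_derivative \<rho> (at q) \<noteq> (\<lambda>_. 0)"
      and \<rho>0: "\<And>x. x \<in> V' \<Longrightarrow> x \<in> frontier \<Omega> \<Longrightarrow> \<rho> x = 0"
      using V' U(3) unfolding local_defining_function_def by auto
    have zero: "\<forall>\<^sub>F v in nhds y. \<rho> (Complex (\<phi> v) (fst v), snd v) = 0"
    proof -
      have s: "smooth_on D (\<lambda>v. (Complex (\<phi> v) (fst v), snd v))"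
        unfolding Complex_eq by (intro smooth_intros \<phi> D)
      have "open (D \<inter> (\<lambda>v. (Complex (\<phi> v) (fst v), snd v)) -` V')"
        by (rule continuous_open_preimage[OF smooth_on_continuous_on[OF s] D \<rho>(1)])
      moreover have "y \<in> D \<inter> (\<lambda>v. (Complex (\<phi> v) (fst v), snd v)) -` V'"
        using yD \<phi>y \<rho>(2) by (cases q) (simp add: y_def)
      ultimately have "\<forall>\<^sub>F v in nhds y. v \<in> D \<inter> (\<lambda>v. (Complex (\<phi> v) (fst v), snd v)) -` V'"
        by (rule eventually_nhds_in_open)
      then show ?thesis
        by (rule eventually_mono) (use \<rho>0 graph graph_U in force)
    qed
    define F where "F = (\<lambda>x::complex2. Re (fst x) - \<phi> (Im (fst x), snd x))"
    obtain A where A: "\<forall>\<^sub>F x in nhds q. \<bar>\<rho> x\<bar> \<le> A * \<bar>F x\<bar>" "\<forall>\<^sub>F x in nhds q. \<bar>F x\<bar> \<le> A * \<bar>\<rho> x\<bar>"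
      unfolding F_def
      by (rule defining_function_comparable[OF \<rho> D yD[unfolded y_def] \<phi> \<phi>y[unfolded y_def] zero[unfolded y_def]])
    define N where "N = (\<lambda>x. k x - a)"
    have N: "(N \<longlongrightarrow> 0) (nhds 0)"
    proof -
      have "isCont k (0, 0)"
        using smooth_on_continuous_on[OF k(1)] continuous_on_eq_continuous_at[OF B(1)] B(2) by blast
      then have "(k \<longlongrightarrow> k (0, 0)) (nhds (0, 0))" unfolding isCont_def tendsto_at_iff_tendsto_nhds .
      then have "((\<lambda>x. k x - a) \<longlongrightarrow> k (0, 0) - a) (nhds (0, 0))" by (intro tendsto_intros)
      then show ?thesis by (simp add: N_def k0 zero_prod_def)
    qed
    have F: "\<forall>\<^sub>F x in nhds q. F x = Re (c * (fst x - fst q + H (snd x - snd q))) - T (snd x - snd q)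
      - Im (fst x - fst q + H (snd x - snd q)) * N (Im (fst x - fst q + H (snd x - snd q)), snd x - snd q)"
    proof -
      define l where "l = (\<lambda>x::complex2. (Im (fst x - fst q + H (snd x - snd q)), snd x - snd q))"
      have "smooth_on UNIV l" unfolding l_def
        by (intro smooth_intros smooth_on_compose[OF sH] open_UNIV) auto
      then have "open (l -` B)" using smooth_on_continuous_on B(1) by (metis open_vimage)
      moreover have "q \<in> l -` B" using B(2) H(2) by (simp add: l_def)
      ultimately have "\<forall>\<^sub>F x in nhds q. x \<in> l -` B" by (rule eventually_nhds_in_open)
      then show ?thesis
      proof (rule eventually_mono)
        fix x assume "x \<in> l -` B"
        then have lB: "l x \<in> B" by simp
        define w where "w = fst x - fst q + H (snd x - snd q)"
        define z where "z = snd x - snd q"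
        have lx: "l x = (Im w, z)" by (simp add: l_def w_def z_def)
        have "g (Im w, z) = T z + Im w * k (Im w, z)"
          using k(2)[of "Im w" z] lB by (simp add: lx gT)
        moreover have "m (Im w, z) = (Im (fst x), snd x)"
          by (simp add: m_def w_def z_def y_def)
        moreover have "Re (fst x) = Re w + Re (fst q) - Re (H z)" by (simp add: w_def z_def)
        ultimately have "F x = Re w - T z - Im w * k (Im w, z)"
          by (simp add: F_def g_def \<phi>y z_def)
        then have "F x = Re (c * w) - T z - Im w * N (Im w, z)"
          unfolding Rec N_def by (simp add: algebra_simps)
        then show "F x = Re (c * (fst x - fst q + H (snd x - snd q))) - T (snd x - snd q)
          - Im (fst x - fst q + H (snd x - snd q)) * N (Im (fst x - fst q + H (snd x - snd q)), snd x - snd q)"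
          unfolding w_def z_def .
      qed
    qed
    have h: "(\<forall>k<r. \<forall>i\<le>k. e k i = 0) \<and> (\<exists>i\<le>r. e r i \<noteq> 0)"
      by (rule dangelo_type_eq_imp_homogeneous[OF \<rho>(1,2,3) A H c0 N F e(1) e(3,2) type])
    then obtain i where i: "i \<le> r" "e r i \<noteq> 0" by blast
    then have "coeff (coeff P (r - i)) i \<noteq> 0" by (simp add: P_def coeff_zzpoly)
    then have "P \<noteq> 0" by auto
    moreover have "i + j = r" if "coeff (coeff P j) i \<noteq> 0" for i j
    proof (rule ccontr)
      assume "i + j \<noteq> r"
      then show False using that h by (auto simp: P_def coeff_zzpoly split: if_splits)
    qed
    ultimately show ?thesis by (simp add: zzbar_homogeneous_def)
  qed
  show ?thesis
    unfolding normal_form_at_def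
  proof (intro exI conjI allI impI)
    show "open V" by (rule oV)
    show "(0, 0) \<in> V" using \<delta> by (simp add: V)
    show "zzbar_real_valued P"
      unfolding zzbar_real_valued_def P using e(2) by (auto intro!: sum_in_Reals)
    show "zzbar_degree_le r P"
      unfolding zzbar_degree_le_def P_def coeff_zzpoly by auto
    show "no_harmonic_terms P"
      unfolding no_harmonic_terms_def P_def coeff_zzpoly using e(3) by auto
    show "smooth_on (snd ` V) R"
      by (rule smooth_on_subset[OF sR]) (auto simp: V)
    have "enat (Suc r) \<le> vanishing_order R"
      using enat_le_vanishing_order_iff_vanishes_to_order[OF open_ball b0 sR] R by blast
    then show "vanishing_order R > enat r" by (simp add: Suc_ile_eq)
    show "smooth_on ((\<lambda>(w, z). (Im (w / c), z)) ` V) Q"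
      by (rule smooth_on_subset[OF sQ]) (auto simp: V B_def abs_less_iff)
    show "vanishing_order (\<lambda>(w, z). Q (Im (w / c), z)) \<ge> 1"
      unfolding one_enat_def enat_le_vanishing_order_iff by (auto simp: Q_def k0 zero_prod_def)
    show "\<Psi> ` (\<Omega> \<inter> U) \<inter> V = {(w, z) \<in> V. Re w + Re (zzbar_eval P z) + R z
      + Im (w / c) * Q (Im (w / c), z) < 0}" by (rule rep)
  next
    fix k assume "pseudoconvex_point \<Omega> q \<and> of_finite_type \<Omega> q (2 * k) \<and> r = 2 * k"
    then show "zzbar_homogeneous (2 * k) P" using homogeneous by simp
  qed
qed

theorem proposition2p3:
  fixes \<Omega> :: "complex2 set" and p :: complex2 and r :: nat
  assumes "open \<Omega>" and "connected \<Omega>" and "smooth_boundary \<Omega>"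
    and "p \<in> frontier \<Omega>" and "r > 0"
    and "outward_unit_normal \<Omega> p (1, 0)"
  shows "\<exists>U (\<Psi> :: complex2 \<Rightarrow> complex2 \<Rightarrow> complex2) (c :: complex2 \<Rightarrow> complex).
    open U \<and> p \<in> U \<and>
    continuous_on ((frontier \<Omega> \<inter> U) \<times> UNIV) (\<lambda>(q, x). \<Psi> q x) \<and>
    (c \<longlongrightarrow> 1) (at p within frontier \<Omega> \<inter> U) \<and>
    (\<forall>q\<in>frontier \<Omega> \<inter> U.
       translation_dilation_triangular (\<Psi> q) \<and>
       \<Psi> q q = (0, 0) \<and>
       Re (c q) \<noteq> 0 \<and>
       (\<exists>(V :: complex2 set) (P :: complex poly poly) (R :: complex \<Rightarrow> real)
          (Q :: real \<times> complex \<Rightarrow> real).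
          open V \<and> (0, 0) \<in> V \<and>
          zzbar_real_valued P \<and> zzbar_degree_le r P \<and> no_harmonic_terms P \<and>
          smooth_on (snd ` V) R \<and> vanishing_order R > enat r \<and>
          smooth_on ((\<lambda>(w, z). (Im (w / c q), z)) ` V) Q \<and>
          vanishing_order (\<lambda>(w, z). Q (Im (w / c q), z)) \<ge> 1 \<and>
          \<Psi> q ` (\<Omega> \<inter> U) \<inter> V =
            {(w, z) \<in> V. Re w + Re (zzbar_eval P z) + R z
                          + Im (w / c q) * Q (Im (w / c q), z) < 0} \<and>
          (\<forall>k. pseudoconvex_point \<Omega> q \<and> of_finite_type \<Omega> q (2 * k) \<and> r = 2 * k
                 \<longrightarrow> zzbar_homogeneous (2 * k) P)))"
proof -
  define Y where "Y = (\<lambda>x::complex2. (Im (fst x), snd x))"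
  have Y: "Y x = (Im (fst x), snd x)" for x by (simp add: Y_def)
  obtain e d \<phi> where ed: "e > 0" "d > 0" and \<phi>: "smooth_on (ball (Y p) d) \<phi>"
    and \<phi>e: "\<And>y. y \<in> ball (Y p) d \<Longrightarrow> \<bar>\<phi> y - Re (fst p)\<bar> < e"
    and graph: "\<And>x. \<bar>Re (fst x) - Re (fst p)\<bar> < e \<Longrightarrow> Y x \<in> ball (Y p) d \<Longrightarrow>
      (x \<in> \<Omega> \<longleftrightarrow> Re (fst x) < \<phi> (Y x)) \<and> (x \<in> frontier \<Omega> \<longleftrightarrow> Re (fst x) = \<phi> (Y x))"
    and \<phi>p: "dir_deriv (1, 0) \<phi> (Y p) = 0"
    by (rule smooth_boundary_graph[OF assms(6,4), folded Y], rule that)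
  define D where "D = ball (Y p) d"
  have D: "open D" "Y p \<in> D" using ed by (auto simp: D_def)
  have cY: "continuous_on S Y" for S unfolding Y_def by (intro continuous_intros)
  define U where "U = {x. \<bar>Re (fst x) - Re (fst p)\<bar> < e} \<inter> Y -` D"
  have U: "open U" "p \<in> U"
    unfolding U_def using ed D
    by (auto intro!: open_Int open_vimage open_Collect_less continuous_intros cY)
  obtain b where b: "\<And>i. smooth_on D (b i)" and b0: "\<And>y k. y \<in> D \<Longrightarrow> k \<le> r \<Longrightarrow>
      (dz ^^ k) (\<lambda>z. of_real (sheared \<phi> y (\<lambda>z. \<Sum>i<r. b i y * z ^ Suc i) z)) 0 = 0"
    using exists_shear[OF D(1) \<phi>[folded D_def], of r] by blast
  define H where "H = (\<lambda>q z. \<Sum>i<r. b i (Y q) * z ^ Suc i)"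
  define c where "c = (\<lambda>q. normal_factor \<phi> (Y q))"
  define \<Psi> where "\<Psi> = (\<lambda>q x. (c q * (fst x - fst q + H q (snd x - snd q)), snd x - snd q))"
  have cn: "continuous_on D (normal_factor \<phi>)"
  proof -
    have "normal_factor \<phi> = (\<lambda>y. 1 + \<i> * of_real (dir_deriv (1, 0) \<phi> y))"
      by (rule ext) (simp add: normal_factor_def complex_eq_iff)
    then show ?thesis
      using smooth_on_continuous_on[OF smooth_on_dir_deriv[OF \<phi>[folded D_def]]]
      by (auto intro!: continuous_intros)
  qed
  have Uq: "Y q \<in> D" if "q \<in> U" for q using that by (simp add: U_def)
  have cf: "continuous_on S (\<lambda>x. f (Y (g x)))" if "continuous_on D f" "continuous_on S g" "g ` S \<subseteq> U"
    for f :: "real \<times> complex \<Rightarrow> complex" and g and S :: "'x::topological_space set"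
    by (rule continuous_on_compose2[OF that(1) continuous_on_compose2[OF cY that(2) order_refl]])
      (use that(3) Uq in blast)
  have continuous: "continuous_on ((frontier \<Omega> \<inter> U) \<times> UNIV) (\<lambda>(q, x). \<Psi> q x)"
    unfolding \<Psi>_def H_def c_def case_prod_unfold
    by (intro continuous_intros cf[OF cn] cf[OF smooth_on_continuous_on[OF b]]) auto
  have limit: "(c \<longlongrightarrow> 1) (at p within frontier \<Omega> \<inter> U)"
  proof -
    have "continuous_on U c" unfolding c_def by (rule cf[OF cn]) (auto intro!: continuous_intros)
    then have "(c \<longlongrightarrow> c p) (at p within U)" using U(2) by (simp add: continuous_on_def)
    moreover have "c p = 1" by (simp add: c_def normal_factor_def \<phi>p complex_eq_iff)
    ultimately have "(c \<longlongrightarrow> 1) (at p within U)" by simp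
    then show ?thesis by (rule tendsto_within_subset) blast
  qed
  have maps: "translation_dilation_triangular (\<Psi> q)" "\<Psi> q q = (0, 0)" "Re (c q) \<noteq> 0" for q
  proof -
    define h where "h = smult (c q) (\<Sum>i<r. monom (b i (Y q)) (Suc i))"
    have "c q \<noteq> 0" by (simp add: c_def normal_factor_def complex_eq_iff)
    moreover have "\<Psi> q = triangular_map h \<circ> dilation_map (c q) 1 \<circ> translation_map (- q)"
      by (rule ext) (simp add: \<Psi>_def H_def h_def triangular_map_def dilation_map_def translation_map_def
        poly_sum poly_monom case_prod_unfold algebra_simps)
    ultimately show "translation_dilation_triangular (\<Psi> q)"
      unfolding translation_dilation_triangular_def by (metis zero_neq_one)
    show "\<Psi> q q = (0, 0)" by (simp add: \<Psi>_def H_def)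
    show "Re (c q) \<noteq> 0" by (simp add: c_def normal_factor_def)
  qed
  have local: "normal_form_at \<Omega> U r q (\<Psi> q) (c q)"
    if q: "q \<in> frontier \<Omega> \<inter> U" for q
  proof (rule normal_form_at_point[where D=D and \<phi>=\<phi> and H="H q"])
    show "open D" "smooth_on D \<phi>" "open U" "q \<in> U" "q \<in> frontier \<Omega>" "r > 0"
      using D \<phi> U q assms(5) by (auto simp: D_def)
    show "(Im (fst x), snd x) \<in> D" if "x \<in> U" for x using Uq[OF that] by (simp add: Y_def)
    show "(Complex (\<phi> v) (fst v), snd v) \<in> U" if "v \<in> D" for v
      using \<phi>e[of v] that by (simp add: U_def Y_def D_def)
    show "(x \<in> \<Omega> \<longleftrightarrow> Re (fst x) < \<phi> (Im (fst x), snd x)) \<and>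
      (x \<in> frontier \<Omega> \<longleftrightarrow> Re (fst x) = \<phi> (Im (fst x), snd x))" if "x \<in> U" for x
      using graph[of x] that by (simp add: U_def D_def Y_def)
    show "H q holomorphic_on UNIV" "H q 0 = 0"
      unfolding H_def by (auto intro!: holomorphic_intros)
    show "(dz ^^ k) (\<lambda>z. of_real (sheared \<phi> (Im (fst q), snd q) (H q) z)) 0 = 0" if "k \<le> r" for k
      using b0[OF Uq that, of q] q by (simp add: H_def Y_def)
    show "\<Psi> q x = (c q * (fst x - fst q + H q (snd x - snd q)), snd x - snd q)" for x
      by (simp add: \<Psi>_def)
    show "c q = normal_factor \<phi> (Im (fst q), snd q)" by (simp add: c_def Y_def)
  qed
  show ?thesis
    by (rule exI[of _ U], rule exI[of _ \<Psi>], rule exI[of _ c])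
      (intro conjI ballI U continuous limit maps local[unfolded normal_form_at_def])
qed

end
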